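(* Let $X$ be a cocompact connected proper metric space with $\operatorname{AN-asdim} X<\infty$. Then $\operatorname{AN-asdim} X=\dim \nu_L X$, where $\operatorname{AN-asdim}$ is the asymptotic Assouad-Nagata dimension, $\nu_L X$ is the sublinear Higson corona of $X$, and $\dim$ is the covering dimension.
   Context: A metric space is proper if its closed bounded subsets are compact. A metric space $X$ is cocompact if there is a compact $K\subset X$ with $X=\bigcup_{\gamma\in \operatorname{Isom}(X)}\gamma(K)$, where $\operatorname{Isom}(X)$ is the set of all isometries of $X$. Spaces are nonempty. Asymptotic Assouad-Nagata dimension: $\operatorname{AN-asdim} X\le n$ if there are $c>0$ and $r_0>0$ such that for every $r\ge r_0$ there is a cover $\mathcal U$ of $X$ with $\operatorname{mesh}\mathcal U=\sup_{U\in\mathcal U}\operatorname{diam}U\le cr$, Lebesgue number $L(\mathcal U)=\inf_{x\in X}\sup_{U\in\mathcal U}d(x,X\setminus U)>r$ (with $d(x,\emptyset)=\infty$), and multiplicity $\le n+1$ (every intersection of $n+2$ distinct elements of $\mathcal U$ is empty). $\operatorname{AN-asdim}X$ is the least such $n\in\{0,1,2,\dots\}$, or $\infty$ if there is none. Sublinear Higson corona: let $(X,d)$ be a proper metric space with basepoint $x_0$ and $\|x\|=d(x,x_0)$. For $E\subset X\times X$ let $E^{-1}=\{(x,y):(y,x)\in E\}$, $E[K]=\{x': (x',x)\in E\text{ for some }x\in K\}$, $E_x=E[\{x\}]$, $E^x=E^{-1}[\{x\}]$. $E$ is proper if $E[K]$ and $E^{-1}[K]$ are relatively compact for each relatively compact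 $K\subset X$. The sublinear coarse structure $\mathcal E_L$ consists of all proper $E\subset X\times X$ with $\lim_{\|x\|\to\infty}\frac{\sup_{y\in E_x}d(y,x)}{\|x\|}=0=\lim_{\|x\|\to\infty}\frac{\sup_{y\in E^x}d(x,y)}{\|x\|}$ (sup over the empty set is $0$; it does not depend on $x_0$). A bounded continuous $f:X\to\mathbb C$ is a Higson function, $f\in C_h(X,\mathcal E_L)$, if for every $E\in\mathcal E_L$ and $\epsilon>0$ there is a compact $K\subset X$ with $|f(x)-f(y)|<\epsilon$ whenever $(y,x)\in E\setminus (K\times K)$. The sublinear Higson compactification $h_LX$ is the compactification of $X$ such that a bounded continuous function $X\to\mathbb C$ extends continuously to $h_LX$ iff it lies in $C_h(X,\mathcal E_L)$; $\nu_LX=h_LX\setminus X$. Convention: covering dimension takes values in $\{0,1,2,\dots\}\cup\{\infty\}$; in particular $\dim\emptyset=0$ (relevant only if $X$ is compact). *)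

theory Defs
  imports "HOL-Analysis.Analysis"
begin

text \<open>A metric space is represented by a subset \<open>X\<close> of a type of class \<open>metric_space\<close>, with the
  induced metric. Suprema and infima of distances are taken in \<^typ>\<open>ennreal\<close>, where
  \<open>Sup {} = 0\<close> and \<open>Inf {} = \<infinity>\<close>.\<close>

definition proper_metric :: "'a::metric_space set \<Rightarrow> bool" where
  "proper_metric X \<longleftrightarrow>
     (\<forall>S. closedin (top_of_set X) S \<and> bounded S \<longrightarrow> compact S)"

definition Isom :: "'a::metric_space set \<Rightarrow> ('a \<Rightarrow> 'a) set" where
  "Isom X = {\<gamma>. bij_betw \<gamma> X X \<and> (\<forall>x\<in>X. \<forall>y\<in>X. dist (\<gamma> x) (\<gamma> y) = dist x y)}"

definition cocompact :: "'a::metric_space set \<Rightarrow> bool" where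
  "cocompact X \<longleftrightarrow> (\<exists>K. K \<subseteq> X \<and> compact K \<and> X = (\<Union>\<gamma>\<in>Isom X. \<gamma> ` K))"

definition multiplicity_le :: "'a set set \<Rightarrow> nat \<Rightarrow> bool" where
  "multiplicity_le \<U> m \<longleftrightarrow> (\<forall>\<V>\<subseteq>\<U>. finite \<V> \<and> card \<V> = m + 1 \<longrightarrow> \<Inter>\<V> = {})"

subsection \<open>Asymptotic Assouad-Nagata dimension\<close>

definition ediam :: "'a::metric_space set \<Rightarrow> ennreal" where
  "ediam U = (SUP x\<in>U. SUP y\<in>U. ennreal (dist x y))"

definition mesh :: "'a::metric_space set set \<Rightarrow> ennreal" where
  "mesh \<U> = (SUP U\<in>\<U>. ediam U)"

definition esetdist :: "'a::metric_space \<Rightarrow> 'a set \<Rightarrow> ennreal" where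
  "esetdist x A = (INF y\<in>A. ennreal (dist x y))"

definition Lebesgue_number :: "'a::metric_space set \<Rightarrow> 'a set set \<Rightarrow> ennreal" where
  "Lebesgue_number X \<U> = (INF x\<in>X. SUP U\<in>\<U>. esetdist x (X - U))"

definition AN_asdim_le :: "'a::metric_space set \<Rightarrow> nat \<Rightarrow> bool" where
  "AN_asdim_le X n \<longleftrightarrow>
     (\<exists>c>0. \<exists>r0>0. \<forall>r\<ge>r0. \<exists>\<U>. \<Union>\<U> = X \<and> mesh \<U> \<le> ennreal (c * r) \<and>
        Lebesgue_number X \<U> > ennreal r \<and> multiplicity_le \<U> (n + 1))"

definition AN_asdim :: "'a::metric_space set \<Rightarrow> enat" where
  "AN_asdim X = (INF n\<in>{n. AN_asdim_le X n}. enat n)"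

subsection \<open>Covering dimension\<close>

definition covering_dim_le :: "'a topology \<Rightarrow> nat \<Rightarrow> bool" where
  "covering_dim_le T n \<longleftrightarrow>
     (\<forall>\<U>. finite \<U> \<and> (\<forall>U\<in>\<U>. openin T U) \<and> \<Union>\<U> = topspace T \<longrightarrow>
        (\<exists>\<V>. finite \<V> \<and> (\<forall>V\<in>\<V>. openin T V) \<and> \<Union>\<V> = topspace T \<and>
             (\<forall>V\<in>\<V>. \<exists>U\<in>\<U>. V \<subseteq> U) \<and> multiplicity_le \<V> (n + 1)))"

definition covering_dim :: "'a topology \<Rightarrow> enat" where
  "covering_dim T = (INF n\<in>{n. covering_dim_le T n}. enat n)"

subsection \<open>The sublinear coarse structure and its Higson functions\<close>

text \<open>\<open>E[K]\<close>: the first coordinates of pairs in \<open>E\<close> with second coordinate in \<open>K\<close>, i.e. the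
  library's \<open>E\<inverse> `` K\<close>.\<close>

definition ent_image :: "('a \<times> 'a) set \<Rightarrow> 'a set \<Rightarrow> 'a set" where
  "ent_image E K = {x'. \<exists>x\<in>K. (x', x) \<in> E}"

definition relatively_compact :: "'a::metric_space set \<Rightarrow> 'a set \<Rightarrow> bool" where
  "relatively_compact X K \<longleftrightarrow> K \<subseteq> X \<and> compact (X \<inter> closure K)"

definition proper_entourage :: "'a::metric_space set \<Rightarrow> ('a \<times> 'a) set \<Rightarrow> bool" where
  "proper_entourage X E \<longleftrightarrow> E \<subseteq> X \<times> X \<and>
     (\<forall>K. relatively_compact X K \<longrightarrow>
        relatively_compact X (ent_image E K) \<and> relatively_compact X (ent_image (E\<inverse>) K))"

text \<open>The filter of \<open>x \<in> X\<close> with \<open>dist x x0 \<rightarrow> \<infinity>\<close>.\<close>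

definition to_infinity :: "'a::metric_space set \<Rightarrow> 'a \<Rightarrow> 'a filter" where
  "to_infinity X x0 = inf (filtercomap (\<lambda>x. dist x x0) at_top) (principal X)"

definition sublinear_structure :: "'a::metric_space set \<Rightarrow> 'a \<Rightarrow> ('a \<times> 'a) set set" where
  "sublinear_structure X x0 = {E. proper_entourage X E \<and>
     ((\<lambda>x. (SUP y\<in>ent_image E {x}. ennreal (dist y x)) / ennreal (dist x x0))
        \<longlongrightarrow> 0) (to_infinity X x0) \<and>
     ((\<lambda>x. (SUP y\<in>ent_image (E\<inverse>) {x}. ennreal (dist x y)) / ennreal (dist x x0))
        \<longlongrightarrow> 0) (to_infinity X x0)}"

definition bounded_continuous :: "'a::metric_space set \<Rightarrow> ('a \<Rightarrow> complex) \<Rightarrow> bool" where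
  "bounded_continuous X f \<longleftrightarrow> continuous_on X f \<and> bounded (f ` X)"

definition Higson_functions ::
    "'a::metric_space set \<Rightarrow> ('a \<times> 'a) set set \<Rightarrow> ('a \<Rightarrow> complex) set" where
  "Higson_functions X \<E> = {f. bounded_continuous X f \<and>
     (\<forall>E\<in>\<E>. \<forall>\<epsilon>>0. \<exists>K. K \<subseteq> X \<and> compact K \<and>
        (\<forall>x y. (y, x) \<in> E - K \<times> K \<longrightarrow> cmod (f x - f y) < \<epsilon>))}"

subsection \<open>The sublinear Higson compactification and corona\<close>

definition compactification ::
    "'a::metric_space set \<Rightarrow> 'b topology \<Rightarrow> ('a \<Rightarrow> 'b) \<Rightarrow> bool" where
  "compactification X H e \<longleftrightarrow> compact_space H \<and> Hausdorff_space H \<and>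
     embedding_map (top_of_set X) H e \<and> H closure_of (e ` X) = topspace H"

definition extends_continuously ::
    "'a set \<Rightarrow> 'b topology \<Rightarrow> ('a \<Rightarrow> 'b) \<Rightarrow> ('a \<Rightarrow> complex) \<Rightarrow> bool" where
  "extends_continuously X H e f \<longleftrightarrow>
     (\<exists>F. continuous_map H euclidean F \<and> (\<forall>x\<in>X. F (e x) = f x))"

text \<open>The sublinear Higson compactification is determined only up to homeomorphism under \<open>X\<close>;
  the predicate holds of each of its realizations \<open>(H, e)\<close>.\<close>

definition sublinear_Higson_compactification ::
    "'a::metric_space set \<Rightarrow> 'a \<Rightarrow> 'b topology \<Rightarrow> ('a \<Rightarrow> 'b) \<Rightarrow> bool" where
  "sublinear_Higson_compactification X x0 H e \<longleftrightarrow> compactification X H e \<and>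
     (\<forall>f. bounded_continuous X f \<longrightarrow>
        (extends_continuously X H e f \<longleftrightarrow>
           f \<in> Higson_functions X (sublinear_structure X x0)))"

definition corona :: "'a set \<Rightarrow> 'b topology \<Rightarrow> ('a \<Rightarrow> 'b) \<Rightarrow> 'b topology" where
  "corona X H e = subtopology H (topspace H - e ` X)"

subsection \<open>Existence of the sublinear Higson compactification\<close>

lemma bump_Higson:
  assumes X: "proper_metric X" and a: "a \<in> X" and r: "r > 0"
    and \<E>: "\<And>E. E \<in> \<E> \<Longrightarrow> proper_entourage X E"
  shows "(\<lambda>x. complex_of_real (max 0 (1 - dist x a / r))) \<in> Higson_functions X \<E>"
proof -
  define f where "f = (\<lambda>x. complex_of_real (max 0 (1 - dist x a / r)))"
  define K where "K = X \<inter> cball a r"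
  have f0: "f x = 0" if "x \<in> X" "x \<notin> K" for x
    using that r by (auto simp: f_def K_def dist_commute field_simps max_def)
  have "norm (f x) \<le> 1" for x
    using r by (auto simp: f_def norm_of_real)
  then have "bounded (f ` X)"
    by (auto simp: bounded_iff)
  moreover have "continuous_on X f"
    unfolding f_def using r by (intro continuous_intros) auto
  moreover have K: "compact K"
    using X unfolding proper_metric_def K_def
    by (meson bounded_Int bounded_cball closed_cball closedin_closed_Int)
  then have rK: "relatively_compact X K"
    unfolding relatively_compact_def by (simp add: closure_closed compact_imp_closed K_def Int_absorb1)
  have "\<exists>K'. K' \<subseteq> X \<and> compact K' \<and> (\<forall>x y. (y, x) \<in> E - K' \<times> K' \<longrightarrow> cmod (f x - f y) < \<epsilon>)"
    if "E \<in> \<E>" "\<epsilon> > 0" for E \<epsilon>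
  proof -
    have E: "E \<subseteq> X \<times> X" and "relatively_compact X (ent_image E K)"
      "relatively_compact X (ent_image (E\<inverse>) K)"
      using \<E>[OF \<open>E \<in> \<E>\<close>] rK by (auto simp: proper_entourage_def)
    then have c: "compact (X \<inter> closure (ent_image E K))" "compact (X \<inter> closure (ent_image (E\<inverse>) K))"
      by (auto simp: relatively_compact_def)
    define K' where "K' = K \<union> X \<inter> closure (ent_image E K) \<union> X \<inter> closure (ent_image (E\<inverse>) K)"
    have "compact K'" "K' \<subseteq> X"
      using c K by (auto simp: K'_def K_def)
    moreover have "cmod (f x - f y) < \<epsilon>" if yx: "(y, x) \<in> E - K' \<times> K'" for x y
    proof -
      have xy: "x \<in> X" "y \<in> X" using yx E by auto
      have "x \<notin> K \<and> y \<notin> K"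
      proof (rule ccontr)
        assume "\<not> (x \<notin> K \<and> y \<notin> K)"
        then have "x \<in> K' \<and> y \<in> K'"
          using yx xy closure_subset[of "ent_image E K"] closure_subset[of "ent_image (E\<inverse>) K"]
          by (auto simp: K'_def ent_image_def)
        then show False using yx by auto
      qed
      then show ?thesis using f0 xy \<open>\<epsilon> > 0\<close> by auto
    qed
    ultimately show ?thesis by blast
  qed
  ultimately show ?thesis
    unfolding Higson_functions_def bounded_continuous_def f_def[symmetric] by auto
qed

theorem sublinear_Higson_compactification_exists:
  fixes X :: "'a::metric_space set"
  assumes X: "proper_metric X"
  shows "\<exists>(H :: (('a \<Rightarrow> complex) \<Rightarrow> complex) topology) e.
           sublinear_Higson_compactification X x0 H e"
proof -
  define \<E> where "\<E> = sublinear_structure X x0"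
  define C where "C = Higson_functions X \<E>"
  define P where "P = product_topology (\<lambda>f::'a\<Rightarrow>complex. euclidean::complex topology) C"
  define e where "e = (\<lambda>x. \<lambda>f\<in>C. f x :: complex)"
  define S where "S = P closure_of (e ` X)"
  define H where "H = subtopology P S"
  have \<E>: "proper_entourage X E" if "E \<in> \<E>" for E
    using that by (auto simp: \<E>_def sublinear_structure_def)
  have C: "continuous_on X f" "bounded (f ` X)" if "f \<in> C" for f
    using that by (auto simp: C_def Higson_functions_def bounded_continuous_def)
  have tP: "topspace P = extensional C"
    by (auto simp: P_def PiE_def)
  have eX: "e ` X \<subseteq> S"
    unfolding S_def by (rule closure_of_subset) (auto simp: tP e_def)
  have SP: "S \<subseteq> topspace P"
    unfolding S_def by (rule closure_of_subset_topspace)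
  have tH: "topspace H = S"
    using SP by (auto simp: H_def)
  have e_cont: "continuous_map (top_of_set X) P e"
    unfolding P_def continuous_map_componentwise
    using C by (auto simp: e_def)
  have haus: "Hausdorff_space H"
    unfolding H_def P_def by (intro Hausdorff_space_subtopology) (auto simp: Hausdorff_space_product_topology)
  have "\<forall>f\<in>C. \<exists>B. \<forall>x\<in>X. cmod (f x) \<le> B"
    using C(2) unfolding bounded_iff by auto
  from bchoice[OF this] obtain B where B: "\<And>f x. f \<in> C \<Longrightarrow> x \<in> X \<Longrightarrow> cmod (f x) \<le> B f"
    by blast
  define Q where "Q = (\<Pi>\<^sub>E f\<in>C. cball (0::complex) (B f))"
  have Q: "compactin P Q"
    unfolding P_def Q_def compactin_PiE by simp
  have "closedin P Q"
    unfolding P_def Q_def closedin_product_topology by simp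
  then have "S \<subseteq> Q"
    unfolding S_def by (intro closure_of_minimal) (auto simp: Q_def e_def B)
  then have "compactin P S"
    using Q closed_compactin S_def closedin_closure_of by metis
  then have comp: "compact_space H"
    unfolding H_def by (rule compact_space_subtopology)
  have emb: "embedding_map (top_of_set X) H e"
  proof -
    have inj: "inj_on e X"
    proof (rule inj_onI, rule ccontr)
      fix x y assume xy: "x \<in> X" "y \<in> X" "e x = e y" "x \<noteq> y"
      define f where "f = (\<lambda>z. complex_of_real (max 0 (1 - dist z x / dist x y)))"
      have "f \<in> C"
        unfolding C_def f_def using xy X \<E> by (intro bump_Higson) auto
      then have "e x f = f x" "e y f = f y" by (auto simp: e_def)
      then have "f x = f y" using xy(3) by simp
      then show False using xy by (simp add: f_def dist_commute)
    qed
    have op: "open_map (top_of_set X) (subtopology P (e ` X)) e"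
      unfolding open_map_def
    proof (intro allI impI)
      fix U assume U: "openin (top_of_set X) U"
      have "\<exists>V. openin P V \<and> e a \<in> V \<and> e ` X \<inter> V \<subseteq> e ` U" if a: "a \<in> U" for a
      proof -
        obtain r where r: "r > 0" "ball a r \<inter> X \<subseteq> U"
          using U a unfolding openin_contains_ball by blast
        have aX: "a \<in> X" using U a openin_imp_subset by blast
        define f where "f = (\<lambda>z. complex_of_real (max 0 (1 - dist z a / r)))"
        have f: "f \<in> C"
          unfolding C_def f_def using X \<E> aX r by (intro bump_Higson) auto
        define V where "V = {p \<in> topspace P. p f \<in> - {0}}"
        have "openin P V"
          unfolding V_def
          by (rule openin_continuous_map_preimage[of _ euclidean])
             (use f in \<open>auto simp: P_def intro: continuous_map_product_projection\<close>)
        moreover have "e a \<in> V"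
          using f aX by (auto simp: V_def tP e_def f_def)
        moreover have "e ` X \<inter> V \<subseteq> e ` U"
        proof clarify
          fix x assume x: "x \<in> X" "e x \<in> V"
          then have "f x \<noteq> 0" using f by (simp add: V_def e_def)
          then have "dist x a < r" using r(1) by (auto simp: f_def max_def field_simps split: if_splits)
          then show "e x \<in> e ` U" using r x by (auto simp: dist_commute)
        qed
        ultimately show ?thesis by blast
      qed
      then obtain V where V: "\<And>a. a \<in> U \<Longrightarrow> openin P (V a) \<and> e a \<in> V a \<and> e ` X \<inter> V a \<subseteq> e ` U"
        by metis
      have "openin P (\<Union>a\<in>U. V a)" using V by auto
      moreover have "e ` U = (\<Union>a\<in>U. V a) \<inter> e ` X"
        using V openin_imp_subset[OF U] by blast
      ultimately show "openin (subtopology P (e ` X)) (e ` U)"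
        unfolding openin_subtopology by blast
    qed
    have "embedding_map (top_of_set X) (subtopology P (e ` X)) e"
      by (rule injective_open_imp_embedding_map)
         (use e_cont inj op in \<open>auto simp: continuous_map_in_subtopology\<close>)
    then have "embedding_map (top_of_set X) P e"
      by (simp add: embedding_map_in_subtopology)
    then show ?thesis
      unfolding H_def by (simp add: embedding_map_in_subtopology eX)
  qed
  have dense: "H closure_of (e ` X) = topspace H"
    unfolding tH unfolding H_def using eX by (simp add: closure_of_subtopology Int_absorb1 S_def)
  have ext: "extends_continuously X H e f" if "f \<in> C" for f
    unfolding extends_continuously_def
  proof (intro exI conjI ballI)
    show "continuous_map H euclidean (\<lambda>p. p f)"
      unfolding H_def P_def using that
      by (intro continuous_map_from_subtopology continuous_map_product_projection)
    show "e x f = f x" for x using that by (simp add: e_def)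
  qed
  have con: "f \<in> C" if bc: "bounded_continuous X f" and ex: "extends_continuously X H e f" for f
  proof -
    obtain F where F: "continuous_map H euclidean F" and Ff: "\<And>x. x \<in> X \<Longrightarrow> F (e x) = f x"
      using ex by (auto simp: extends_continuously_def)
    have unif: "\<exists>T \<delta>. finite T \<and> T \<subseteq> C \<and> \<delta> > 0 \<and>
       (\<forall>x\<in>X. \<forall>y\<in>X. (\<forall>g\<in>T. cmod (g x - g y) < \<delta>) \<longrightarrow> cmod (f x - f y) < \<epsilon>)"
      if "\<epsilon> > 0" for \<epsilon>
    proof -
      define N where "N = (\<lambda>p T (\<delta>::real). {q \<in> topspace P. \<forall>g\<in>T. q g \<in> ball (p g) \<delta>})"
      have N_open: "openin P (N p T \<delta>)" if "finite T" "T \<subseteq> C" for p T \<delta>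
      proof -
        have "N p T \<delta> = topspace P \<inter> (\<Inter>g\<in>T. {q \<in> topspace P. q g \<in> ball (p g) \<delta>})"
          by (auto simp: N_def)
        moreover have "openin P {q \<in> topspace P. q g \<in> ball (p g) \<delta>}" if "g \<in> T" for g
          by (rule openin_continuous_map_preimage[of _ euclidean])
             (use \<open>T \<subseteq> C\<close> that in \<open>auto simp: P_def intro: continuous_map_product_projection\<close>)
        ultimately show ?thesis
          using \<open>finite T\<close> by (cases "T = {}") (auto intro!: openin_Inter)
      qed
      have "\<exists>T \<delta>. finite T \<and> T \<subseteq> C \<and> \<delta> > 0 \<and>
              (\<forall>q\<in>S. q \<in> N p T (2 * \<delta>) \<longrightarrow> dist (F q) (F p) < \<epsilon> / 2)" if p: "p \<in> S" for p
      proof -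
        have "openin H {q \<in> topspace H. F q \<in> ball (F p) (\<epsilon>/2)}"
          by (rule openin_continuous_map_preimage[OF F]) auto
        then obtain W where W: "openin P W" "{q \<in> S. F q \<in> ball (F p) (\<epsilon>/2)} = W \<inter> S"
          unfolding tH unfolding H_def openin_subtopology by auto
        have "p \<in> {q \<in> S. F q \<in> ball (F p) (\<epsilon>/2)}" using p \<open>\<epsilon> > 0\<close> by simp
        then have "p \<in> W" unfolding W(2) by blast
        then obtain U where U: "finite {g \<in> C. U g \<noteq> UNIV}" "\<And>g. g \<in> C \<Longrightarrow> open (U g)"
            "p \<in> Pi\<^sub>E C U" "Pi\<^sub>E C U \<subseteq> W"
          using W(1) unfolding P_def openin_product_topology_alt by auto
        define T where "T = {g \<in> C. U g \<noteq> UNIV}"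
        have "\<exists>d>0. ball (p g) d \<subseteq> U g" if "g \<in> T" for g
          using U that by (auto simp: T_def PiE_def Pi_def open_contains_ball)
        then obtain d where d: "\<And>g. g \<in> T \<Longrightarrow> d g > 0 \<and> ball (p g) (d g) \<subseteq> U g" by metis
        define \<delta> where "\<delta> = Min (insert 1 (d ` T)) / 2"
        have finT: "finite T" using U(1) by (simp add: T_def)
        have "\<delta> > 0" using d finT by (auto simp: \<delta>_def)
        have \<delta>d: "2 * \<delta> \<le> d g" if "g \<in> T" for g using that finT by (auto simp: \<delta>_def)
        have "dist (F q) (F p) < \<epsilon> / 2" if q: "q \<in> S" "q \<in> N p T (2 * \<delta>)" for q
        proof -
          have "q g \<in> U g" if g: "g \<in> C" for g
          proof (cases "g \<in> T")
            case True
            then have "q g \<in> ball (p g) (2 * \<delta>)" using q by (auto simp: N_def)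
            then have "q g \<in> ball (p g) (d g)" using \<delta>d[OF True] by auto
            then show ?thesis using d[OF True] by auto
          qed (use g in \<open>auto simp: T_def\<close>)
          moreover have "q \<in> extensional C" using q SP tP by auto
          ultimately have "q \<in> W" using U(4) by (auto simp: PiE_def)
          then have "q \<in> {q \<in> S. F q \<in> ball (F p) (\<epsilon>/2)}" unfolding W(2) using q(1) by blast
          then show ?thesis by (simp add: dist_commute)
        qed
        then show ?thesis using finT \<open>\<delta> > 0\<close> by (intro exI[of _ T] exI[of _ \<delta>]) (auto simp: T_def)
      qed
      then obtain T d where Td: "\<And>p. p \<in> S \<Longrightarrow> finite (T p) \<and> T p \<subseteq> C \<and> d p > 0 \<and>
              (\<forall>q\<in>S. q \<in> N p (T p) (2 * d p) \<longrightarrow> dist (F q) (F p) < \<epsilon> / 2)"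
        by metis
      have pN: "p \<in> N p (T p) (d p)" if "p \<in> S" for p
        using Td[OF that] that SP by (auto simp: N_def)
      obtain D where D: "finite D" "D \<subseteq> S" "S \<subseteq> (\<Union>p\<in>D. N p (T p) (d p))"
      proof -
        have "\<exists>\<F>. finite \<F> \<and> \<F> \<subseteq> (\<lambda>p. N p (T p) (d p)) ` S \<and> S \<subseteq> \<Union>\<F>"
        proof (rule compactinD[OF \<open>compactin P S\<close>])
          show "openin P U" if "U \<in> (\<lambda>p. N p (T p) (d p)) ` S" for U
            using that N_open Td by blast
          show "S \<subseteq> \<Union>((\<lambda>p. N p (T p) (d p)) ` S)"
            using pN by blast
        qed
        then obtain \<F> where \<F>: "finite \<F>" "\<F> \<subseteq> (\<lambda>p. N p (T p) (d p)) ` S" "S \<subseteq> \<Union>\<F>" by blast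
        obtain D where "D \<subseteq> S" "finite D" "\<F> = (\<lambda>p. N p (T p) (d p)) ` D"
          using finite_subset_image[OF \<F>(1,2)] by blast
        then show thesis using \<F>(3) that by blast
      qed
      define \<delta> where "\<delta> = Min (insert 1 (d ` D))"
      have "\<delta> > 0" using D Td by (auto simp: \<delta>_def)
      have \<delta>d: "\<delta> \<le> d p" if "p \<in> D" for p using that D by (auto simp: \<delta>_def)
      have "cmod (f x - f y) < \<epsilon>"
        if xy: "x \<in> X" "y \<in> X" "\<forall>g\<in>\<Union>(T ` D). cmod (g x - g y) < \<delta>" for x y
      proof -
        have S: "e x \<in> S" "e y \<in> S" using eX xy by auto
        then obtain p where p: "p \<in> D" "e x \<in> N p (T p) (d p)" using D by blast
        have pS: "p \<in> S" using p D by blast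
        have x2: "e x \<in> N p (T p) (2 * d p)"
          using p(2) Td[OF pS] by (force simp: N_def)
        have "e y g \<in> ball (p g) (2 * d p)" if g: "g \<in> T p" for g
        proof -
          have "g \<in> C" using Td[OF pS] g by auto
          have "dist (p g) (e x g) < d p" using p(2) g by (auto simp: N_def)
          moreover have "dist (e x g) (e y g) < d p"
            using xy(3) p(1) g \<delta>d[OF p(1)] \<open>g \<in> C\<close> by (force simp: e_def dist_norm)
          ultimately show ?thesis
            using dist_triangle[of "p g" "e y g" "e x g"] by simp
        qed
        then have "e y \<in> N p (T p) (2 * d p)" using S SP by (auto simp: N_def)
        then have "dist (F (e x)) (F p) < \<epsilon>/2" "dist (F (e y)) (F p) < \<epsilon>/2"
          using Td[OF pS] x2 S by auto
        then have "dist (F (e x)) (F (e y)) < \<epsilon>" by (rule dist_triangle_half_l)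
        then show ?thesis using Ff xy by (simp add: dist_norm)
      qed
      then show ?thesis
        using D Td \<open>\<delta> > 0\<close> by (intro exI[of _ "\<Union>(T ` D)"] exI[of _ \<delta>]) blast
    qed
    have "\<exists>K. K \<subseteq> X \<and> compact K \<and> (\<forall>x y. (y, x) \<in> E - K \<times> K \<longrightarrow> cmod (f x - f y) < \<epsilon>)"
      if E: "E \<in> \<E>" and "\<epsilon> > 0" for E \<epsilon>
    proof -
      obtain T \<delta> where T: "finite T" "T \<subseteq> C" "\<delta> > 0"
        "\<And>x y. x \<in> X \<Longrightarrow> y \<in> X \<Longrightarrow> (\<forall>g\<in>T. cmod (g x - g y) < \<delta>) \<Longrightarrow> cmod (f x - f y) < \<epsilon>"
        using unif[OF \<open>\<epsilon> > 0\<close>] by blast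
      have "\<exists>K. K \<subseteq> X \<and> compact K \<and> (\<forall>x y. (y, x) \<in> E - K \<times> K \<longrightarrow> cmod (g x - g y) < \<delta>)"
        if "g \<in> T" for g
        using that T(2,3) E by (auto simp: C_def Higson_functions_def)
      then obtain K where K: "\<And>g. g \<in> T \<Longrightarrow> K g \<subseteq> X \<and> compact (K g) \<and>
          (\<forall>x y. (y, x) \<in> E - K g \<times> K g \<longrightarrow> cmod (g x - g y) < \<delta>)"
        by metis
      have "compact (\<Union>(K ` T))" using K T(1) by (intro compact_UN) auto
      moreover have "cmod (f x - f y) < \<epsilon>" if yx: "(y, x) \<in> E - \<Union>(K ` T) \<times> \<Union>(K ` T)" for x y
      proof (rule T(4))
        show "x \<in> X" "y \<in> X" using yx \<E>[OF E] by (auto simp: proper_entourage_def)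
        show "\<forall>g\<in>T. cmod (g x - g y) < \<delta>" using K yx by blast
      qed
      ultimately show ?thesis using K by (intro exI[of _ "\<Union>(K ` T)"]) blast
    qed
    then show ?thesis using bc by (simp add: C_def Higson_functions_def)
  qed
  have "sublinear_Higson_compactification X x0 H e"
    unfolding sublinear_Higson_compactification_def compactification_def
    using comp haus emb dense ext con unfolding C_def \<E>_def by blast
  then show ?thesis by blast
qed

end

theory Submission
  imports Defs
begin

text \<open>Write \<open>|x|\<close> for the distance to the base point. A colouring of a set with \<open>n + 1\<close> colours is
  small at scale \<open>s\<close> if for suitable \<open>\<delta>\<close> its monochromatic \<open>\<delta> s\<close>-chains have diameter at most \<open>\<epsilon> s\<close>.
  For unbounded \<open>X\<close>, \<open>AN-asdim X \<le> n\<close> means that small colourings of all of \<open>X\<close> exist at every large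
  constant scale \<open>s = R\<close>, whereas \<open>dim \<nu>\<^sub>L X \<le> n\<close> means, once \<open>AN-asdim X\<close> is finite, that they exist
  near infinity at scale \<open>s(x) = |x|\<close>: a bounded continuous function is a Higson function iff it
  oscillates little on balls of radius \<open>\<delta> |x|\<close>, so sets which diverge linearly have disjoint closures
  in the corona, and conversely. Colourings at constant scales are glued along
  the annuli \<open>4^j \<le> |x| < 4^(j+1)\<close> to one at scale \<open>|x|\<close>. In the other direction, cut \<open>X\<close> into finitely
  many families of pieces of size \<open>R\<close>, which is possible as \<open>AN-asdim X\<close> is finite; by connectedness
  and cocompactness an isometry moves each piece to a place where \<open>|x|\<close> is comparable with \<open>R\<close>, and
  there the colouring at scale \<open>|x|\<close> can be used. Both gluings rest on a union lemma for small
  colourings, which does not increase the number of colours.\<close>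

section \<open>Colourings with controlled monochromatic chains\<close>

text \<open>For each colour, the chain classes form a family bounded by \<epsilon> s and separated
  by \<delta> s. A small colouring is thus the Kolmogorov-Ostrand form of a dimension bound: n + 1
  such families in place of a cover of multiplicity n + 1. Unlike a cover, a colouring can be
  overwritten on a subset, and this makes unions cheap: the new colouring only has to be much finer
  than the gaps of the old one. From the corona to X there are two obstacles. A colouring at scale
  |x| is far too coarse for pieces of size R that lie much further out than R, and no single
  isometry brings all of them back. Different isometries for different pieces do no harm inside one
  colour class, since short chains never pass from one piece to another, and there are only finitely
  many classes to join afterwards. Moreover, a cover of the corona carries no bound on sizes in X;
  the bound has to be built into the cover before it is refined.\<close>

definition chain_rel :: "'a::metric_space set \<Rightarrow> ('a \<Rightarrow> 'c) \<Rightarrow> ('a \<Rightarrow> real) \<Rightarrow> ('a \<times> 'a) set" where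
  "chain_rel A c t =
     {(x, y). x \<in> A \<and> y \<in> A \<and> c x = c y \<and> dist x y \<le> t x \<and> dist x y \<le> t y}"

text \<open>Testing each step against \<open>t\<close> at both ends keeps the relation symmetric
  although the scale varies. Hence any point of a chain class may serve as its start, and
  \<open>D\<close> bounds the class as seen from each of its points.\<close>

definition controlled ::
    "'a::metric_space set \<Rightarrow> ('a \<Rightarrow> 'c) \<Rightarrow> ('a \<Rightarrow> real) \<Rightarrow> ('a \<Rightarrow> real) \<Rightarrow> bool" where
  "controlled A c t D \<longleftrightarrow> (\<forall>x y. x \<in> A \<longrightarrow> (x, y) \<in> (chain_rel A c t)\<^sup>* \<longrightarrow> dist x y \<le> D x)"

text \<open>Linear control is encoded by letting \<delta> depend on \<epsilon> but not on
  \<open>j\<close>. In the applications \<open>F\<close> is \<open>at_top\<close>, and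
  \<open>A j\<close> is either a part of \<open>X\<close> with constant scale \<open>j\<close> or a
  part of \<open>X\<close> outside the ball of radius \<open>j\<close> with scale
  \<open>dist x x0\<close>.\<close>

definition small_colourable ::
    "nat \<Rightarrow> 'j filter \<Rightarrow> ('j \<Rightarrow> 'a::metric_space set) \<Rightarrow> ('j \<Rightarrow> 'a \<Rightarrow> real) \<Rightarrow> bool" where
  "small_colourable n F A s \<longleftrightarrow> (\<forall>\<epsilon>>0. \<exists>\<delta>>0. \<forall>\<^sub>F j in F. \<exists>c::'a \<Rightarrow> nat. (\<forall>x\<in>A j. c x \<le> n) \<and>
     controlled (A j) c (\<lambda>x. \<delta> * s j x) (\<lambda>x. \<epsilon> * s j x))"

lemma sym_chain_rel: "sym (chain_rel A c t)"
  by (auto simp: sym_def chain_rel_def dist_commute)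

lemma chain_relD:
  assumes "(x, y) \<in> chain_rel A c t"
  shows "x \<in> A" "y \<in> A" "c x = c y" "dist x y \<le> t x" "dist x y \<le> t y"
  using assms by (auto simp: chain_rel_def)

lemma chain_rel_rtrancl_sym:
  "(x, y) \<in> (chain_rel A c t)\<^sup>* \<Longrightarrow> (y, x) \<in> (chain_rel A c t)\<^sup>*"
  by (meson sym_chain_rel sym_rtrancl symD)

lemma chain_rel_rtrancl_in:
  assumes "(x, y) \<in> (chain_rel A c t)\<^sup>*" "x \<in> A"
  shows "y \<in> A" "c y = c x"
  using assms by (induction) (auto simp: chain_rel_def)

lemma chain_rel_mono:
  assumes "B \<subseteq> A" "\<And>x. x \<in> B \<Longrightarrow> t' x \<le> t x"
  shows "chain_rel B c t' \<subseteq> chain_rel A c t"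
  unfolding chain_rel_def using assms by (auto intro: order_trans[OF _ assms(2)])

lemma controlledD:
  "controlled A c t D \<Longrightarrow> x \<in> A \<Longrightarrow> (x, y) \<in> (chain_rel A c t)\<^sup>* \<Longrightarrow> dist x y \<le> D x"
  by (auto simp: controlled_def)

lemma controlled_mono:
  assumes "controlled A c t D" "B \<subseteq> A" "\<And>x. x \<in> B \<Longrightarrow> t' x \<le> t x" "\<And>x. x \<in> B \<Longrightarrow> D x \<le> D' x"
  shows "controlled B c t' D'"
  unfolding controlled_def
proof (intro allI impI)
  fix x y assume x: "x \<in> B" and y: "(x, y) \<in> (chain_rel B c t')\<^sup>*"
  have "(x, y) \<in> (chain_rel A c t)\<^sup>*"
    using y rtrancl_mono[OF chain_rel_mono[of B A t' t c]] assms(2,3) by blast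
  then have "dist x y \<le> D x"
    using controlledD[OF assms(1)] x assms(2) by blast
  then show "dist x y \<le> D' x" using assms(4)[OF x] by simp
qed

lemma small_colourableE:
  assumes "small_colourable n F A s" "\<epsilon> > 0"
  obtains \<delta> where "\<delta> > 0" "\<forall>\<^sub>F j in F. \<exists>c::'a::metric_space \<Rightarrow> nat. (\<forall>x\<in>A j. c x \<le> n) \<and>
     controlled (A j) c (\<lambda>x. \<delta> * s j x) (\<lambda>x. \<epsilon> * s j x)"
  using assms unfolding small_colourable_def by blast

section \<open>Representatives of chain classes\<close>

definition chain_rep :: "('a \<times> 'a) set \<Rightarrow> 'a \<Rightarrow> 'a" where
  "chain_rep r x = (SOME y. (x, y) \<in> r\<^sup>*)"

lemma chain_rep_related: "(x, chain_rep r x) \<in> r\<^sup>*"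
  unfolding chain_rep_def by (rule someI[of _ x]) simp

text \<open>Anything chosen at the representative is constant along chains; isometries and members
  of a cover are assigned to whole classes in this way.\<close>

lemma chain_rep_eq:
  assumes "sym r" "(x, y) \<in> r\<^sup>*"
  shows "chain_rep r x = chain_rep r y"
proof -
  have "(y, x) \<in> r\<^sup>*" using assms by (meson sym_rtrancl symD)
  then have "(x, z) \<in> r\<^sup>* \<longleftrightarrow> (y, z) \<in> r\<^sup>*" for z
    using assms(2) by (meson rtrancl_trans)
  then show ?thesis by (simp add: chain_rep_def)
qed

section \<open>Unions\<close>

text \<open>Here \<open>b\<close> and \<open>z\<close> are consecutive points outside
  \<open>A\<close>, with an excursion into \<open>A\<close> from \<open>a\<close> to
  \<open>y\<close> between them. Passing from \<open>b\<close> to \<open>a\<close> and from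
  \<open>a\<close> to \<open>y\<close> at most doubles the scale each time, so the three distances
  are at most \<alpha>, 2 \<alpha>' and 4 \<alpha> times \<open>s b\<close>.\<close>

lemma hop_dist_le:
  fixes s :: "'a::metric_space \<Rightarrow> real"
  assumes lip: "\<And>x y. x \<in> S \<Longrightarrow> y \<in> S \<Longrightarrow> s x \<le> s y + dist x y"
    and pos: "\<And>x. x \<in> S \<Longrightarrow> 0 \<le> s x"
    and \<alpha>: "0 \<le> \<alpha>" "\<alpha> \<le> 1" "0 \<le> \<alpha>'" "\<alpha>' \<le> 1"
    and S: "b \<in> S" "a \<in> S" "y \<in> S"
    and d: "dist b a \<le> \<alpha> * s b" "dist a y \<le> \<alpha>' * s a" "dist y z \<le> \<alpha> * s y"
  shows "dist b z \<le> (5 * \<alpha> + 2 * \<alpha>') * s b"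
proof -
  have sa: "s a \<le> 2 * s b"
    using lip[OF S(2,1)] d(1) mult_right_mono[OF \<alpha>(2) pos[OF S(1)]] by (simp add: dist_commute)
  have sy: "s y \<le> 2 * s a"
    using lip[OF S(3,2)] d(2) mult_right_mono[OF \<alpha>(4) pos[OF S(2)]] by (simp add: dist_commute)
  have "\<alpha>' * s a \<le> \<alpha>' * (2 * s b)" by (rule mult_left_mono[OF sa \<alpha>(3)])
  moreover have "\<alpha> * s y \<le> \<alpha> * (4 * s b)" by (rule mult_left_mono) (use sa sy \<alpha> in auto)
  moreover have "dist b z \<le> dist b a + dist a y + dist y z"
    using dist_triangle[of b z a] dist_triangle[of a z y] by simp
  ultimately show ?thesis using d by (simp add: algebra_simps)
qed

text \<open>A chain in \<open>A \<union> B\<close> is a chain of points of \<open>B - A\<close> interrupted by chains in \<open>A\<close>. Since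
  the latter are short compared with the scale \<open>\<beta>\<close>, the points of \<open>B - A\<close> form a \<open>\<beta>\<close>-chain by
  themselves.\<close>

lemma controlled_Un:
  fixes s :: "'a::metric_space \<Rightarrow> real"
  assumes lip: "\<And>x y. x \<in> A \<union> B \<Longrightarrow> y \<in> A \<union> B \<Longrightarrow> s x \<le> s y + dist x y"
    and pos: "\<And>x. x \<in> A \<union> B \<Longrightarrow> 0 \<le> s x"
    and cA: "controlled A a (\<lambda>x. \<alpha> * s x) (\<lambda>x. \<alpha>' * s x)"
    and cB: "controlled B b (\<lambda>x. \<beta> * s x) (\<lambda>x. \<beta>' * s x)"
    and \<alpha>: "0 \<le> \<alpha>" "\<alpha> \<le> 1" "0 \<le> \<alpha>'" "\<alpha>' \<le> 1" and \<beta>': "0 \<le> \<beta>'" "\<beta>' \<le> 1"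
    and \<beta>: "5 * \<alpha> + 2 * \<alpha>' \<le> \<beta>"
  shows "controlled (A \<union> B) (\<lambda>x. if x \<in> A then a x else b x) (\<lambda>x. \<alpha> * s x)
           (\<lambda>x. (17 * \<alpha>' + 10 * \<alpha> + 4 * \<beta>') * s x)"
  unfolding controlled_def
proof (intro allI impI)
  define c where "c = (\<lambda>x. if x \<in> A then a x else b x)"
  define rA where "rA = chain_rel A a (\<lambda>x. \<alpha> * s x)"
  define rB where "rB = chain_rel B b (\<lambda>x. \<beta> * s x)"
  define r where "r = chain_rel (A \<union> B) c (\<lambda>x. \<alpha> * s x)"
  \<comment> \<open>Meant for \<open>z\<close> outside \<open>A\<close>: a chain inside
    \<open>A\<close> leads from \<open>y\<close> to a point one short step away from
    \<open>z\<close>, unless \<open>y\<close> is already \<open>z\<close>.\<close>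
  define near where "near = (\<lambda>y z. y = z \<or> (y \<in> A \<and> c y = c z \<and>
     (\<exists>w\<in>A. (y, w) \<in> rA\<^sup>* \<and> dist w z \<le> \<alpha> * s w \<and> dist w z \<le> \<alpha> * s z)))"
  fix x y assume x: "x \<in> A \<union> B"
    and xy: "(x, y) \<in> (chain_rel (A \<union> B) (\<lambda>x. if x \<in> A then a x else b x) (\<lambda>x. \<alpha> * s x))\<^sup>*"
  have cAD: "dist u v \<le> \<alpha>' * s u" if "u \<in> A" "(u, v) \<in> rA\<^sup>*" for u v
    using controlledD[OF cA] that by (simp add: rA_def)
  have rA_in: "v \<in> A" if "u \<in> A" "(u, v) \<in> rA\<^sup>*" for u v
    using chain_rel_rtrancl_in(1) that unfolding rA_def by blast
  have rA_sym: "(v, u) \<in> rA\<^sup>*" if "(u, v) \<in> rA\<^sup>*" for u v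
    using that chain_rel_rtrancl_sym unfolding rA_def by blast
  have "(x, y) \<in> r\<^sup>*" using xy by (simp add: r_def c_def)
  \<comment> \<open>Invariant: either the chain has not left \<open>A\<close>, or \<open>u\<close>
    and \<open>v\<close> are the first and the last point that it visited outside
    \<open>A\<close>.\<close>
  then have "(x \<in> A \<and> y \<in> A \<and> (x, y) \<in> rA\<^sup>*) \<or>
    (\<exists>u\<in>B-A. \<exists>v\<in>B-A. near x u \<and> (u, v) \<in> rB\<^sup>* \<and> near y v)"
  proof (induction rule: rtrancl_induct)
    case base
    show ?case using x by (cases "x \<in> A") (auto simp: near_def)
  next
    case (step y z)
    have yz: "y \<in> A \<union> B" "z \<in> A \<union> B" "c y = c z" "dist y z \<le> \<alpha> * s y" "dist y z \<le> \<alpha> * s z"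
      using step(2) by (auto simp: r_def chain_rel_def)
    have yzA: "(y, z) \<in> rA" if "y \<in> A" "z \<in> A"
      using that yz by (auto simp: rA_def chain_rel_def c_def)
    from step(3) consider (1) "x \<in> A" "y \<in> A" "(x, y) \<in> rA\<^sup>*"
      | (2) u v where "u \<in> B-A" "v \<in> B-A" "near x u" "(u, v) \<in> rB\<^sup>*" "near y v" by blast
    then show ?case
    proof cases
      case 1
      show ?thesis
      proof (cases "z \<in> A")
        case True
        then show ?thesis using 1 yzA by (meson rtrancl.rtrancl_into_rtrancl)
      next
        case False
        have "c x = c y"
          using chain_rel_rtrancl_in(2)[OF 1(3)[unfolded rA_def] 1(1)] 1 by (simp add: c_def)
        then have "near x z"
          unfolding near_def using 1 yz by auto
        then show ?thesis using False yz by (auto simp: near_def)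
      qed
    next
      case 2
      show ?thesis
      proof (cases "z \<in> A")
        case True
        have "near z v"
        proof (cases "y = v")
          case True
          then show ?thesis unfolding near_def using \<open>z \<in> A\<close> yz
            by (auto simp: dist_commute)
        next
          case False
          then have "y \<in> A" "c y = c v" and
            "\<exists>w\<in>A. (y, w) \<in> rA\<^sup>* \<and> dist w v \<le> \<alpha> * s w \<and> dist w v \<le> \<alpha> * s v"
            using 2(5) by (auto simp: near_def)
          moreover have "(z, y) \<in> rA\<^sup>*" using yzA[OF \<open>y \<in> A\<close> \<open>z \<in> A\<close>] rA_sym by blast
          ultimately show ?thesis unfolding near_def using \<open>z \<in> A\<close> yz(3)
            by (auto intro: rtrancl_trans)
        qed
        then show ?thesis using 2 by blast
      next
        case False
        have zB: "z \<in> B" using False yz by auto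
        have "c v = c z" using 2(5) yz(3) by (auto simp: near_def)
        then have bb: "b v = b z" using 2(2) False by (simp add: c_def)
        \<comment> \<open>Membership in \<open>rB\<close> needs the bound at both scales, so the
          excursion is traversed once from \<open>v\<close> and once, backwards, from
          \<open>z\<close>.\<close>
        have "dist v z \<le> (5 * \<alpha> + 2 * \<alpha>') * s v \<and> dist v z \<le> (5 * \<alpha> + 2 * \<alpha>') * s z"
        proof (cases "y = v")
          case True
          have "\<alpha> * s v \<le> (5 * \<alpha> + 2 * \<alpha>') * s v" "\<alpha> * s z \<le> (5 * \<alpha> + 2 * \<alpha>') * s z"
            using \<alpha> pos 2(2) zB by (auto intro!: mult_right_mono)
          then show ?thesis using yz True by auto
        next
          case False
          then obtain w where w: "y \<in> A" "w \<in> A" "(y, w) \<in> rA\<^sup>*"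
            "dist w v \<le> \<alpha> * s w" "dist w v \<le> \<alpha> * s v"
            using 2(5) by (auto simp: near_def)
          have wy: "dist w y \<le> \<alpha>' * s w" "dist y w \<le> \<alpha>' * s y"
            using cAD w rA_sym by blast+
          have "dist v z \<le> (5 * \<alpha> + 2 * \<alpha>') * s v"
            by (rule hop_dist_le[where S = "A \<union> B" and s = s and a = w and y = y])
               (use lip pos \<alpha> w wy yz 2 in \<open>auto simp: dist_commute\<close>)
          moreover have "dist z v \<le> (5 * \<alpha> + 2 * \<alpha>') * s z"
            by (rule hop_dist_le[where S = "A \<union> B" and s = s and a = y and y = w])
               (use lip pos \<alpha> w wy yz 2 zB in \<open>auto simp: dist_commute\<close>)
          ultimately show ?thesis by (simp add: dist_commute)
        qed
        moreover have "(5 * \<alpha> + 2 * \<alpha>') * s v \<le> \<beta> * s v" "(5 * \<alpha> + 2 * \<alpha>') * s z \<le> \<beta> * s z"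
          using \<beta> pos 2(2) zB by (auto intro!: mult_right_mono)
        ultimately have "(v, z) \<in> rB"
          unfolding rB_def chain_rel_def using 2(2) zB bb by auto
        then have "(u, z) \<in> rB\<^sup>*" using 2(4) by simp
        then show ?thesis using 2 zB False by (auto simp: near_def)
      qed
    qed
  qed
  then show "dist x y \<le> (17 * \<alpha>' + 10 * \<alpha> + 4 * \<beta>') * s x"
  proof
    assume "x \<in> A \<and> y \<in> A \<and> (x, y) \<in> rA\<^sup>*"
    then have "dist x y \<le> \<alpha>' * s x" using cAD by blast
    also have "\<dots> \<le> (17 * \<alpha>' + 10 * \<alpha> + 4 * \<beta>') * s x"
      using \<alpha> \<beta>' pos[OF x] by (intro mult_right_mono) auto
    finally show ?thesis .
  next
    assume "\<exists>u\<in>B-A. \<exists>v\<in>B-A. near x u \<and> (u, v) \<in> rB\<^sup>* \<and> near y v"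
    then obtain u v where uv: "u \<in> B" "v \<in> B" "near x u" "(u, v) \<in> rB\<^sup>*" "near y v" by blast
    \<comment> \<open>Along x, u, v, y the scale grows to at most 4 \<open>s x\<close> at
      \<open>u\<close> and 8 \<open>s x\<close> at \<open>v\<close>. The three distances are at most
      \<alpha>' + 2 \<alpha>, 4 \<beta>' and 8 (\<alpha> + 2 \<alpha>') times \<open>s x\<close>,
      which add up to the stated constant.\<close>
    have sx: "0 \<le> s x" and su: "0 \<le> s u" and sv: "0 \<le> s v" using pos x uv by auto
    have 1: "dist x u \<le> (\<alpha>' + 2 * \<alpha>) * s x"
    proof (cases "x = u")
      case True then show ?thesis using sx \<alpha> by simp
    next
      case False
      then obtain w where w: "x \<in> A" "w \<in> A" "(x, w) \<in> rA\<^sup>*" "dist w u \<le> \<alpha> * s w"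
        using uv(3) by (auto simp: near_def)
      have d: "dist x w \<le> \<alpha>' * s x" using cAD w by blast
      have "s w \<le> 2 * s x"
        using lip[of w x] d mult_right_mono[OF \<alpha>(4) sx] w by (simp add: dist_commute)
      then have "\<alpha> * s w \<le> \<alpha> * (2 * s x)" using \<alpha> by (intro mult_left_mono) auto
      then show ?thesis using d w dist_triangle[of x u w] by (simp add: algebra_simps)
    qed
    have "(\<alpha>' + 2 * \<alpha>) * s x \<le> 3 * s x" using \<alpha> sx by (intro mult_right_mono) auto
    then have su4: "s u \<le> 4 * s x" using lip[of u x] 1 uv x by (simp add: dist_commute)
    have 2: "dist u v \<le> \<beta>' * s u" using controlledD[OF cB] uv by (simp add: rB_def)
    have "\<beta>' * s u \<le> 1 * s u" using \<beta>' su by (intro mult_right_mono) auto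
    then have sv8: "s v \<le> 8 * s x" using lip[of v u] 2 uv su4 by (simp add: dist_commute)
    have 3: "dist v y \<le> (\<alpha> + 2 * \<alpha>') * s v"
    proof (cases "y = v")
      case True then show ?thesis using sv \<alpha> by simp
    next
      case False
      then obtain w where w: "y \<in> A" "w \<in> A" "(y, w) \<in> rA\<^sup>*" "dist w v \<le> \<alpha> * s v"
        using uv(5) by (auto simp: near_def)
      have d: "dist w y \<le> \<alpha>' * s w" using cAD w rA_sym by blast
      have "s w \<le> 2 * s v"
        using lip[of w v] w mult_right_mono[OF \<alpha>(2) sv] uv by (simp add: dist_commute)
      then have "\<alpha>' * s w \<le> \<alpha>' * (2 * s v)" using \<alpha> by (intro mult_left_mono) auto
      then show ?thesis using d w dist_triangle[of v y w] by (simp add: algebra_simps dist_commute)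
    qed
    have "\<beta>' * s u \<le> \<beta>' * (4 * s x)" using \<beta>' su4 by (intro mult_left_mono) auto
    moreover have "(\<alpha> + 2 * \<alpha>') * s v \<le> (\<alpha> + 2 * \<alpha>') * (8 * s x)"
      using \<alpha> sv8 by (intro mult_left_mono) auto
    moreover have "dist x y \<le> dist x u + dist u v + dist v y"
      using dist_triangle[of x y u] dist_triangle[of u y v] by simp
    ultimately show ?thesis using 1 2 3 by (simp add: algebra_simps)
  qed
qed

text \<open>The order of the choices matters: \<open>B\<close> is coloured up to size \<beta>',
  which yields a gap \<beta>; only then is \<open>A\<close> coloured, with classes so small that an
  excursion into \<open>A\<close> does not bridge this gap. Both colourings use the same colours 0,
  ..., n.\<close>

lemma small_colourable_Un:
  fixes A B :: "'j \<Rightarrow> 'a::metric_space set"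
  assumes lip: "\<forall>\<^sub>F j in F. \<forall>x\<in>A j \<union> B j. 0 \<le> s j x \<and> (\<forall>y\<in>A j \<union> B j. s j x \<le> s j y + dist x y)"
    and A: "small_colourable n F A s" and B: "small_colourable n F B s"
  shows "small_colourable n F (\<lambda>j. A j \<union> B j) s"
  unfolding small_colourable_def
proof (intro allI impI)
  fix \<epsilon> :: real assume \<epsilon>: "\<epsilon> > 0"
  define \<beta>' where "\<beta>' = min 1 (\<epsilon> / 8)"
  have \<beta>': "0 < \<beta>'" "\<beta>' \<le> 1" "4 * \<beta>' \<le> \<epsilon> / 2" using \<epsilon> by (auto simp: \<beta>'_def)
  obtain \<beta> where \<beta>: "\<beta> > 0" "\<forall>\<^sub>F j in F. \<exists>c. (\<forall>x\<in>B j. c x \<le> n) \<and>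
     controlled (B j) c (\<lambda>x. \<beta> * s j x) (\<lambda>x. \<beta>' * s j x)"
    by (rule small_colourableE[OF B \<beta>'(1)])
  define \<alpha>' where "\<alpha>' = min 1 (min (\<beta> / 4) (\<epsilon> / 100))"
  have \<alpha>': "0 < \<alpha>'" "\<alpha>' \<le> 1" "\<alpha>' \<le> \<beta> / 4" "\<alpha>' \<le> \<epsilon> / 100" using \<epsilon> \<beta> by (auto simp: \<alpha>'_def)
  obtain \<alpha>0 where \<alpha>0: "\<alpha>0 > 0" "\<forall>\<^sub>F j in F. \<exists>c. (\<forall>x\<in>A j. c x \<le> n) \<and>
     controlled (A j) c (\<lambda>x. \<alpha>0 * s j x) (\<lambda>x. \<alpha>' * s j x)"
    by (rule small_colourableE[OF A \<alpha>'(1)])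
  \<comment> \<open>With these shares, 5 \<alpha> + 2 \<alpha>' \<le> \<beta>/4 + \<beta>/2 and 17
    \<alpha>' + 10 \<alpha> + 4 \<beta>' \<le> 27 \<epsilon>/100 + \<epsilon>/2.\<close>
  define \<alpha> where "\<alpha> = min \<alpha>0 (min 1 (min (\<beta> / 20) (\<epsilon> / 100)))"
  have \<alpha>: "0 < \<alpha>" "\<alpha> \<le> \<alpha>0" "\<alpha> \<le> 1" "\<alpha> \<le> \<beta> / 20" "\<alpha> \<le> \<epsilon> / 100"
    using \<epsilon> \<beta> \<alpha>0 by (auto simp: \<alpha>_def)
  have "\<forall>\<^sub>F j in F. \<exists>c. (\<forall>x\<in>A j \<union> B j. c x \<le> n) \<and>
     controlled (A j \<union> B j) c (\<lambda>x. \<alpha> * s j x) (\<lambda>x. \<epsilon> * s j x)"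
    using \<beta>(2) \<alpha>0(2) lip
  proof eventually_elim
    case (elim j)
    then obtain a b where ab: "\<forall>x\<in>A j. a x \<le> n" "\<forall>x\<in>B j. b x \<le> n"
      "controlled (A j) a (\<lambda>x. \<alpha>0 * s j x) (\<lambda>x. \<alpha>' * s j x)"
      "controlled (B j) b (\<lambda>x. \<beta> * s j x) (\<lambda>x. \<beta>' * s j x)" by blast
    have lp: "s j x \<le> s j y + dist x y" if "x \<in> A j \<union> B j" "y \<in> A j \<union> B j" for x y
      using elim(3) that by blast
    have pos: "0 \<le> s j x" if "x \<in> A j \<union> B j" for x
      using elim(3) that by blast
    have "controlled (A j) a (\<lambda>x. \<alpha> * s j x) (\<lambda>x. \<alpha>' * s j x)"
      by (rule controlled_mono[OF ab(3)]) (use pos \<alpha> in \<open>auto intro: mult_right_mono\<close>)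
    then have "controlled (A j \<union> B j) (\<lambda>x. if x \<in> A j then a x else b x) (\<lambda>x. \<alpha> * s j x)
       (\<lambda>x. (17 * \<alpha>' + 10 * \<alpha> + 4 * \<beta>') * s j x)"
      by (intro controlled_Un[OF lp pos _ ab(4)]) (use \<alpha> \<alpha>' \<beta>' in auto)
    then have "controlled (A j \<union> B j) (\<lambda>x. if x \<in> A j then a x else b x) (\<lambda>x. \<alpha> * s j x)
       (\<lambda>x. \<epsilon> * s j x)"
      by (rule controlled_mono) (use pos \<alpha> \<alpha>' \<beta>' \<epsilon> in \<open>auto intro!: mult_right_mono\<close>)
    then show ?case using ab(1,2) by (intro exI[of _ "\<lambda>x. if x \<in> A j then a x else b x"]) auto
  qed
  then show "\<exists>\<delta>>0. \<forall>\<^sub>F j in F. \<exists>c. (\<forall>x\<in>A j \<union> B j. c x \<le> n) \<and>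
     controlled (A j \<union> B j) c (\<lambda>x. \<delta> * s j x) (\<lambda>x. \<epsilon> * s j x)"
    using \<alpha>(1) by blast
qed

section \<open>From covers to colourings\<close>

text \<open>Pigeonhole on the n + 1 intervals of length r / (n + 1) that fill [0, r): of the at most
  n + 1 positive values, the one at \<open>m\<close> lies above all intervals, so one interval
  contains no positive value. \<open>T\<close> collects the indices above it.\<close>

lemma gap_set_exists:
  fixes f :: "'i \<Rightarrow> real"
  assumes fin: "finite {i\<in>I. f i > 0}" and card: "card {i\<in>I. f i > 0} \<le> n + 1"
    and m: "m \<in> I" "f m \<ge> r" and r: "r > 0"
  shows "\<exists>T. T \<noteq> {} \<and> T \<subseteq> {i\<in>I. f i > 0} \<and> (\<forall>i\<in>T. \<forall>j\<in>I-T. f i - f j \<ge> r / real (n + 1))"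
proof -
  define \<theta> where "\<theta> = r / real (n + 1)"
  have \<theta>: "\<theta> > 0" using r by (simp add: \<theta>_def)
  have n\<theta>: "real (n + 1) * \<theta> = r" by (simp add: \<theta>_def)
  define P where "P = {i\<in>I. f i > 0}"
  have mP: "m \<in> P" using m r by (simp add: P_def)
  have "\<exists>k\<le>n. \<forall>i\<in>P. \<not> (real k * \<theta> \<le> f i \<and> f i < real (k + 1) * \<theta>)"
  proof (rule ccontr)
    assume "\<not> ?thesis"
    then have "\<forall>k\<in>{..n}. \<exists>i\<in>P. real k * \<theta> \<le> f i \<and> f i < real (k + 1) * \<theta>" by auto
    then have "\<forall>k\<in>{..n}. \<exists>i. i \<in> P \<and> real k * \<theta> \<le> f i \<and> f i < real (k + 1) * \<theta>" by blast
    from bchoice[OF this] obtain g where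
      g: "\<And>k. k \<le> n \<Longrightarrow> g k \<in> P \<and> real k * \<theta> \<le> f (g k) \<and> f (g k) < real (k + 1) * \<theta>"
      by auto
    have "inj_on g {..n}"
    proof (rule linorder_inj_onI')
      fix k l assume kl: "k \<in> {..n}" "l \<in> {..n}" "k < l"
      have "f (g k) < real (k + 1) * \<theta>" using g kl by auto
      also have "\<dots> \<le> real l * \<theta>" using kl \<theta> by (intro mult_right_mono) auto
      also have "\<dots> \<le> f (g l)" using g kl by auto
      finally show "g k \<noteq> g l" by auto
    qed
    moreover have "g ` {..n} \<subseteq> P - {m}"
    proof
      fix i assume "i \<in> g ` {..n}"
      then obtain k where k: "k \<le> n" "i = g k" by auto
      have "f (g k) < real (k + 1) * \<theta>" using g k by auto
      also have "\<dots> \<le> real (n + 1) * \<theta>" using k \<theta> by (intro mult_right_mono) auto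
      also have "\<dots> \<le> f m" using m n\<theta> by simp
      finally show "i \<in> P - {m}" using g k by auto
    qed
    ultimately have "card {..n} \<le> card (P - {m})"
      using fin by (intro card_inj_on_le[of g]) (auto simp: P_def)
    also have "\<dots> \<le> n" using card mP fin by (simp add: P_def)
    finally show False by simp
  qed
  then obtain k where k: "k \<le> n" "\<And>i. i \<in> P \<Longrightarrow> \<not> (real k * \<theta> \<le> f i \<and> f i < real (k + 1) * \<theta>)"
    by blast
  define T where "T = {i\<in>P. f i \<ge> real (k + 1) * \<theta>}"
  have "real (k + 1) * \<theta> \<le> real (n + 1) * \<theta>" using k \<theta> by (intro mult_right_mono) auto
  then have "m \<in> T" using m n\<theta> mP by (simp add: T_def)
  moreover have "f i - f j \<ge> \<theta>" if "i \<in> T" "j \<in> I - T" for i j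
  proof -
    have "f j \<le> real k * \<theta>"
    proof (cases "j \<in> P")
      case True
      then show ?thesis using that k(2)[of j] by (auto simp: T_def)
    next
      case False
      then have "f j \<le> 0" using that by (auto simp: P_def)
      also have "0 \<le> real k * \<theta>" using \<theta> by simp
      finally show ?thesis .
    qed
    moreover have "f i \<ge> real (k + 1) * \<theta>" using that by (simp add: T_def)
    ultimately show ?thesis by (simp add: algebra_simps)
  qed
  moreover have "T \<subseteq> P" by (auto simp: T_def)
  ultimately show ?thesis by (intro exI[of _ T]) (auto simp: P_def \<theta>_def)
qed

text \<open>Points are coloured by the number of indices above the gap; among nearby points of the same
  colour these indices cannot change, as that would move two values across a gap.\<close>

lemma gap_colouring:
  fixes f :: "'i \<Rightarrow> 'a \<Rightarrow> real"
  assumes fin: "\<And>x. x \<in> A \<Longrightarrow> finite {i\<in>I. f i x > 0} \<and> card {i\<in>I. f i x > 0} \<le> n + 1"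
    and big: "\<And>x. x \<in> A \<Longrightarrow> \<exists>i\<in>I. f i x \<ge> r" and r: "r > 0"
  shows "\<exists>(c :: 'a \<Rightarrow> nat) T. (\<forall>x\<in>A. c x \<le> n) \<and> (\<forall>x\<in>A. T x \<noteq> {} \<and> T x \<subseteq> {i\<in>I. f i x > 0}) \<and>
    (\<forall>x\<in>A. \<forall>y\<in>A. c x = c y \<and> (\<forall>i\<in>I. \<bar>f i x - f i y\<bar> < r / real (n + 1)) \<longrightarrow> T x = T y)"
proof -
  have "\<forall>x\<in>A. \<exists>T. T \<noteq> {} \<and> T \<subseteq> {i\<in>I. f i x > 0} \<and>
     (\<forall>i\<in>T. \<forall>j\<in>I-T. f i x - f j x \<ge> r / real (n + 1))"
  proof
    fix x assume x: "x \<in> A"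
    obtain m where "m \<in> I" "f m x \<ge> r" using big[OF x] by blast
    then show "\<exists>T. T \<noteq> {} \<and> T \<subseteq> {i\<in>I. f i x > 0} \<and>
       (\<forall>i\<in>T. \<forall>j\<in>I-T. f i x - f j x \<ge> r / real (n + 1))"
      by (intro gap_set_exists[of I "\<lambda>i. f i x" n m r]) (use fin[OF x] r in auto)
  qed
  from bchoice[OF this] obtain T where T': "\<forall>x\<in>A. T x \<noteq> {} \<and> T x \<subseteq> {i\<in>I. f i x > 0} \<and>
     (\<forall>i\<in>T x. \<forall>j\<in>I-T x. f i x - f j x \<ge> r / real (n + 1))" ..
  note T = bspec[OF T']
  have Tfin: "finite (T x)" "card (T x) \<ge> 1" "card (T x) \<le> n + 1" if x: "x \<in> A" for x
  proof -
    show f: "finite (T x)" using T[OF x] fin[OF x] finite_subset by blast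
    show "card (T x) \<ge> 1" using f T[OF x] by (simp add: Suc_le_eq card_gt_0_iff)
    show "card (T x) \<le> n + 1" 
      using T[OF x] fin[OF x] card_mono[of "{i\<in>I. f i x > 0}" "T x"] by auto
  qed
  show ?thesis
  \<comment> \<open>The cardinality lies between 1 and n + 1; subtracting 1 gives colours from 0 to
    n and stays injective because \<open>T x\<close> is nonempty.\<close>
  proof (intro exI[of _ "\<lambda>x. card (T x) - 1"] exI[of _ T] conjI ballI impI)
    show "card (T x) - 1 \<le> n" if "x \<in> A" for x using Tfin[OF that] by simp
    show "T x \<noteq> {}" "T x \<subseteq> {i\<in>I. f i x > 0}" if "x \<in> A" for x using T[OF that] by blast+
    fix x y assume x: "x \<in> A" and y: "y \<in> A"
      and "card (T x) - 1 = card (T y) - 1 \<and> (\<forall>i\<in>I. \<bar>f i x - f i y\<bar> < r / real (n + 1))"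
    then have c: "card (T x) - 1 = card (T y) - 1"
      and close: "\<And>i. i \<in> I \<Longrightarrow> \<bar>f i x - f i y\<bar> < r / real (n + 1)" by auto
    have card: "card (T x) = card (T y)" using c Tfin(2)[OF x] Tfin(2)[OF y] by linarith
    show "T x = T y"
    proof (rule ccontr)
      assume ne: "T x \<noteq> T y"
      \<comment> \<open>Finite sets of equal size that differ each contain an element missing from
        the other. The difference of these two values would have to change by 2 r / (n + 1) between
        \<open>x\<close> and \<open>y\<close>, while each value changes by less than r / (n +
        1).\<close>
      have "\<not> T x \<subseteq> T y" "\<not> T y \<subseteq> T x"
        using ne card card_subset_eq[OF Tfin(1)[OF x], of "T y"]
          card_subset_eq[OF Tfin(1)[OF y], of "T x"] by auto
      then obtain i j where ij: "i \<in> T x" "i \<notin> T y" "j \<in> T y" "j \<notin> T x" by blast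
      have I: "i \<in> I" "j \<in> I" using ij T[OF x] T[OF y] by blast+
      have "f i x - f j x \<ge> r / real (n + 1)" using T[OF x] ij I by blast
      moreover have "f j y - f i y \<ge> r / real (n + 1)" using T[OF y] ij I by blast
      ultimately show False using close[OF I(1)] close[OF I(2)] by linarith
    qed
  qed
qed

lemma multiplicity_le_card:
  assumes "multiplicity_le \<U> m" "\<V> \<subseteq> \<U>" "x \<in> \<Inter>\<V>"
  shows "finite \<V> \<and> card \<V> \<le> m"
proof (rule ccontr)
  assume "\<not> ?thesis"
  then consider "infinite \<V>" | "m + 1 \<le> card \<V>" by force
  then obtain \<W> where "\<W> \<subseteq> \<V>" "finite \<W>" "card \<W> = m + 1"
  proof cases
    case 1
    then show thesis using infinite_arbitrarily_large that by blast
  next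
    case 2
    then show thesis using obtain_subset_with_card_n[OF 2] that by metis
  qed
  then have "\<Inter>\<W> = {}" using assms(1,2) by (simp add: multiplicity_le_def)
  then show False using assms(3) \<open>\<W> \<subseteq> \<V>\<close> by blast
qed

text \<open>For scale R take a cover at r = \<epsilon> R / k, so that its mesh is at most \<epsilon>
  R. The distances to the complements of its members are 1-Lipschitz, at most n + 1 of them are
  positive at a point and one is at least r, so gap colouring applies. As \<delta> R is half of r /
  (n + 1), the set \<open>T\<close> is constant on chains, and each chain lies in a single
  member.\<close>

lemma AN_asdim_le_imp_small_colourable:
  fixes X :: "'a::metric_space set"
  assumes X: "\<not> bounded X" and AN: "AN_asdim_le X n"
  shows "small_colourable n at_top (\<lambda>R. X) (\<lambda>R _. R)"
  unfolding small_colourable_def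
proof (intro allI impI)
  fix \<epsilon> :: real assume \<epsilon>: "\<epsilon> > 0"
  obtain k r0 where k: "k > 0" "r0 > 0" and cov: "\<And>r. r \<ge> r0 \<Longrightarrow> \<exists>\<U>. \<Union>\<U> = X \<and>
     mesh \<U> \<le> ennreal (k * r) \<and> Lebesgue_number X \<U> > ennreal r \<and> multiplicity_le \<U> (n + 1)"
    using AN unfolding AN_asdim_le_def by blast
  define \<delta> where "\<delta> = \<epsilon> / k / (2 * real (n + 1))"
  have \<delta>: "\<delta> > 0" using \<epsilon> k by (simp add: \<delta>_def)
  have "\<forall>\<^sub>F R in at_top. \<exists>c::'a\<Rightarrow>nat. (\<forall>x\<in>X. c x \<le> n) \<and> controlled X c (\<lambda>x. \<delta> * R) (\<lambda>x. \<epsilon> * R)"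
    using eventually_ge_at_top[of "max 1 (r0 * k / \<epsilon>)"]
  proof eventually_elim
    case (elim R)
    define r where "r = \<epsilon> * R / k"
    have R: "R \<ge> 1" using elim by simp
    have r: "r \<ge> r0" "r > 0" using elim k \<epsilon> R by (auto simp: r_def field_simps)
    obtain \<U> where U: "\<Union>\<U> = X" "mesh \<U> \<le> ennreal (k * r)" "Lebesgue_number X \<U> > ennreal r"
      "multiplicity_le \<U> (n + 1)" using cov[OF r(1)] by blast
    have half: "a / 2 < a" if "a > 0" for a :: real using that by simp
    have r\<theta>: "r / real (n + 1) > 0" using r(2) by simp
    have diam: "dist x y \<le> \<epsilon> * R" if "V \<in> \<U>" "x \<in> V" "y \<in> V" for V x y
    proof -
      have "ennreal (dist x y) \<le> ediam V"
        unfolding ediam_def using that by (intro SUP_upper2[of x] SUP_upper2[of y]) auto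
      also have "\<dots> \<le> mesh \<U>" unfolding mesh_def using that by (intro SUP_upper)
      also have "\<dots> \<le> ennreal (\<epsilon> * R)" using U(2) k by (simp add: r_def)
      finally show ?thesis using \<epsilon> R by (simp add: ennreal_le_iff)
    qed
    \<comment> \<open>\<open>infdist\<close> to the empty set is 0, so the function of a member
      equal to \<open>X\<close> would vanish. Unboundedness of \<open>X\<close> excludes such a
      member, since members have finite diameter.\<close>
    have ne: "X - V \<noteq> {}" if "V \<in> \<U>" for V
    proof
      assume "X - V = {}"
      then have "dist x y \<le> \<epsilon> * R" if "x \<in> X" "y \<in> X" for x y
        using diam[OF \<open>V \<in> \<U>\<close>] that by blast
      then show False using X unfolding bounded_two_points by blast
    qed
    define f where "f = (\<lambda>V x. infdist x (X - V))"
    have f_in: "x \<in> V" if "V \<in> \<U>" "x \<in> X" "f V x > 0" for V x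
      using that infdist_zero[of x "X - V"] unfolding f_def by (metis DiffI less_irrefl)
    have f_lip: "\<bar>f V x - f V y\<bar> \<le> dist x y" for V x y
      unfolding f_def
      using infdist_triangle[of x "X - V" y] infdist_triangle[of y "X - V" x]
      by (auto simp: dist_commute abs_le_iff)
    have mult: "finite {V\<in>\<U>. f V x > 0} \<and> card {V\<in>\<U>. f V x > 0} \<le> n + 1" if x: "x \<in> X" for x
      by (rule multiplicity_le_card[OF U(4)]) (use f_in x in auto)
    have big: "\<exists>V\<in>\<U>. f V x \<ge> r" if x: "x \<in> X" for x
    proof -
      have "ennreal r < (SUP V\<in>\<U>. esetdist x (X - V))"
        using U(3) x unfolding Lebesgue_number_def
        by (rule less_le_trans[OF _ INF_lower])
      then obtain V where V: "V \<in> \<U>" "ennreal r < esetdist x (X - V)"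
        by (auto simp: less_SUP_iff)
      have "r \<le> dist x y" if "y \<in> X - V" for y
      proof -
        have "ennreal r \<le> ennreal (dist x y)"
          using V(2) that unfolding esetdist_def
          by (intro less_imp_le less_le_trans[OF _ INF_lower[of y]])
        then show ?thesis by (simp add: ennreal_le_iff)
      qed
      then have "f V x \<ge> r"
        unfolding f_def using ne[OF V(1)] by (subst infdist_notempty) (auto intro!: cINF_greatest)
      then show ?thesis using V(1) by blast
    qed
    have "\<exists>(c::'a \<Rightarrow> nat) T. (\<forall>x\<in>X. c x \<le> n) \<and> (\<forall>x\<in>X. T x \<noteq> {} \<and> T x \<subseteq> {V\<in>\<U>. f V x > 0}) \<and>
      (\<forall>x\<in>X. \<forall>y\<in>X. c x = c y \<and> (\<forall>V\<in>\<U>. \<bar>f V x - f V y\<bar> < r / real (n + 1)) \<longrightarrow> T x = T y)"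
      by (rule gap_colouring) (use mult big r in auto)
    then obtain c :: "'a \<Rightarrow> nat" and T where cT': "\<forall>x\<in>X. c x \<le> n"
      "\<forall>x\<in>X. T x \<noteq> {} \<and> T x \<subseteq> {V\<in>\<U>. f V x > 0}"
      "\<forall>x\<in>X. \<forall>y\<in>X. c x = c y \<and> (\<forall>V\<in>\<U>. \<bar>f V x - f V y\<bar> < r / real (n + 1)) \<longrightarrow> T x = T y"
      by (elim exE conjE)
    note cT = bspec[OF cT'(1)] bspec[OF cT'(2)] cT'(3)[rule_format, OF _ _ conjI]
    have step: "T x = T y" if "(x, y) \<in> chain_rel X c (\<lambda>x. \<delta> * R)" for x y
    proof (rule cT(3))
      show "x \<in> X" "y \<in> X" "c x = c y" using chain_relD[OF that] by auto
    next
      show "\<forall>V\<in>\<U>. \<bar>f V x - f V y\<bar> < r / real (n + 1)"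
      proof
        fix V assume "V \<in> \<U>"
        have "\<bar>f V x - f V y\<bar> \<le> \<delta> * R" using f_lip chain_relD(4)[OF that] by (meson order_trans)
        also have "\<dots> = (r / real (n + 1)) / 2" by (simp add: \<delta>_def r_def)
        also have "\<dots> < r / real (n + 1)" by (rule half[OF r\<theta>])
        finally show "\<bar>f V x - f V y\<bar> < r / real (n + 1)" .
      qed
    qed
    have "controlled X c (\<lambda>x. \<delta> * R) (\<lambda>x. \<epsilon> * R)"
      unfolding controlled_def
    proof (intro allI impI)
      fix x y assume x: "x \<in> X" and xy: "(x, y) \<in> (chain_rel X c (\<lambda>x. \<delta> * R))\<^sup>*"
      have "T x = T y" using xy by induction (use step in auto)
      moreover have "y \<in> X" using chain_rel_rtrancl_in(1)[OF xy x] .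
      ultimately obtain V where "V \<in> \<U>" "f V x > 0" "f V y > 0"
        using cT(2)[OF x] cT(2)[of y] by blast
      then show "dist x y \<le> \<epsilon> * R" using diam f_in x \<open>y \<in> X\<close> by blast
    qed
    then show ?case using cT(1) by blast
  qed
  then show "\<exists>\<delta>>0. \<forall>\<^sub>F R in at_top. \<exists>c::'a\<Rightarrow>nat. (\<forall>x\<in>X. c x \<le> n) \<and>
     controlled X c (\<lambda>x. \<delta> * R) (\<lambda>x. \<epsilon> * R)"
    using \<delta> by blast
qed

section \<open>From colourings back to covers\<close>

lemma multiplicity_le_colour:
  fixes W :: "'i \<Rightarrow> 'b set"
  assumes c: "\<And>i. i \<in> I \<Longrightarrow> c i \<le> (n::nat)"
    and disj: "\<And>i j. i \<in> I \<Longrightarrow> j \<in> I \<Longrightarrow> c i = c j \<Longrightarrow> W i \<noteq> W j \<Longrightarrow> W i \<inter> W j = {}"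
  shows "multiplicity_le (W ` I) (n + 1)"
  unfolding multiplicity_le_def
proof (intro allI impI)
  fix \<V> assume \<V>: "\<V> \<subseteq> W ` I" and fc: "finite \<V> \<and> card \<V> = n + 1 + 1"
  then obtain g where g: "\<And>V. V \<in> \<V> \<Longrightarrow> g V \<in> I \<and> W (g V) = V"
    using bchoice[of \<V> "\<lambda>V i. i \<in> I \<and> W i = V"] by blast
  \<comment> \<open>There are n + 2 distinct sets but only n + 1 colours.\<close>
  have "\<not> inj_on (c \<circ> g) \<V>"
  proof
    assume "inj_on (c \<circ> g) \<V>"
    then have "card \<V> \<le> card {..n}"
      by (rule card_inj_on_le) (use c g in auto)
    then show False using fc by simp
  qed
  then obtain U V where "U \<in> \<V>" "V \<in> \<V>" "U \<noteq> V" "c (g U) = c (g V)"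
    by (auto simp: inj_on_def)
  then have "U \<inter> V = {}" using disj[of "g U" "g V"] g by auto
  then show "\<Inter>\<V> = {}" using \<open>U \<in> \<V>\<close> \<open>V \<in> \<V>\<close> by blast
qed

text \<open>The cover consists of the 2 r-neighbourhoods of the chain classes. Its Lebesgue number
  is at least 2 r, hence strictly above r, and neighbourhoods of different classes of one colour are
  disjoint because their classes are more than 5 r apart.\<close>

lemma small_colourable_imp_AN_asdim_le:
  fixes X :: "'a::metric_space set"
  assumes sc: "small_colourable n at_top (\<lambda>R. X) (\<lambda>R _. R)"
  shows "AN_asdim_le X n"
proof -
  obtain \<delta> where \<delta>: "\<delta> > 0" and "\<forall>\<^sub>F R in at_top. \<exists>c::'a\<Rightarrow>nat. (\<forall>x\<in>X. c x \<le> n) \<and>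
     controlled X c (\<lambda>x. \<delta> * R) (\<lambda>x. 1 * R)"
    by (rule small_colourableE[OF sc zero_less_one])
  then obtain R0 where R0: "\<And>R. R \<ge> R0 \<Longrightarrow> \<exists>c::'a\<Rightarrow>nat. (\<forall>x\<in>X. c x \<le> n) \<and>
     controlled X c (\<lambda>x. \<delta> * R) (\<lambda>x. 1 * R)"
    unfolding eventually_at_top_linorder by blast
  have "\<exists>\<U>. \<Union>\<U> = X \<and> mesh \<U> \<le> ennreal ((5 / \<delta> + 4) * r) \<and>
     Lebesgue_number X \<U> > ennreal r \<and> multiplicity_le \<U> (n + 1)"
    if r: "r \<ge> max 1 (\<bar>R0\<bar> * \<delta>)" for r
  proof -
    \<comment> \<open>This makes the chain step \<delta> R equal to 5 r. Classes have diameter at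
      most R, so the mesh is at most R + 4 r = (5 / \<delta> + 4) r.\<close>
    define R where "R = 5 * r / \<delta>"
    have r1: "r \<ge> 1" using r by simp
    have "R \<ge> r / \<delta>" using r1 \<delta> by (simp add: R_def divide_right_mono)
    moreover have "R0 * \<delta> \<le> \<bar>R0\<bar> * \<delta>" using \<delta> by (intro mult_right_mono) auto
    then have "R0 * \<delta> \<le> r" using r by linarith
    then have "R0 \<le> r / \<delta>" using \<delta> by (simp add: pos_le_divide_eq)
    ultimately have "R \<ge> R0" by simp
    have dR: "\<delta> * R = 5 * r" using \<delta> by (simp add: R_def)
    obtain c :: "'a \<Rightarrow> nat" where c: "\<And>x. x \<in> X \<Longrightarrow> c x \<le> n" "controlled X c (\<lambda>x. 5 * r) (\<lambda>x. R)"
      using R0[OF \<open>R \<ge> R0\<close>] dR by auto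
    define rl where "rl = chain_rel X c (\<lambda>x. 5 * r)"
    define W where "W = (\<lambda>x. {z\<in>X. \<exists>y. (x, y) \<in> rl\<^sup>* \<and> dist z y \<le> 2 * r})"
    have rlin: "y \<in> X" "c y = c x" if "x \<in> X" "(x, y) \<in> rl\<^sup>*" for x y
      using chain_rel_rtrancl_in[OF that(2)[unfolded rl_def] that(1)] by auto
    have rlsym: "(y, x) \<in> rl\<^sup>*" if "(x, y) \<in> rl\<^sup>*" for x y
      using that chain_rel_rtrancl_sym unfolding rl_def by blast
    have xW: "x \<in> W x" if "x \<in> X" for x using that r1 unfolding W_def by auto
    have "\<Union>(W ` X) = X" using xW by (auto simp: W_def)
    moreover have "multiplicity_le (W ` X) (n + 1)"
    proof (rule multiplicity_le_colour[of X c])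
      fix x y assume xy: "x \<in> X" "y \<in> X" "c x = c y" "W x \<noteq> W y"
      show "W x \<inter> W y = {}"
      proof (rule ccontr)
        assume "W x \<inter> W y \<noteq> {}"
        then obtain z u v where z: "z \<in> X" "(x, u) \<in> rl\<^sup>*" "dist z u \<le> 2 * r"
          "(y, v) \<in> rl\<^sup>*" "dist z v \<le> 2 * r" by (auto simp: W_def)
        have "dist u v \<le> 5 * r" using z dist_triangle2[of u v z] r1 by (simp add: dist_commute)
        moreover have "u \<in> X" "v \<in> X" "c u = c v"
          using rlin[OF xy(1) z(2)] rlin[OF xy(2) z(4)] xy(3) by auto
        ultimately have "(u, v) \<in> rl" by (auto simp: rl_def chain_rel_def)
        then have "(x, y) \<in> rl\<^sup>*" using z rlsym by (meson rtrancl.rtrancl_into_rtrancl rtrancl_trans)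
        then have "(x, w) \<in> rl\<^sup>* \<longleftrightarrow> (y, w) \<in> rl\<^sup>*" for w using rlsym by (meson rtrancl_trans)
        then show False using xy(4) by (simp add: W_def)
      qed
    qed (use c in auto)
    moreover have "mesh (W ` X) \<le> ennreal ((5 / \<delta> + 4) * r)"
      unfolding mesh_def ediam_def
    proof (intro SUP_least)
      fix V u v assume "V \<in> W ` X" "u \<in> V" "v \<in> V"
      then obtain x u' v' where x: "x \<in> X" "(x, u') \<in> rl\<^sup>*" "dist u u' \<le> 2 * r"
        "(x, v') \<in> rl\<^sup>*" "dist v v' \<le> 2 * r" by (auto simp: W_def)
      have "(u', v') \<in> rl\<^sup>*" using x rlsym by (meson rtrancl_trans)
      then have "dist u' v' \<le> R"
        using controlledD[OF c(2)] rlin(1)[OF x(1,2)] unfolding rl_def by blast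
      then have "dist u v \<le> R + 4 * r"
        using x dist_triangle[of u v u'] dist_triangle[of u' v v'] by (simp add: dist_commute)
      then show "ennreal (dist u v) \<le> ennreal ((5 / \<delta> + 4) * r)"
        by (intro ennreal_leI) (simp add: R_def algebra_simps)
    qed
    moreover have "Lebesgue_number X (W ` X) > ennreal r"
    proof -
      have "ennreal (2 * r) \<le> (SUP V\<in>W ` X. esetdist x (X - V))" if x: "x \<in> X" for x
      proof -
        have "ennreal (2 * r) \<le> esetdist x (X - W x)"
          unfolding esetdist_def
        proof (intro INF_greatest ennreal_leI)
          fix y assume "y \<in> X - W x"
          then have "\<not> dist y x \<le> 2 * r" unfolding W_def by blast
          then show "2 * r \<le> dist x y" by (simp add: dist_commute)
        qed
        also have "\<dots> \<le> (SUP V\<in>W ` X. esetdist x (X - V))" using x by (intro SUP_upper) auto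
        finally show ?thesis .
      qed
      then have "ennreal (2 * r) \<le> Lebesgue_number X (W ` X)"
        unfolding Lebesgue_number_def by (intro INF_greatest)
      moreover have "ennreal r < ennreal (2 * r)" using r1 by (simp add: ennreal_less_iff)
      ultimately show ?thesis by (rule less_le_trans[rotated])
    qed
    ultimately show ?thesis by blast
  qed
  moreover have "5 / \<delta> + 4 > 0" "max 1 (\<bar>R0\<bar> * \<delta>) > 0" using \<delta> by (auto simp: add_pos_pos)
  ultimately show ?thesis unfolding AN_asdim_le_def by blast
qed

section \<open>Colourings at linearly growing scale\<close>

text \<open>Annulus \<open>l\<close> carries the colouring for the constant scale 4^l.
  \<open>P\<close> selects annuli no two of which are adjacent: two points in different selected
  annuli have norms that differ by a factor above 4, so no step of length at most half the norm
  joins them, and a chain stays in its annulus.\<close>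

lemma small_colourable_annuli:
  fixes X :: "'a::metric_space set"
  assumes sc: "small_colourable n at_top (\<lambda>R. X) (\<lambda>R _. R)"
    and l: "\<And>x. x \<in> X \<Longrightarrow> dist x x0 \<ge> 1 \<Longrightarrow> 4 ^ l x \<le> dist x x0 \<and> dist x x0 < 4 * 4 ^ l x"
    and sep: "\<And>x y. x \<in> X \<Longrightarrow> y \<in> X \<Longrightarrow> P x \<Longrightarrow> P y \<Longrightarrow> l x < l y \<Longrightarrow> l x + 2 \<le> (l y :: nat)"
  shows "small_colourable n at_top (\<lambda>R. {x\<in>X - ball x0 R. P x}) (\<lambda>R x. dist x x0)"
  unfolding small_colourable_def
proof (intro allI impI)
  fix \<epsilon> :: real assume \<epsilon>: "\<epsilon> > 0"
  obtain \<delta>0 where \<delta>0: "\<delta>0 > 0" and "\<forall>\<^sub>F R in at_top. \<exists>c::'a\<Rightarrow>nat. (\<forall>x\<in>X. c x \<le> n) \<and>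
     controlled X c (\<lambda>x. \<delta>0 * R) (\<lambda>x. \<epsilon> * R)"
    by (rule small_colourableE[OF sc \<epsilon>])
  then obtain R0 where R0: "\<And>R. R \<ge> R0 \<Longrightarrow> \<exists>c::'a\<Rightarrow>nat. (\<forall>x\<in>X. c x \<le> n) \<and>
     controlled X c (\<lambda>x. \<delta>0 * R) (\<lambda>x. \<epsilon> * R)"
    unfolding eventually_at_top_linorder by blast
  define good where "good = (\<lambda>R (c::'a\<Rightarrow>nat). (\<forall>x\<in>X. c x \<le> n) \<and>
     controlled X c (\<lambda>x. \<delta>0 * R) (\<lambda>x. \<epsilon> * R))"
  define a where "a = (\<lambda>R. SOME c. good R c)"
  have a: "good R (a R)" if "R \<ge> R0" for R
    unfolding a_def using R0[OF that] by (intro someI_ex[of "good R"]) (auto simp: good_def)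
  define \<delta> where "\<delta> = min (\<delta>0 / 4) (1 / 2)"
  have \<delta>: "\<delta> > 0" "\<delta> \<le> \<delta>0 / 4" "\<delta> \<le> 1 / 2" using \<delta>0 by (auto simp: \<delta>_def)
  have "\<forall>\<^sub>F R in at_top. \<exists>c::'a\<Rightarrow>nat. (\<forall>x\<in>{x\<in>X - ball x0 R. P x}. c x \<le> n) \<and>
     controlled {x\<in>X - ball x0 R. P x} c (\<lambda>x. \<delta> * dist x x0) (\<lambda>x. \<epsilon> * dist x x0)"
    using eventually_ge_at_top[of "max 1 (4 * \<bar>R0\<bar>)"]
  proof eventually_elim
    case (elim R)
    define A where "A = {x\<in>X - ball x0 R. P x}"
    define c where "c = (\<lambda>x. a (4 ^ l x) x)"
    have A: "x \<in> X" "P x" "dist x x0 \<ge> 1" "4 ^ l x \<ge> R0" "4 ^ l x \<le> dist x x0" "dist x x0 < 4 * 4 ^ l x"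
      if "x \<in> A" for x
    proof -
      show x: "x \<in> X" "P x" and d: "dist x x0 \<ge> 1" using that elim by (auto simp: A_def dist_commute)
      show l4: "4 ^ l x \<le> dist x x0" "dist x x0 < 4 * 4 ^ l x" using l[OF x(1) d] by auto
      have "dist x x0 \<ge> 4 * \<bar>R0\<bar>" using that elim by (auto simp: A_def dist_commute)
      then show "4 ^ l x \<ge> R0" using l4 by linarith
    qed
    have far: "dist x y > dist y x0 / 2" if "x \<in> A" "y \<in> A" "l x < l y" for x y
    proof -
      have "l x + 2 \<le> l y" using sep A that by blast
      then have "(4::real) ^ (l x + 2) \<le> 4 ^ l y" by (intro power_increasing) auto
      then have "16 * (4::real) ^ l x \<le> dist y x0" using A(5)[OF that(2)] by simp
      then have "dist x x0 < dist y x0 / 4" using A(6)[OF that(1)] by simp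
      then show ?thesis using dist_triangle[of y x0 x] A(3)[OF that(2)] by (simp add: dist_commute)
    qed
    have step: "l x = l y \<and> (x, y) \<in> chain_rel X (a (4 ^ l x)) (\<lambda>_. \<delta>0 * 4 ^ l x)"
      if "(x, y) \<in> chain_rel A c (\<lambda>x. \<delta> * dist x x0)" for x y
    proof -
      note xy = chain_relD[OF that]
      have "\<delta> * dist x x0 \<le> (1/2) * dist x x0" "\<delta> * dist y x0 \<le> (1/2) * dist y x0"
        by (rule mult_right_mono[OF \<delta>(3) zero_le_dist])+
      then have "\<not> l x < l y" "\<not> l y < l x"
        using far[of x y] far[of y x] xy by (auto simp: dist_commute)
      then have eq: "l x = l y" by simp
      have "\<delta> * dist x x0 \<le> (\<delta>0 / 4) * (4 * 4 ^ l x)"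
        using \<delta> A(6)[OF xy(1)] by (intro mult_mono) auto
      then have "dist x y \<le> \<delta>0 * 4 ^ l x" using xy(4) by simp
      then show ?thesis using eq xy A by (auto simp: chain_rel_def c_def)
    qed
    have "controlled A c (\<lambda>x. \<delta> * dist x x0) (\<lambda>x. \<epsilon> * dist x x0)"
      unfolding controlled_def
    proof (intro allI impI)
      fix x y assume x: "x \<in> A" and xy: "(x, y) \<in> (chain_rel A c (\<lambda>x. \<delta> * dist x x0))\<^sup>*"
      have "l x = l y \<and> (x, y) \<in> (chain_rel X (a (4 ^ l x)) (\<lambda>_. \<delta>0 * 4 ^ l x))\<^sup>*"
        using xy
      proof induction
        case (step y z)
        then show ?case using \<open>\<And>x y. (x, y) \<in> chain_rel A c (\<lambda>x. \<delta> * dist x x0) \<Longrightarrow> _\<close>[of y z]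
          by (auto intro: rtrancl_into_rtrancl)
      qed auto
      moreover have "controlled X (a (4 ^ l x)) (\<lambda>_. \<delta>0 * 4 ^ l x) (\<lambda>_. \<epsilon> * 4 ^ l x)"
        using a[OF A(4)[OF x]] by (simp add: good_def)
      ultimately have "dist x y \<le> \<epsilon> * 4 ^ l x" using controlledD A(1)[OF x] by blast
      also have "\<dots> \<le> \<epsilon> * dist x x0" using \<epsilon> A(5)[OF x] by simp
      finally show "dist x y \<le> \<epsilon> * dist x x0" .
    qed
    moreover have "c x \<le> n" if "x \<in> A" for x
      using a[OF A(4)[OF that]] A(1)[OF that] by (simp add: good_def c_def)
    ultimately show ?case unfolding A_def by blast
  qed
  then show "\<exists>\<delta>>0. \<forall>\<^sub>F R in at_top. \<exists>c::'a\<Rightarrow>nat. (\<forall>x\<in>{x\<in>X - ball x0 R. P x}. c x \<le> n) \<and>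
     controlled {x\<in>X - ball x0 R. P x} c (\<lambda>x. \<delta> * dist x x0) (\<lambda>x. \<epsilon> * dist x x0)"
    using \<delta>(1) by blast
qed

text \<open>Adjacent annuli touch, and unrelated colourings on them could chain through many annuli.
  Hence even and odd levels are coloured separately and joined as a union.\<close>

lemma small_colourable_linear:
  fixes X :: "'a::metric_space set"
  assumes sc: "small_colourable n at_top (\<lambda>R. X) (\<lambda>R _. R)"
  shows "small_colourable n at_top (\<lambda>R. X - ball x0 R) (\<lambda>R x. dist x x0)"
proof -
  define l where "l = (\<lambda>x. nat \<lfloor>log 4 (dist x x0)\<rfloor>)"
  have l: "4 ^ l x \<le> dist x x0 \<and> dist x x0 < 4 * 4 ^ l x" if "dist x x0 \<ge> 1" for x
  proof -
    have "x \<noteq> x0" using that by auto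
    define k where "k = \<lfloor>log 4 (dist x x0)\<rfloor>"
    have "0 \<le> log 4 (dist x x0)" by (subst zero_le_log_cancel_iff) (use that in auto)
    then have "k \<ge> 0" by (simp add: k_def)
    then have k: "real (l x) = real_of_int k" by (simp add: l_def k_def)
    have "real_of_int k \<le> log 4 (dist x x0)" "log 4 (dist x x0) < real_of_int k + 1"
      unfolding k_def by linarith+
    then have "4 powr real (l x) \<le> dist x x0" "dist x x0 < 4 powr (real (l x) + 1)"
      using \<open>x \<noteq> x0\<close> k by (auto simp: le_log_iff log_less_iff)
    then show ?thesis by (simp add: powr_add powr_realpow)
  qed
  have "small_colourable n at_top (\<lambda>R. {x\<in>X - ball x0 R. even (l x)} \<union> {x\<in>X - ball x0 R. odd (l x)})
     (\<lambda>R x. dist x x0)"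
  proof (rule small_colourable_Un)
    show "small_colourable n at_top (\<lambda>R. {x\<in>X - ball x0 R. even (l x)}) (\<lambda>R x. dist x x0)"
      by (rule small_colourable_annuli[OF sc, of x0 l]) (use l in \<open>auto, presburger\<close>)
    show "small_colourable n at_top (\<lambda>R. {x\<in>X - ball x0 R. odd (l x)}) (\<lambda>R x. dist x x0)"
      by (rule small_colourable_annuli[OF sc, of x0 l]) (use l in \<open>auto, presburger\<close>)
    show "\<forall>\<^sub>F R in at_top. \<forall>x\<in>{x\<in>X - ball x0 R. even (l x)} \<union> {x\<in>X - ball x0 R. odd (l x)}.
       0 \<le> dist x x0 \<and> (\<forall>y\<in>{x\<in>X - ball x0 R. even (l x)} \<union> {x\<in>X - ball x0 R. odd (l x)}.
       dist x x0 \<le> dist y x0 + dist x y)"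
      by (intro always_eventually) (metis add.commute dist_triangle zero_le_dist)
  qed
  moreover have "{x\<in>X - ball x0 R. even (l x)} \<union> {x\<in>X - ball x0 R. odd (l x)} = X - ball x0 R" for R
    by auto
  ultimately show ?thesis by simp
qed

section \<open>Transport by isometries\<close>

lemma Isom_comp_inv:
  assumes "\<gamma> \<in> Isom X" "\<gamma>' \<in> Isom X"
  shows "\<gamma>' \<circ> inv_into X \<gamma> \<in> Isom X"
proof -
  have b: "bij_betw \<gamma> X X" "bij_betw \<gamma>' X X" using assms by (auto simp: Isom_def)
  have "bij_betw (\<gamma>' \<circ> inv_into X \<gamma>) X X"
    using b by (meson bij_betw_inv_into bij_betw_trans)
  moreover have "dist (\<gamma>' (inv_into X \<gamma> x)) (\<gamma>' (inv_into X \<gamma> y)) = dist x y" if "x \<in> X" "y \<in> X" for x y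
  proof -
    have i: "inv_into X \<gamma> x \<in> X" "inv_into X \<gamma> y \<in> X"
      using b(1) that by (metis bij_betw_imp_surj_on inv_into_into)+
    have "\<gamma> (inv_into X \<gamma> x) = x" "\<gamma> (inv_into X \<gamma> y) = y"
      using b(1) that by (metis bij_betw_inv_into_right)+
    then show ?thesis using assms i by (force simp: Isom_def)
  qed
  ultimately show ?thesis by (simp add: Isom_def)
qed

text \<open>If y = \<gamma> u and z = \<gamma>' v with \<open>u\<close> and \<open>v\<close> in
  \<open>K\<close>, then \<gamma>' composed with the inverse of \<gamma> takes y to \<gamma>' u,
  whose distance from z is that of \<open>u\<close> from \<open>v\<close>.\<close>

lemma cocompact_transport:
  assumes "cocompact X"
  shows "\<exists>D. \<forall>y\<in>X. \<forall>z\<in>X. \<exists>\<gamma>\<in>Isom X. dist (\<gamma> y) z \<le> D"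
proof -
  obtain K where K: "K \<subseteq> X" "compact K" "X = (\<Union>\<gamma>\<in>Isom X. \<gamma> ` K)"
    using assms by (auto simp: cocompact_def)
  obtain D where D: "\<And>x y. x \<in> K \<Longrightarrow> y \<in> K \<Longrightarrow> dist x y \<le> D"
    using compact_imp_bounded[OF K(2)] unfolding bounded_two_points by blast
  show ?thesis
  proof (intro exI[of _ D] ballI)
    fix y z assume "y \<in> X" "z \<in> X"
    then have "y \<in> (\<Union>\<gamma>\<in>Isom X. \<gamma> ` K)" "z \<in> (\<Union>\<gamma>\<in>Isom X. \<gamma> ` K)" using K(3) by auto
    then obtain \<gamma> \<gamma>' u v where g: "\<gamma> \<in> Isom X" "\<gamma>' \<in> Isom X" "u \<in> K" "v \<in> K" "y = \<gamma> u" "z = \<gamma>' v"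
      by blast
    have uX: "u \<in> X" "v \<in> X" using g K(1) by auto
    have "inv_into X \<gamma> y = u"
      using g uX by (auto simp: Isom_def bij_betw_def)
    then have "dist ((\<gamma>' \<circ> inv_into X \<gamma>) y) z = dist u v"
      using g uX by (simp add: Isom_def)
    then show "\<exists>\<gamma>\<in>Isom X. dist (\<gamma> y) z \<le> D"
      using Isom_comp_inv[OF g(1,2)] D[OF g(3,4)] by (intro bexI) auto
  qed
qed

text \<open>Connectedness enters here: it supplies, at every prescribed radius, a target to which
  pieces can be moved.\<close>

lemma connected_unbounded_distance:
  fixes X :: "'a::metric_space set"
  assumes "connected X" "\<not> bounded X" "x0 \<in> X" "\<rho> \<ge> 0"
  obtains z where "z \<in> X" "dist z x0 = \<rho>"
proof -
  have "connected ((\<lambda>x. dist x x0) ` X)"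
    by (rule connected_continuous_image[OF _ assms(1)]) (intro continuous_intros)
  moreover have "\<exists>w\<in>X. dist w x0 > \<rho>"
  proof (rule ccontr)
    assume "\<not> ?thesis"
    then have "X \<subseteq> cball x0 \<rho>" by (auto simp: not_less dist_commute)
    then show False using assms(2) bounded_subset[OF bounded_cball] by blast
  qed
  then obtain w where w: "w \<in> X" "dist w x0 > \<rho>" ..
  moreover have "0 \<in> (\<lambda>x. dist x x0) ` X" by (rule image_eqI[OF _ assms(3)]) simp
  ultimately have "\<rho> \<in> (\<lambda>x. dist x x0) ` X"
    using assms(4) connectedD_interval[of "(\<lambda>x. dist x x0) ` X" 0 "dist w x0" \<rho>] by simp
  then show thesis using that by blast
qed

text \<open>The pieces of a colour class of the \<open>m\<close>-colouring at scale \<open>R\<close> are moved, one by one, into the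
  annulus of radius about \<open>3 * R\<close>, where the colourings at linearly growing scale are available.\<close>

lemma small_colourable_colour_class:
  fixes X :: "'a::metric_space set"
  assumes X: "connected X" "\<not> bounded X" "cocompact X" "x0 \<in> X"
    and W: "small_colourable n at_top (\<lambda>R. X - ball x0 R) (\<lambda>R x. dist x x0)"
    and \<delta>0: "\<delta>0 > 0"
    and c: "\<forall>\<^sub>F R in at_top. controlled X (c R :: 'a \<Rightarrow> nat) (\<lambda>x. \<delta>0 * R) (\<lambda>x. R)"
  shows "small_colourable n at_top (\<lambda>R. {x\<in>X. c R x = i}) (\<lambda>R _. R)"
  unfolding small_colourable_def
proof (intro allI impI)
  fix \<epsilon> :: real assume \<epsilon>: "\<epsilon> > 0"
  obtain D0 where D0: "\<And>y z. y \<in> X \<Longrightarrow> z \<in> X \<Longrightarrow> \<exists>\<gamma>\<in>Isom X. dist (\<gamma> y) z \<le> D0"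
    using cocompact_transport[OF X(3)] by blast
  obtain \<delta>1 where \<delta>1: "\<delta>1 > 0" and "\<forall>\<^sub>F R in at_top. \<exists>b::'a\<Rightarrow>nat. (\<forall>x\<in>X - ball x0 R. b x \<le> n) \<and>
     controlled (X - ball x0 R) b (\<lambda>x. \<delta>1 * dist x x0) (\<lambda>x. \<epsilon> / 5 * dist x x0)"
    by (rule small_colourableE[OF W, of "\<epsilon> / 5"]) (use \<epsilon> in auto)
  \<comment> \<open>One colouring \<open>b\<close> outside one ball serves every large
    \<open>R\<close>; larger scales use \<open>b\<close> further out.\<close>
  then obtain R1 where R1: "\<exists>b::'a\<Rightarrow>nat. (\<forall>x\<in>X - ball x0 R1. b x \<le> n) \<and>
     controlled (X - ball x0 R1) b (\<lambda>x. \<delta>1 * dist x x0) (\<lambda>x. \<epsilon> / 5 * dist x x0)"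
    unfolding eventually_at_top_linorder by blast
  then obtain b :: "'a \<Rightarrow> nat" where b: "\<forall>x\<in>X - ball x0 R1. b x \<le> n"
     "controlled (X - ball x0 R1) b (\<lambda>x. \<delta>1 * dist x x0) (\<lambda>x. \<epsilon> / 5 * dist x x0)" by blast
  define \<delta> where "\<delta> = min \<delta>0 \<delta>1"
  have \<delta>: "\<delta> > 0" "\<delta> \<le> \<delta>0" "\<delta> \<le> \<delta>1" using \<delta>0 \<delta>1 by (auto simp: \<delta>_def)
  have "\<forall>\<^sub>F R in at_top. \<exists>a::'a\<Rightarrow>nat. (\<forall>x\<in>{x\<in>X. c R x = i}. a x \<le> n) \<and>
     controlled {x\<in>X. c R x = i} a (\<lambda>x. \<delta> * R) (\<lambda>x. \<epsilon> * R)"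
    using eventually_ge_at_top[of "max 1 (max D0 R1)"] c
  proof eventually_elim
    case (elim R)
    have R: "R \<ge> 1" "R \<ge> D0" "R \<ge> R1" using elim by auto
    define rl where "rl = chain_rel X (c R) (\<lambda>x. \<delta>0 * R)"
    \<comment> \<open>A piece has radius at most R about its representative, which is moved to
      within D0 \<le> R of \<open>z\<close>. Around norm 3 R the whole piece then has norms between
      R and 5 R; the upper bound is the reason for \<epsilon> / 5 above.\<close>
    obtain z where z: "z \<in> X" "dist z x0 = 3 * R"
      using connected_unbounded_distance[OF X(1,2,4), of "3 * R"] R by auto
    have "\<forall>y\<in>X. \<exists>\<gamma>. \<gamma> \<in> Isom X \<and> dist (\<gamma> y) z \<le> D0" using D0 z by blast
    from bchoice[OF this] obtain g where g: "\<forall>y\<in>X. g y \<in> Isom X \<and> dist (g y y) z \<le> D0" ..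
    define h where "h = (\<lambda>x. g (chain_rep rl x) x)"
    have rep: "chain_rep rl x \<in> X" "dist x (chain_rep rl x) \<le> R" if "x \<in> X" for x
    proof -
      have r: "(x, chain_rep rl x) \<in> rl\<^sup>*" by (rule chain_rep_related)
      show "chain_rep rl x \<in> X" using chain_rel_rtrancl_in(1) r that unfolding rl_def by blast
      show "dist x (chain_rep rl x) \<le> R" using controlledD[OF elim(2) that] r unfolding rl_def by blast
    qed
    have h: "h x \<in> X" "dist (h x) x0 \<ge> R" "dist (h x) x0 \<le> 5 * R" if x: "x \<in> X" for x
    proof -
      define y where "y = chain_rep rl x"
      have y: "y \<in> X" "dist x y \<le> R" using rep[OF x] by (auto simp: y_def)
      have gy: "g y \<in> Isom X" "dist (g y y) z \<le> D0" using g y by auto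
      show "h x \<in> X" using gy x by (auto simp: h_def y_def[symmetric] Isom_def bij_betw_def)
      have "dist (g y x) (g y y) \<le> R" using gy x y by (auto simp: Isom_def)
      then have "dist (h x) z \<le> 2 * R"
        using gy R dist_triangle[of "h x" z "g y y"] by (simp add: h_def y_def[symmetric])
      then show "dist (h x) x0 \<ge> R" "dist (h x) x0 \<le> 5 * R"
        using z dist_triangle[of "h x" x0 z] dist_triangle[of z x0 "h x"] by (auto simp: dist_commute)
    qed
    have hA: "h x \<in> X - ball x0 R1" if "x \<in> X" for x
      using h[OF that] R by (auto simp: dist_commute)
    define A where "A = {x\<in>X. c R x = i}"
    \<comment> \<open>As \<delta> \<le> \<delta>0, a step inside the colour class stays in one
      piece, where \<open>h\<close> is a single isometry.\<close>
    have step: "(h x, h y) \<in> chain_rel (X - ball x0 R1) b (\<lambda>x. \<delta>1 * dist x x0)"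
      if xy: "(x, y) \<in> chain_rel A (b \<circ> h) (\<lambda>x. \<delta> * R)" for x y
    proof -
      note d = chain_relD[OF xy]
      have "\<delta> * R \<le> \<delta>0 * R" using \<delta> R by (intro mult_right_mono) auto
      then have "(x, y) \<in> rl"
        using d by (auto simp: rl_def chain_rel_def A_def)
      then have "chain_rep rl x = chain_rep rl y"
        by (intro chain_rep_eq) (auto simp: rl_def sym_chain_rel)
      then have "dist (h x) (h y) = dist x y"
        using g rep[of x] d by (auto simp: h_def A_def Isom_def)
      moreover have "\<delta> * R \<le> \<delta>1 * dist (h x) x0" "\<delta> * R \<le> \<delta>1 * dist (h y) x0"
        using \<delta> R h d \<delta>1 by (auto simp: A_def intro!: mult_mono)
      moreover have "h x \<in> X - ball x0 R1" "h y \<in> X - ball x0 R1" using hA d by (auto simp: A_def)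
      ultimately show ?thesis using d by (auto simp: chain_rel_def)
    qed
    have iso: "dist (h x) (h y) = dist x y"
      if x: "x \<in> X" and xy: "(x, y) \<in> rl\<^sup>*" for x y
    proof -
      have "chain_rep rl x = chain_rep rl y"
        using xy by (intro chain_rep_eq) (auto simp: rl_def sym_chain_rel)
      moreover have "y \<in> X" using chain_rel_rtrancl_in(1) x xy unfolding rl_def by blast
      ultimately show ?thesis using g rep[of x] x by (auto simp: h_def Isom_def)
    qed
    have "controlled A (b \<circ> h) (\<lambda>x. \<delta> * R) (\<lambda>x. \<epsilon> * R)"
      unfolding controlled_def
    proof (intro allI impI)
      fix x y assume x: "x \<in> A" and xy: "(x, y) \<in> (chain_rel A (b \<circ> h) (\<lambda>x. \<delta> * R))\<^sup>*"
      have xX: "x \<in> X" using x by (simp add: A_def)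
      have "(h x, h y) \<in> (chain_rel (X - ball x0 R1) b (\<lambda>x. \<delta>1 * dist x x0))\<^sup>*"
        using xy by induction (use step in \<open>auto intro: rtrancl_into_rtrancl\<close>)
      then have "dist (h x) (h y) \<le> \<epsilon> / 5 * dist (h x) x0"
        using controlledD[OF b(2)] hA[OF xX] by blast
      also have "\<dots> \<le> \<epsilon> / 5 * (5 * R)" using h[OF xX] \<epsilon> by (intro mult_left_mono) auto
      finally have "dist (h x) (h y) \<le> \<epsilon> * R" by simp
      moreover have "\<delta> * R \<le> \<delta>0 * R" using \<delta> R by (intro mult_right_mono) auto
      then have "chain_rel A (b \<circ> h) (\<lambda>x. \<delta> * R) \<subseteq> rl"
        by (auto simp: chain_rel_def rl_def A_def)
      then have "(x, y) \<in> rl\<^sup>*" using xy rtrancl_mono by blast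
      ultimately show "dist x y \<le> \<epsilon> * R" using iso[OF xX] by simp
    qed
    moreover have "(b \<circ> h) x \<le> n" if "x \<in> A" for x using b(1) hA that by (auto simp: A_def)
    ultimately show ?case unfolding A_def by blast
  qed
  then show "\<exists>\<delta>>0. \<forall>\<^sub>F R in at_top. \<exists>a::'a\<Rightarrow>nat. (\<forall>x\<in>{x\<in>X. c R x = i}. a x \<le> n) \<and>
     controlled {x\<in>X. c R x = i} a (\<lambda>x. \<delta> * R) (\<lambda>x. \<epsilon> * R)"
    using \<delta>(1) by blast
qed

section \<open>Joining the colour classes\<close>

lemma small_colourable_empty: "small_colourable n F (\<lambda>_. {}) s"
  unfolding small_colourable_def controlled_def by (auto intro: exI[of _ 1])

lemma small_colourable_cong:
  assumes "\<forall>\<^sub>F j in F. A j = B j" "small_colourable n F A s"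
  shows "small_colourable n F B s"
  unfolding small_colourable_def
proof (intro allI impI)
  fix \<epsilon> :: real assume "\<epsilon> > 0"
  then obtain \<delta> where "\<delta> > 0" and *: "\<forall>\<^sub>F j in F. \<exists>c::'b \<Rightarrow> nat. (\<forall>x\<in>A j. c x \<le> n) \<and>
     controlled (A j) c (\<lambda>x. \<delta> * s j x) (\<lambda>x. \<epsilon> * s j x)"
    using small_colourableE[OF assms(2)] by blast
  have "\<forall>\<^sub>F j in F. \<exists>c::'b \<Rightarrow> nat. (\<forall>x\<in>B j. c x \<le> n) \<and>
     controlled (B j) c (\<lambda>x. \<delta> * s j x) (\<lambda>x. \<epsilon> * s j x)"
    using * assms(1) by eventually_elim simp
  then show "\<exists>\<delta>>0. \<forall>\<^sub>F j in F. \<exists>c::'b \<Rightarrow> nat. (\<forall>x\<in>B j. c x \<le> n) \<and>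
     controlled (B j) c (\<lambda>x. \<delta> * s j x) (\<lambda>x. \<epsilon> * s j x)"
    using \<open>\<delta> > 0\<close> by blast
qed

lemma small_colourable_linear_imp_global:
  fixes X :: "'a::metric_space set"
  assumes X: "connected X" "\<not> bounded X" "cocompact X" "x0 \<in> X"
    and W: "small_colourable n at_top (\<lambda>R. X - ball x0 R) (\<lambda>R x. dist x x0)"
    and m: "small_colourable m at_top (\<lambda>R. X) (\<lambda>R _. R)"
  shows "small_colourable n at_top (\<lambda>R. X) (\<lambda>R _. R)"
proof -
  obtain \<delta>0 where \<delta>0: "\<delta>0 > 0" and ev: "\<forall>\<^sub>F R in at_top. \<exists>c::'a\<Rightarrow>nat. (\<forall>x\<in>X. c x \<le> m) \<and>
     controlled X c (\<lambda>x. \<delta>0 * R) (\<lambda>x. 1 * R)"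
    by (rule small_colourableE[OF m zero_less_one])
  define good where "good = (\<lambda>R (c::'a\<Rightarrow>nat). (\<forall>x\<in>X. c x \<le> m) \<and>
     controlled X c (\<lambda>x. \<delta>0 * R) (\<lambda>x. R))"
  \<comment> \<open>The auxiliary colourings are fixed once, with classes of size R; the families of
    their colour classes must not depend on the \<epsilon> for which they are recoloured.\<close>
  define c where "c = (\<lambda>R. SOME c. good R c)"
  have good: "\<forall>\<^sub>F R in at_top. good R (c R)"
    using ev
  proof eventually_elim
    case (elim R)
    then have "\<exists>c. good R c" by (simp add: good_def)
    then show ?case unfolding c_def by (rule someI_ex)
  qed
  have colour_class: "small_colourable n at_top (\<lambda>R. {x\<in>X. c R x = i}) (\<lambda>R _. R)" for i
    by (rule small_colourable_colour_class[OF X W \<delta>0])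
       (use good in \<open>auto simp: good_def elim: eventually_mono\<close>)
  \<comment> \<open>The number of unions is m + 1 for every \<open>R\<close>, so the constants of
    the union lemma remain independent of \<open>R\<close>.\<close>
  have "small_colourable n at_top (\<lambda>R. {x\<in>X. c R x < k}) (\<lambda>R _. R)" for k
  proof (induction k)
    case 0
    show ?case by (simp add: small_colourable_empty)
  next
    case (Suc k)
    have "small_colourable n at_top (\<lambda>R. {x\<in>X. c R x < k} \<union> {x\<in>X. c R x = k}) (\<lambda>R _. R)"
      by (rule small_colourable_Un[OF _ Suc colour_class])
         (rule eventually_mono[OF eventually_ge_at_top[of 0]], auto)
    moreover have "{x\<in>X. c R x < k} \<union> {x\<in>X. c R x = k} = {x\<in>X. c R x < Suc k}" for R by auto
    ultimately show ?case by simp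
  qed
  then have "small_colourable n at_top (\<lambda>R. {x\<in>X. c R x < Suc m}) (\<lambda>R _. R)" .
  moreover have "\<forall>\<^sub>F R in at_top. {x\<in>X. c R x < Suc m} = X"
    using good by eventually_elim (auto simp: good_def less_Suc_eq_le)
  ultimately show ?thesis by (rule small_colourable_cong[rotated])
qed

section \<open>Higson functions of the sublinear structure\<close>

lemma eventually_to_infinity:
  "eventually P (to_infinity X x0) \<longleftrightarrow> (\<exists>B. \<forall>x\<in>X. dist x x0 \<ge> B \<longrightarrow> P x)"
proof
  assume "eventually P (to_infinity X x0)"
  then obtain Q where Q: "eventually Q at_top" "\<And>x. Q (dist x x0) \<Longrightarrow> x \<in> X \<longrightarrow> P x"
    unfolding to_infinity_def eventually_inf_principal eventually_filtercomap by blast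
  then obtain B where "\<And>b. b \<ge> B \<Longrightarrow> Q b" unfolding eventually_at_top_linorder by blast
  then show "\<exists>B. \<forall>x\<in>X. dist x x0 \<ge> B \<longrightarrow> P x" using Q(2) by blast
next
  assume "\<exists>B. \<forall>x\<in>X. dist x x0 \<ge> B \<longrightarrow> P x"
  then obtain B where "\<And>x. x \<in> X \<Longrightarrow> dist x x0 \<ge> B \<Longrightarrow> P x" by blast
  then show "eventually P (to_infinity X x0)"
    unfolding to_infinity_def eventually_inf_principal eventually_filtercomap
    using eventually_ge_at_top[of B] by blast
qed

lemma ennreal_tendsto_0I:
  fixes g :: "'a \<Rightarrow> ennreal"
  assumes "\<And>\<eta>. \<eta> > 0 \<Longrightarrow> eventually (\<lambda>x. g x \<le> ennreal \<eta>) F"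
  shows "(g \<longlongrightarrow> 0) F"
proof (rule order_tendstoI)
  fix a :: ennreal assume "0 < a"
  then obtain b where b: "0 < b" "b < a" using dense by blast
  have "b \<noteq> top" using b(2) by auto
  then obtain \<eta> where \<eta>: "b = ennreal \<eta>" "\<eta> \<ge> 0" by (cases b) auto
  have "\<eta> > 0" using \<eta> b by (simp add: ennreal_less_zero_iff)
  then show "\<forall>\<^sub>F x in F. g x < a"
    using assms[of \<eta>] b \<eta> by (auto elim: eventually_mono)
qed auto

lemma SUP_ennreal_divide_le:
  assumes "\<And>y. y \<in> S \<Longrightarrow> g y \<le> \<eta> * d" "d > 0" "\<eta> > 0"
  shows "(SUP y\<in>S. ennreal (g y)) / ennreal d \<le> ennreal \<eta>"
proof -
  have "(SUP y\<in>S. ennreal (g y)) \<le> ennreal (\<eta> * d)"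
    by (intro SUP_least ennreal_leI assms)
  then have "(SUP y\<in>S. ennreal (g y)) / ennreal d \<le> ennreal (\<eta> * d) / ennreal d"
    by (rule divide_right_mono_ennreal)
  also have "\<dots> = ennreal \<eta>" using assms by (simp add: divide_ennreal)
  finally show ?thesis .
qed

lemma SUP_ennreal_divide_less:
  assumes "(SUP y\<in>S. ennreal (g y)) / ennreal d < ennreal \<delta>" "d > 0" "\<delta> > 0" "y \<in> S"
  shows "g y \<le> \<delta> * d"
proof (rule ccontr)
  assume "\<not> g y \<le> \<delta> * d"
  then have gy: "g y / d \<ge> \<delta>" "g y \<ge> 0"
    using assms(2,3) by (auto simp: field_simps intro: order_trans[of _ "\<delta> * d"])
  have "ennreal \<delta> \<le> ennreal (g y) / ennreal d"
    using gy assms(2) by (simp add: divide_ennreal ennreal_leI)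
  also have "\<dots> \<le> (SUP y\<in>S. ennreal (g y)) / ennreal d"
    by (intro divide_right_mono_ennreal SUP_upper assms)
  finally show False using assms(1) by simp
qed

section \<open>Higson functions as functions of small oscillation at linear scale\<close>

lemma relatively_compact_bounded:
  assumes "relatively_compact X K"
  obtains B where "\<And>x. x \<in> K \<Longrightarrow> dist x x0 \<le> B"
proof -
  have "K \<subseteq> X \<inter> closure K" "bounded (X \<inter> closure K)"
    using assms closure_subset[of K] by (auto simp: relatively_compact_def compact_imp_bounded)
  then have "bounded K" using bounded_subset by blast
  then obtain B where "\<forall>x\<in>K. dist x0 x \<le> B" unfolding bounded_any_center[of K x0] by blast
  then show thesis using that[of B] by (simp add: dist_commute)
qed

lemma relatively_compact_finite: "finite K \<Longrightarrow> K \<subseteq> X \<Longrightarrow> relatively_compact X K"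
  by (simp add: relatively_compact_def closure_closed finite_imp_closed Int_absorb1 finite_imp_compact)

text \<open>Turns a sequence of counterexamples into one entourage. Only finitely many pairs meet a
  bounded set, which gives properness, and the relative distances tend to 0.\<close>

lemma sequence_in_sublinear_structure:
  fixes u v :: "nat \<Rightarrow> 'a::metric_space"
  assumes uX: "\<And>k. u k \<in> X" and vX: "\<And>k. v k \<in> X"
    and u: "\<And>k. dist (u k) x0 \<ge> real k + 1"
    and uv: "\<And>k. dist (u k) (v k) \<le> dist (u k) x0 / (real k + 2)"
  shows "range (\<lambda>k. (v k, u k)) \<in> sublinear_structure X x0"
proof -
  define E where "E = range (\<lambda>k. (v k, u k))"
  \<comment> \<open>The denominator k + 2 is at least 2, so \<open>v k\<close> has at least half the
    norm of \<open>u k\<close>; this allows normalising by the second point as well.\<close>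
  have vu: "dist (u k) x0 \<le> 2 * dist (v k) x0" for k
  proof -
    have "dist (u k) x0 / (real k + 2) \<le> dist (u k) x0 / 2" by (intro divide_left_mono) auto
    then show ?thesis using uv[of k] dist_triangle[of "u k" x0 "v k"] by linarith
  qed
  have "proper_entourage X E"
    unfolding proper_entourage_def
  proof (intro conjI allI impI)
    show "E \<subseteq> X \<times> X" using uX vX by (auto simp: E_def)
    fix K assume "relatively_compact X K"
    then obtain B where B: "\<And>x. x \<in> K \<Longrightarrow> dist x x0 \<le> B" using relatively_compact_bounded by blast
    have "ent_image E K \<subseteq> v ` {..nat \<lceil>B\<rceil>}"
    proof
      fix x assume "x \<in> ent_image E K"
      then obtain k where k: "x = v k" "u k \<in> K" by (auto simp: ent_image_def E_def)
      have "real k \<le> B" using B[OF k(2)] u[of k] by simp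
      then have "k \<le> nat \<lceil>B\<rceil>" by linarith
      then show "x \<in> v ` {..nat \<lceil>B\<rceil>}" using k by auto
    qed
    then show "relatively_compact X (ent_image E K)"
      using vX finite_subset[of "ent_image E K"] by (intro relatively_compact_finite) auto
    have "ent_image (E\<inverse>) K \<subseteq> u ` {..nat \<lceil>2 * B\<rceil>}"
    proof
      fix x assume "x \<in> ent_image (E\<inverse>) K"
      then obtain k where k: "x = u k" "v k \<in> K" by (auto simp: ent_image_def E_def)
      have "real k \<le> 2 * B" using B[OF k(2)] u[of k] vu[of k] by simp
      then have "k \<le> nat \<lceil>2 * B\<rceil>" by linarith
      then show "x \<in> u ` {..nat \<lceil>2 * B\<rceil>}" using k by auto
    qed
    then show "relatively_compact X (ent_image (E\<inverse>) K)"
      using uX finite_subset[of "ent_image (E\<inverse>) K"] by (intro relatively_compact_finite) auto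
  qed
  moreover have "\<exists>B. \<forall>x\<in>X. dist x x0 \<ge> B \<longrightarrow>
      (SUP y\<in>ent_image E {x}. ennreal (dist y x)) / ennreal (dist x x0) \<le> ennreal \<eta> \<and>
      (SUP y\<in>ent_image (E\<inverse>) {x}. ennreal (dist x y)) / ennreal (dist x x0) \<le> ennreal \<eta>"
    if \<eta>: "\<eta> > 0" for \<eta>
  proof -
    obtain k0 :: nat where k0: "2 / \<eta> \<le> real k0" using real_arch_simple by blast
    \<comment> \<open>Larger than the norms of all points with index below \<open>k0\<close>; a
      point of norm at least \<open>B\<close> therefore only occurs with index at least
      \<open>k0\<close>.\<close>
    define B where "B = 1 + (\<Sum>k<k0. dist (u k) x0 + dist (v k) x0)"
    have B1: "B \<ge> 1" by (simp add: B_def sum_nonneg)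
    have small: "2 * d / (real k + 2) \<le> \<eta> * d" if "k \<ge> k0" "d \<ge> 0" for k d
    proof -
      have "2 / \<eta> \<le> real k + 2" using k0 that by linarith
      then have "2 / (real k + 2) \<le> \<eta>" using \<eta> by (simp add: field_simps)
      then show ?thesis using mult_right_mono[OF _ that(2), of "2 / (real k + 2)" \<eta>] by simp
    qed
    have kB: "k \<ge> k0" if "dist (u k) x0 \<ge> B \<or> dist (v k) x0 \<ge> B" for k
    proof (rule ccontr)
      assume "\<not> k \<ge> k0"
      then have "dist (u k) x0 + dist (v k) x0 \<le> (\<Sum>k<k0. dist (u k) x0 + dist (v k) x0)"
        by (intro member_le_sum[of k "{..<k0}" "\<lambda>k. dist (u k) x0 + dist (v k) x0"]) auto
      then show False using that zero_le_dist[of "u k" x0] zero_le_dist[of "v k" x0]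
        unfolding B_def by linarith
    qed
    show ?thesis
    proof (intro exI[of _ B] ballI impI conjI)
      fix x assume x: "x \<in> X" "dist x x0 \<ge> B"
      have d: "dist x x0 > 0" using x B1 by linarith
      show "(SUP y\<in>ent_image E {x}. ennreal (dist y x)) / ennreal (dist x x0) \<le> ennreal \<eta>"
      proof (rule SUP_ennreal_divide_le[OF _ d \<eta>])
        fix y assume "y \<in> ent_image E {x}"
        then obtain k where k: "y = v k" "x = u k" by (auto simp: ent_image_def E_def)
        have "dist x y \<le> dist x x0 / (real k + 2)" using uv[of k] k by simp
        also have "\<dots> \<le> 2 * dist x x0 / (real k + 2)" by (intro divide_right_mono) auto
        also have "\<dots> \<le> \<eta> * dist x x0" using small kB[of k] k x by simp
        finally show "dist y x \<le> \<eta> * dist x x0" by (simp add: dist_commute)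
      qed
      show "(SUP y\<in>ent_image (E\<inverse>) {x}. ennreal (dist x y)) / ennreal (dist x x0) \<le> ennreal \<eta>"
      proof (rule SUP_ennreal_divide_le[OF _ d \<eta>])
        fix y assume "y \<in> ent_image (E\<inverse>) {x}"
        then obtain k where k: "y = u k" "x = v k" by (auto simp: ent_image_def E_def)
        have "dist x y \<le> dist y x0 / (real k + 2)" using uv[of k] k by (simp add: dist_commute)
        also have "\<dots> \<le> 2 * dist x x0 / (real k + 2)" using vu[of k] k by (intro divide_right_mono) auto
        also have "\<dots> \<le> \<eta> * dist x x0" using small kB[of k] k x by simp
        finally show "dist x y \<le> \<eta> * dist x x0" .
      qed
    qed
  qed
  then have "((\<lambda>x. (SUP y\<in>ent_image E {x}. ennreal (dist y x)) / ennreal (dist x x0))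
        \<longlongrightarrow> 0) (to_infinity X x0)"
    "((\<lambda>x. (SUP y\<in>ent_image (E\<inverse>) {x}. ennreal (dist x y)) / ennreal (dist x x0))
        \<longlongrightarrow> 0) (to_infinity X x0)"
    by (intro ennreal_tendsto_0I; unfold eventually_to_infinity; blast)+
  ultimately show ?thesis unfolding sublinear_structure_def E_def[symmetric] by blast
qed

text \<open>The quantifier over all entourages becomes one uniform estimate: if every \<delta> = 1 /
  (k + 2) fails beyond radius k + 1, the failing pairs form a single sublinear entourage along which
  \<open>f\<close> keeps oscillating.\<close>

lemma Higson_functions_slow:
  fixes X :: "'a::metric_space set"
  assumes f: "f \<in> Higson_functions X (sublinear_structure X x0)" and \<epsilon>: "\<epsilon> > 0"
  shows "\<exists>\<delta>>0. \<exists>R. \<forall>x\<in>X. \<forall>y\<in>X. dist x x0 \<ge> R \<and> dist x y \<le> \<delta> * dist x x0 \<longrightarrow> cmod (f x - f y) < \<epsilon>"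
proof (rule ccontr)
  assume neg: "\<not> ?thesis"
  have "\<forall>k::nat. \<exists>p. fst p \<in> X \<and> snd p \<in> X \<and> dist (fst p) x0 \<ge> real k + 1 \<and>
     dist (fst p) (snd p) \<le> dist (fst p) x0 / (real k + 2) \<and> \<not> cmod (f (fst p) - f (snd p)) < \<epsilon>"
  proof
    fix k :: nat
    have "1 / (real k + 2) > 0" by simp
    then obtain x y where "x \<in> X" "y \<in> X" "dist x x0 \<ge> real k + 1"
      "dist x y \<le> 1 / (real k + 2) * dist x x0" "\<not> cmod (f x - f y) < \<epsilon>"
      using neg by blast
    then show "\<exists>p. fst p \<in> X \<and> snd p \<in> X \<and> dist (fst p) x0 \<ge> real k + 1 \<and>
     dist (fst p) (snd p) \<le> dist (fst p) x0 / (real k + 2) \<and> \<not> cmod (f (fst p) - f (snd p)) < \<epsilon>"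
      by (intro exI[of _ "(x, y)"]) simp
  qed
  from choice[OF this] obtain p where p: "\<forall>k. fst (p k) \<in> X \<and> snd (p k) \<in> X \<and>
     dist (fst (p k)) x0 \<ge> real k + 1 \<and> dist (fst (p k)) (snd (p k)) \<le> dist (fst (p k)) x0 / (real k + 2) \<and>
     \<not> cmod (f (fst (p k)) - f (snd (p k))) < \<epsilon>" ..
  have "range (\<lambda>k. (snd (p k), fst (p k))) \<in> sublinear_structure X x0"
    by (rule sequence_in_sublinear_structure) (use p in auto)
  then obtain K where K: "compact K" and close:
    "\<And>x y. (y, x) \<in> range (\<lambda>k. (snd (p k), fst (p k))) - K \<times> K \<Longrightarrow> cmod (f x - f y) < \<epsilon>"
    using f \<epsilon> unfolding Higson_functions_def by blast
  obtain B where B: "\<forall>x\<in>K. dist x0 x \<le> B"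
    using compact_imp_bounded[OF K] unfolding bounded_any_center[of K x0] by blast
  obtain k :: nat where k: "B \<le> real k" using real_arch_simple by blast
  have "fst (p k) \<notin> K"
  proof
    assume "fst (p k) \<in> K"
    then have "dist (fst (p k)) x0 \<le> B" using B by (metis dist_commute)
    moreover have "dist (fst (p k)) x0 \<ge> real k + 1" using p by blast
    ultimately show False using k by linarith
  qed
  then have "cmod (f (fst (p k)) - f (snd (p k))) < \<epsilon>" by (intro close) auto
  then show False using p by blast
qed

lemma slow_imp_Higson_functions:
  fixes X :: "'a::metric_space set"
  assumes X: "proper_metric X" and f: "bounded_continuous X f"
    and slow: "\<And>\<epsilon>. \<epsilon> > 0 \<Longrightarrow> \<exists>\<delta>>0. \<exists>R. \<forall>x\<in>X. \<forall>y\<in>X. dist x x0 \<ge> R \<and> dist x y \<le> \<delta> * dist x x0 \<longrightarrow>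
       cmod (f x - f y) < \<epsilon>"
  shows "f \<in> Higson_functions X (sublinear_structure X x0)"
proof -
  have "\<exists>K. K \<subseteq> X \<and> compact K \<and> (\<forall>x y. (y, x) \<in> E - K \<times> K \<longrightarrow> cmod (f x - f y) < \<epsilon>)"
    if E: "E \<in> sublinear_structure X x0" and \<epsilon>: "\<epsilon> > 0" for E \<epsilon>
  proof -
    obtain \<delta> R where \<delta>: "\<delta> > 0" and close: "\<And>x y. x \<in> X \<Longrightarrow> y \<in> X \<Longrightarrow> dist x x0 \<ge> R \<Longrightarrow>
       dist x y \<le> \<delta> * dist x x0 \<Longrightarrow> cmod (f x - f y) < \<epsilon>"
      using slow[OF \<epsilon>] by blast
    have EX: "E \<subseteq> X \<times> X" using E by (auto simp: sublinear_structure_def proper_entourage_def)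
    have lims: "((\<lambda>x. (SUP y\<in>ent_image E {x}. ennreal (dist y x)) / ennreal (dist x x0))
        \<longlongrightarrow> 0) (to_infinity X x0)"
      "((\<lambda>x. (SUP y\<in>ent_image (E\<inverse>) {x}. ennreal (dist x y)) / ennreal (dist x x0))
        \<longlongrightarrow> 0) (to_infinity X x0)"
      using E by (auto simp: sublinear_structure_def)
    have "ennreal \<delta> > 0" using \<delta> by simp
    note ev = order_tendstoD(2)[OF lims(1) this] order_tendstoD(2)[OF lims(2) this]
    obtain B1 where B1: "\<And>x. x \<in> X \<Longrightarrow> dist x x0 \<ge> B1 \<Longrightarrow>
       (SUP y\<in>ent_image E {x}. ennreal (dist y x)) / ennreal (dist x x0) < ennreal \<delta>"
      using ev(1) unfolding eventually_to_infinity by blast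
    obtain B2 where B2: "\<And>x. x \<in> X \<Longrightarrow> dist x x0 \<ge> B2 \<Longrightarrow>
       (SUP y\<in>ent_image (E\<inverse>) {x}. ennreal (dist x y)) / ennreal (dist x x0) < ennreal \<delta>"
      using ev(2) unfolding eventually_to_infinity by blast
    define B where "B = max 1 (max R (max B1 B2))"
    define K where "K = X \<inter> cball x0 B"
    have "compact K"
      using X unfolding proper_metric_def K_def
      by (meson bounded_Int bounded_cball closed_cball closedin_closed_Int)
    moreover have "cmod (f x - f y) < \<epsilon>" if yx: "(y, x) \<in> E - K \<times> K" for x y
    proof -
      have xy: "x \<in> X" "y \<in> X" using yx EX by auto
      then have "dist x x0 > B \<or> dist y x0 > B" using yx by (auto simp: K_def dist_commute not_le)
      \<comment> \<open>Possibly only one of the two points lies outside \<open>K\<close>; the two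
        limits in the sublinear structure serve the two cases.\<close>
      then show ?thesis
      proof
        assume xB: "dist x x0 > B"
        then have d: "dist x x0 > 0" "dist x x0 \<ge> B1" "dist x x0 \<ge> R" by (auto simp: B_def)
        have "dist y x \<le> \<delta> * dist x x0"
          by (rule SUP_ennreal_divide_less[OF B1[OF xy(1) d(2)] d(1) \<delta>])
             (use yx in \<open>auto simp: ent_image_def\<close>)
        then show ?thesis using close[OF xy d(3)] by (simp add: dist_commute)
      next
        assume yB: "dist y x0 > B"
        then have d: "dist y x0 > 0" "dist y x0 \<ge> B2" "dist y x0 \<ge> R" by (auto simp: B_def)
        have "dist y x \<le> \<delta> * dist y x0"
          by (rule SUP_ennreal_divide_less[OF B2[OF xy(2) d(2)] d(1) \<delta>])
             (use yx in \<open>auto simp: ent_image_def\<close>)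
        then show ?thesis using close[OF xy(2,1) d(3)] by (simp add: norm_minus_commute)
      qed
    qed
    ultimately show ?thesis by (intro exI[of _ K]) (auto simp: K_def)
  qed
  then show ?thesis using f unfolding Higson_functions_def by blast
qed

text \<open>Numerator and denominator are both Lipschitz and the numerator grows at most linearly,
  so the quotient changes by at most a constant times \<open>dist x y\<close> over the norm. The
  function vanishes on \<open>W\<close> and equals 1 where the distance to \<open>W\<close> is
  comparable with the norm.\<close>

lemma divergence_function_Higson:
  fixes X :: "'a::metric_space set"
  assumes X: "proper_metric X" and \<kappa>: "\<kappa> > 0" and W: "W \<noteq> {}"
  shows "(\<lambda>x. complex_of_real (min 1 (infdist x W / (\<kappa> * (dist x x0 + 1)))))
           \<in> Higson_functions X (sublinear_structure X x0)"
proof (rule slow_imp_Higson_functions[OF X])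
  define g where "g = (\<lambda>x. infdist x W / (\<kappa> * (dist x x0 + 1)))"
  have pos: "\<kappa> * (dist x x0 + 1) > 0" for x using \<kappa> by (simp add: add_nonneg_pos)
  have g0: "g x \<ge> 0" for x unfolding g_def using pos[of x] by (simp add: infdist_nonneg)
  have "continuous_on X g"
    unfolding g_def using pos by (intro continuous_intros) (metis less_irrefl)
  then have "continuous_on X (\<lambda>x. complex_of_real (min 1 (g x)))"
    by (intro continuous_intros)
  moreover have "norm (complex_of_real (min 1 (g x))) \<le> 1" for x using g0[of x] by (simp add: norm_of_real)
  then have "bounded ((\<lambda>x. complex_of_real (min 1 (g x))) ` X)" by (auto simp: bounded_iff)
  ultimately show "bounded_continuous X (\<lambda>x. complex_of_real (min 1 (infdist x W / (\<kappa> * (dist x x0 + 1)))))"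
    by (simp add: bounded_continuous_def g_def)
  fix \<epsilon> :: real assume \<epsilon>: "\<epsilon> > 0"
  \<comment> \<open>The bound \<open>infdist y W\<close> \<le> (M - 1) (|y| + 1) is used for the
    change of the denominator; one more unit pays for that of the numerator.\<close>
  define M where "M = 2 + infdist x0 W"
  have M: "M \<ge> 2" by (simp add: M_def infdist_nonneg)
  define \<delta> where "\<delta> = \<epsilon> * \<kappa> / (2 * M)"
  have \<delta>: "\<delta> > 0" using \<epsilon> \<kappa> M by (simp add: \<delta>_def)
  have main: "\<bar>g x - g y\<bar> \<le> M * dist x y / (\<kappa> * (dist x x0 + 1))" for x y
  proof -
    define a where "a = dist x x0 + 1"
    define b where "b = dist y x0 + 1"
    have ab: "a \<ge> 1" "b \<ge> 1" by (auto simp: a_def b_def)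
    have 1: "\<bar>infdist x W - infdist y W\<bar> \<le> dist x y"
      using infdist_triangle[of x W y] infdist_triangle[of y W x] by (auto simp: dist_commute abs_le_iff)
    have 2: "\<bar>a - b\<bar> \<le> dist x y"
      unfolding a_def b_def using dist_triangle[of x x0 y] dist_triangle[of y x0 x]
      by (auto simp: dist_commute abs_le_iff)
    have "infdist y W \<le> infdist x0 W + dist y x0" using infdist_triangle[of y W x0] by simp
    also have "\<dots> \<le> (M - 1) * b"
    proof -
      have "infdist x0 W * 1 \<le> infdist x0 W * b" using ab infdist_nonneg by (intro mult_left_mono) auto
      then show ?thesis by (simp add: M_def b_def algebra_simps)
    qed
    finally have y: "infdist y W \<le> (M - 1) * b" .
    have "g x - g y = ((infdist x W - infdist y W) * b + infdist y W * (b - a)) / (\<kappa> * a * b)"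
      using ab \<kappa> unfolding g_def a_def[symmetric] b_def[symmetric] by (simp add: field_simps)
    also have "\<bar>\<dots>\<bar> = \<bar>(infdist x W - infdist y W) * b + infdist y W * (b - a)\<bar> / (\<kappa> * a * b)"
      using ab \<kappa> by (simp add: abs_mult)
    also have "\<dots> \<le> (M * dist x y * b) / (\<kappa> * a * b)"
    proof (rule divide_right_mono)
      have "\<bar>(infdist x W - infdist y W) * b + infdist y W * (b - a)\<bar>
          \<le> \<bar>infdist x W - infdist y W\<bar> * b + infdist y W * \<bar>a - b\<bar>"
        using ab infdist_nonneg[of y W]
        by (intro order_trans[OF abs_triangle_ineq]) (simp add: abs_mult abs_minus_commute)
      also have "\<dots> \<le> dist x y * b + ((M - 1) * b) * dist x y"
        using 1 2 y ab M infdist_nonneg[of y W] by (intro add_mono mult_mono) auto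
      finally show "\<bar>(infdist x W - infdist y W) * b + infdist y W * (b - a)\<bar> \<le> M * dist x y * b"
        by (simp add: algebra_simps)
      show "0 \<le> \<kappa> * a * b" using \<kappa> ab by simp
    qed
    also have "\<dots> = M * dist x y / (\<kappa> * a)" using ab by simp
    finally show ?thesis by (simp add: a_def)
  qed
  have "cmod (complex_of_real (min 1 (g x)) - complex_of_real (min 1 (g y))) < \<epsilon>"
    if "dist x y \<le> \<delta> * dist x x0" for x y
  proof -
    have "\<bar>min 1 (g x) - min 1 (g y)\<bar> \<le> \<bar>g x - g y\<bar>" by (auto simp: min_def)
    also have "\<dots> \<le> M * dist x y / (\<kappa> * (dist x x0 + 1))" by (rule main)
    also have "\<dots> \<le> M * (\<delta> * (dist x x0 + 1)) / (\<kappa> * (dist x x0 + 1))"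
    proof (intro divide_right_mono mult_left_mono)
      show "dist x y \<le> \<delta> * (dist x x0 + 1)" using that \<delta> by (simp add: algebra_simps)
    qed (use M pos[of x] in auto)
    also have "\<dots> = M * \<delta> / \<kappa>" 
      using add_nonneg_pos[OF zero_le_dist[of x x0] zero_less_one] by (simp add: less_imp_neq[symmetric])
    also have "\<dots> = \<epsilon> / 2" using M \<kappa> by (simp add: \<delta>_def)
    also have "\<dots> < \<epsilon>" using \<epsilon> by simp
    finally show ?thesis by (metis norm_of_real of_real_diff)
  qed
  then show "\<exists>\<delta>>0. \<exists>R. \<forall>x\<in>X. \<forall>y\<in>X. dist x x0 \<ge> R \<and> dist x y \<le> \<delta> * dist x x0 \<longrightarrow>
     cmod (complex_of_real (min 1 (infdist x W / (\<kappa> * (dist x x0 + 1)))) -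
       complex_of_real (min 1 (infdist y W / (\<kappa> * (dist y x0 + 1))))) < \<epsilon>"
    using \<delta> unfolding g_def by blast
qed

section \<open>The sublinear Higson corona\<close>

text \<open>Separate each \<open>K i\<close> from the union of the others by open sets U i and V i,
  and let \<open>G i\<close> be the intersection of U i with all V j for j \<noteq> i. Then
  \<open>G i\<close> lies in U i and \<open>G j\<close> in V i.\<close>

lemma normal_space_disjoint_expansion:
  assumes T: "normal_space T" and I: "finite I" and K: "\<And>i. i \<in> I \<Longrightarrow> closedin T (K i)"
    and disj: "\<And>i j. i \<in> I \<Longrightarrow> j \<in> I \<Longrightarrow> i \<noteq> j \<Longrightarrow> K i \<inter> K j = {}"
  obtains G where "\<And>i. i \<in> I \<Longrightarrow> openin T (G i) \<and> K i \<subseteq> G i"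
    "\<And>i j. i \<in> I \<Longrightarrow> j \<in> I \<Longrightarrow> i \<noteq> j \<Longrightarrow> G i \<inter> G j = {}"
proof -
  have "\<forall>i\<in>I. \<exists>p. openin T (fst p) \<and> openin T (snd p) \<and> K i \<subseteq> fst p \<and>
     (\<Union>j\<in>I-{i}. K j) \<subseteq> snd p \<and> disjnt (fst p) (snd p)"
  proof
    fix i assume i: "i \<in> I"
    have "closedin T (\<Union>j\<in>I-{i}. K j)" using I K by (intro closedin_Union) auto
    moreover have "disjnt (K i) (\<Union>j\<in>I-{i}. K j)" using disj[OF i] unfolding disjnt_def by blast
    ultimately have "\<exists>U V. openin T U \<and> openin T V \<and> K i \<subseteq> U \<and> (\<Union>j\<in>I-{i}. K j) \<subseteq> V \<and> disjnt U V"
      using T[unfolded normal_space_def, rule_format, of "K i"] K[OF i] by simp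
    then obtain U V where "openin T U" "openin T V" "K i \<subseteq> U" "(\<Union>j\<in>I-{i}. K j) \<subseteq> V" "disjnt U V"
      by (elim exE conjE)
    then show "\<exists>p. openin T (fst p) \<and> openin T (snd p) \<and> K i \<subseteq> fst p \<and>
     (\<Union>j\<in>I-{i}. K j) \<subseteq> snd p \<and> disjnt (fst p) (snd p)"
      by (intro exI[of _ "(U, V)"]) auto
  qed
  from bchoice[OF this] obtain p where p: "\<forall>i\<in>I. openin T (fst (p i)) \<and> openin T (snd (p i)) \<and>
     K i \<subseteq> fst (p i) \<and> (\<Union>j\<in>I-{i}. K j) \<subseteq> snd (p i) \<and> disjnt (fst (p i)) (snd (p i))" ..
  define G where "G = (\<lambda>i. \<Inter>(insert (fst (p i)) ((\<lambda>j. snd (p j)) ` (I - {i}))))"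
  show thesis
  proof (rule that[of G])
    fix i assume i: "i \<in> I"
    have "openin T (G i)" unfolding G_def by (rule openin_Inter) (use I p i in auto)
    moreover have "K i \<subseteq> snd (p j)" if "j \<in> I - {i}" for j
    proof -
      have "K i \<subseteq> (\<Union>k\<in>I-{j}. K k)" using that i by blast
      also have "\<dots> \<subseteq> snd (p j)" using p that by simp
      finally show ?thesis .
    qed
    then have "K i \<subseteq> G i" unfolding G_def using bspec[OF p i] by auto
    ultimately show "openin T (G i) \<and> K i \<subseteq> G i" by blast
  next
    fix i j assume ij: "i \<in> I" "j \<in> I" "i \<noteq> j"
    have "G i \<subseteq> fst (p i)" by (simp add: G_def)
    moreover have "G j \<subseteq> snd (p i)" using ij by (auto simp: G_def)
    moreover have "fst (p i) \<inter> snd (p i) = {}" using p ij by (simp add: disjnt_def)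
    ultimately show "G i \<inter> G j = {}" by blast
  qed
qed

locale sublinear_Higson =
  fixes X :: "'a::metric_space set" and x0 :: 'a and hX :: "'b topology" and e :: "'a \<Rightarrow> 'b"
  assumes proper: "proper_metric X"
    and Higson: "sublinear_Higson_compactification X x0 hX e"
begin

abbreviation bdry :: "'b set" where "bdry \<equiv> topspace hX - e ` X"

lemma compact_hX: "compact_space hX" and Hausdorff_hX: "Hausdorff_space hX"
  and embedding: "embedding_map (top_of_set X) hX e"
  and dense: "hX closure_of (e ` X) = topspace hX"
  using Higson by (auto simp: sublinear_Higson_compactification_def compactification_def)

lemma normal_hX: "normal_space hX"
  using compact_Hausdorff_or_regular_imp_normal_space compact_hX Hausdorff_hX by blast

lemma continuous_e: "continuous_map (top_of_set X) hX e"
  using embedding unfolding embedding_map_def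
  by (metis continuous_map_in_subtopology homeomorphic_imp_continuous_map)

lemma e_in: "x \<in> X \<Longrightarrow> e x \<in> topspace hX"
  using continuous_map_image_subset_topspace[OF continuous_e] by auto

lemma topspace_corona: "topspace (corona X hX e) = bdry"
  by (auto simp: corona_def)

lemma closedin_image_cball: "closedin hX (e ` (X \<inter> cball x0 R))"
proof -
  have "compact (X \<inter> cball x0 R)"
    using proper unfolding proper_metric_def
    by (meson bounded_Int bounded_cball closed_cball closedin_closed_Int)
  then have "compactin (top_of_set X) (X \<inter> cball x0 R)"
    by (simp add: compactin_subtopology)
  then have "compactin hX (e ` (X \<inter> cball x0 R))"
    using continuous_e image_compactin by blast
  then show ?thesis using Hausdorff_hX compactin_imp_closedin by blast
qed

text \<open>The embedding is open only onto its image, so the image of the ball is the trace of an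
  open set T. By density T lies in the closure of that trace, hence in the compact image of the
  closed ball, and so T is its own trace.\<close>

lemma openin_image_ball: "openin hX (e ` (X \<inter> ball x0 R))"
proof -
  have "open_map (top_of_set X) (subtopology hX (e ` X)) e"
    using embedding unfolding embedding_map_def by (simp add: homeomorphic_imp_open_map)
  moreover have "openin (top_of_set X) (X \<inter> ball x0 R)" by (simp add: openin_open_Int)
  ultimately have "openin (subtopology hX (e ` X)) (e ` (X \<inter> ball x0 R))"
    unfolding open_map_def by blast
  then obtain T where T: "openin hX T" "e ` (X \<inter> ball x0 R) = T \<inter> e ` X"
    unfolding openin_subtopology by blast
  have "T \<subseteq> hX closure_of (T \<inter> e ` X)"
    using openin_Int_closure_of_subset[OF T(1), of "e ` X"] dense openin_subset[OF T(1)] by auto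
  also have "\<dots> \<subseteq> e ` (X \<inter> cball x0 R)"
    by (rule closure_of_minimal[OF _ closedin_image_cball]) (unfold T(2)[symmetric], auto)
  finally have "T \<subseteq> e ` X" by auto
  then have "T \<inter> e ` X = T" by blast
  then show ?thesis using T by simp
qed

lemma image_eq_UN: "e ` X = (\<Union>k::nat. e ` (X \<inter> ball x0 (real k)))"
proof
  show "e ` X \<subseteq> (\<Union>k::nat. e ` (X \<inter> ball x0 (real k)))"
  proof clarify
    fix x assume x: "x \<in> X"
    obtain k :: nat where "dist x0 x < real k" using reals_Archimedean2 by blast
    then have "e x \<in> e ` (X \<inter> ball x0 (real k))" using x by simp
    then show "e x \<in> (\<Union>k::nat. e ` (X \<inter> ball x0 (real k)))" by blast
  qed
qed auto

lemma closedin_bdry: "closedin hX bdry"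
proof -
  have "openin hX (e ` X)"
    by (subst image_eq_UN) (use openin_image_ball in auto)
  then show ?thesis by blast
qed

text \<open>Translates facts about the corona into facts near infinity: a closed set that misses the
  corona is compact and is covered by finitely many images of balls.\<close>

lemma bounded_off_bdry:
  assumes S: "closedin hX S" "S \<inter> bdry = {}"
  shows "\<exists>R. \<forall>x\<in>X. e x \<in> S \<longrightarrow> dist x x0 < R"
proof -
  have "compactin hX S" using compact_hX S(1) closedin_compact_space by blast
  moreover have "S \<subseteq> e ` X" using S(2) closedin_subset[OF S(1)] by blast
  then have "S \<subseteq> \<Union>(range (\<lambda>k::nat. e ` (X \<inter> ball x0 (real k))))"
    by (subst (asm) image_eq_UN)
  moreover have "\<And>U. U \<in> range (\<lambda>k::nat. e ` (X \<inter> ball x0 (real k))) \<Longrightarrow> openin hX U"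
    using openin_image_ball by auto
  ultimately have "\<exists>\<F>. finite \<F> \<and> \<F> \<subseteq> range (\<lambda>k::nat. e ` (X \<inter> ball x0 (real k))) \<and> S \<subseteq> \<Union>\<F>"
    by (intro compactinD)
  then obtain \<F> where \<F>: "finite \<F>" "\<F> \<subseteq> range (\<lambda>k::nat. e ` (X \<inter> ball x0 (real k)))" "S \<subseteq> \<Union>\<F>"
    by (elim exE conjE)
  obtain D where D: "finite D" "\<F> = (\<lambda>k::nat. e ` (X \<inter> ball x0 (real k))) ` D"
    using finite_subset_image[OF \<F>(1,2)] by blast
  have inj: "inj_on e X"
    using embedding by (metis embedding_map_def homeomorphic_imp_injective_map topspace_euclidean_subtopology)
  have "dist x x0 < real (Max (insert 0 D))" if x: "x \<in> X" "e x \<in> S" for x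
  proof -
    obtain k where k: "k \<in> D" "e x \<in> e ` (X \<inter> ball x0 (real k))" using x \<F>(3) D(2) by auto
    then have "x \<in> ball x0 (real k)" using inj x(1) by (auto simp: inj_on_def)
    moreover have "k \<le> Max (insert 0 D)" using D(1) k(1) by simp
    ultimately show ?thesis by (simp add: dist_commute)
  qed
  then show ?thesis by blast
qed

lemma closure_image_ball_off_bdry:
  assumes "W \<subseteq> X \<inter> cball x0 R"
  shows "hX closure_of (e ` W) \<inter> bdry = {}"
proof -
  have "hX closure_of (e ` W) \<subseteq> e ` (X \<inter> cball x0 R)"
    by (rule closure_of_minimal[OF _ closedin_image_cball]) (use assms in auto)
  then show ?thesis by blast
qed

text \<open>Viewed as a complex function, the restriction of \<open>F\<close> to \<open>X\<close> is
  bounded by compactness and extends to \<open>hX\<close> by construction, so it is a Higson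
  function.\<close>

lemma continuous_map_slow:
  assumes F: "continuous_map hX euclideanreal F" and \<epsilon>: "\<epsilon> > 0"
  shows "\<exists>\<delta>>0. \<exists>R. \<forall>x\<in>X. \<forall>y\<in>X. dist x x0 \<ge> R \<and> dist x y \<le> \<delta> * dist x x0 \<longrightarrow> \<bar>F (e x) - F (e y)\<bar> < \<epsilon>"
proof -
  define f where "f = (\<lambda>x. complex_of_real (F (e x)))"
  have G: "continuous_map hX euclidean (\<lambda>p. complex_of_real (F p))"
    using continuous_map_compose[OF F, of euclidean complex_of_real]
    by (simp add: o_def continuous_on_of_real_id)
  have "compactin euclidean ((\<lambda>p. complex_of_real (F p)) ` topspace hX)"
    using image_compactin[OF _ G] compact_hX by (simp add: compact_space_def)
  then have "bounded ((\<lambda>p. complex_of_real (F p)) ` topspace hX)" by (simp add: compact_imp_bounded)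
  moreover have "f ` X \<subseteq> (\<lambda>p. complex_of_real (F p)) ` topspace hX"
    using e_in by (auto simp: f_def)
  ultimately have "bounded (f ` X)" using bounded_subset by blast
  moreover have "continuous_on X f"
    using continuous_map_compose[OF continuous_e G] by (simp add: f_def o_def)
  ultimately have bc: "bounded_continuous X f" by (simp add: bounded_continuous_def)
  moreover have "extends_continuously X hX e f"
    unfolding extends_continuously_def f_def using G by blast
  ultimately have "f \<in> Higson_functions X (sublinear_structure X x0)"
    using Higson unfolding sublinear_Higson_compactification_def by blast
  from Higson_functions_slow[OF this \<epsilon>] show ?thesis
    unfolding f_def of_real_diff[symmetric] norm_of_real .
qed

lemma finite_continuous_map_slow:
  assumes "finite \<F>" and "\<forall>U\<in>\<F>. continuous_map hX euclideanreal (F U)" and \<epsilon>: "\<epsilon> > 0"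
  shows "\<exists>\<delta>>0. \<exists>R. \<forall>U\<in>\<F>. \<forall>x\<in>X. \<forall>y\<in>X. dist x x0 \<ge> R \<and> dist x y \<le> \<delta> * dist x x0 \<longrightarrow>
           \<bar>F U (e x) - F U (e y)\<bar> < \<epsilon>"
  using assms(1,2)
proof (induction rule: finite_induct)
  case empty
  show ?case by (auto intro: exI[of _ 1])
next
  case (insert U \<F>)
  obtain \<delta>1 R1 where 1: "\<delta>1 > 0" "\<And>x y. x \<in> X \<Longrightarrow> y \<in> X \<Longrightarrow> dist x x0 \<ge> R1 \<Longrightarrow>
     dist x y \<le> \<delta>1 * dist x x0 \<Longrightarrow> \<bar>F U (e x) - F U (e y)\<bar> < \<epsilon>"
    using continuous_map_slow[OF bspec[OF insert(4) insertI1] \<epsilon>] by blast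
  have "\<exists>\<delta>>0. \<exists>R. \<forall>U\<in>\<F>. \<forall>x\<in>X. \<forall>y\<in>X. dist x x0 \<ge> R \<and> dist x y \<le> \<delta> * dist x x0 \<longrightarrow>
           \<bar>F U (e x) - F U (e y)\<bar> < \<epsilon>"
    using insert.prems by (intro insert.IH) simp
  then obtain \<delta>2 R2 where 2: "\<delta>2 > 0" "\<And>V x y. V \<in> \<F> \<Longrightarrow> x \<in> X \<Longrightarrow> y \<in> X \<Longrightarrow> dist x x0 \<ge> R2 \<Longrightarrow>
     dist x y \<le> \<delta>2 * dist x x0 \<Longrightarrow> \<bar>F V (e x) - F V (e y)\<bar> < \<epsilon>"
    by blast
  show ?case
  proof (rule exI[of _ "min \<delta>1 \<delta>2"], intro conjI exI[of _ "max R1 R2"] ballI impI)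
    show "min \<delta>1 \<delta>2 > 0" using 1 2 by simp
    fix V x y assume V: "V \<in> insert U \<F>" and xy: "x \<in> X" "y \<in> X"
      and d: "max R1 R2 \<le> dist x x0 \<and> dist x y \<le> min \<delta>1 \<delta>2 * dist x x0"
    have "min \<delta>1 \<delta>2 * dist x x0 \<le> \<delta>1 * dist x x0" "min \<delta>1 \<delta>2 * dist x x0 \<le> \<delta>2 * dist x x0"
      by (auto intro: mult_right_mono)
    then have "dist x y \<le> \<delta>1 * dist x x0" "dist x y \<le> \<delta>2 * dist x x0" using d by linarith+
    then show "\<bar>F V (e x) - F V (e y)\<bar> < \<epsilon>"
      using V 1(2)[OF xy] 2(2)[OF _ xy] d by auto
  qed
qed

text \<open>The continuous extension of the divergence function of \<open>W1\<close> is 0 on the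
  closure of \<open>W1\<close> and 1 on the closure of \<open>W2\<close> minus the unit ball; the
  remaining part of \<open>W2\<close> does not reach the corona.\<close>

lemma closures_disjoint:
  assumes W: "W1 \<subseteq> X" "W2 \<subseteq> X" and \<delta>: "\<delta> > 0"
    and far: "\<And>x y. x \<in> W1 \<Longrightarrow> y \<in> W2 \<Longrightarrow> dist x y \<ge> \<delta> * dist x x0"
  shows "hX closure_of (e ` W1) \<inter> hX closure_of (e ` W2) \<inter> bdry = {}"
proof (cases "W1 = {}")
  case False
  \<comment> \<open>The hypothesis compares the distance with the norm of the point in
    \<open>W1\<close>. In terms of the norm of y it reads dist \<ge> \<delta> / (1 + \<delta>) |y| =
    2 \<kappa> |y|, which is at least \<kappa> (|y| + 1) once |y| \<ge> 1.\<close>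
  define \<kappa> where "\<kappa> = \<delta> / (1 + \<delta>) / 2"
  have \<kappa>: "\<kappa> > 0" using \<delta> by (simp add: \<kappa>_def)
  define f where "f = (\<lambda>x. complex_of_real (min 1 (infdist x W1 / (\<kappa> * (dist x x0 + 1)))))"
  have "f \<in> Higson_functions X (sublinear_structure X x0)"
    unfolding f_def by (rule divergence_function_Higson[OF proper \<kappa> False])
  moreover from this have "bounded_continuous X f" by (simp add: Higson_functions_def)
  ultimately have "extends_continuously X hX e f"
    using Higson unfolding sublinear_Higson_compactification_def by blast
  then obtain F where F: "continuous_map hX euclidean F" "\<And>x. x \<in> X \<Longrightarrow> F (e x) = f x"
    unfolding extends_continuously_def by blast
  have cl: "hX closure_of (e ` W) \<subseteq> {p \<in> topspace hX. F p = c}"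
    if "W \<subseteq> X" "\<And>x. x \<in> W \<Longrightarrow> f x = c" for W c
  proof (rule closure_of_minimal)
    show "e ` W \<subseteq> {p \<in> topspace hX. F p = c}" using that F(2) e_in by auto
    have "closedin hX {p \<in> topspace hX. F p \<in> {c}}"
      by (rule closedin_continuous_map_preimage[OF F(1)]) simp
    then show "closedin hX {p \<in> topspace hX. F p = c}" by simp
  qed
  have f0: "f x = 0" if "x \<in> W1" for x using that by (simp add: f_def)
  have f1: "f y = 1" if y: "y \<in> W2" "y \<notin> ball x0 1" for y
  proof -
    have d: "dist y x0 \<ge> 1" using y(2) by (simp add: dist_commute)
    have "2 * \<kappa> * dist y x0 \<le> dist y x" if x: "x \<in> W1" for x
    proof -
      have "\<delta> * (dist y x0 - dist x y) \<le> \<delta> * dist x x0"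
        using \<delta> dist_triangle[of y x0 x] by (intro mult_left_mono) (auto simp: dist_commute)
      then have "\<delta> * dist y x0 \<le> (1 + \<delta>) * dist x y" using far[OF x y(1)] by (simp add: algebra_simps)
      then show ?thesis using \<delta> by (simp add: \<kappa>_def field_simps dist_commute)
    qed
    then have "2 * \<kappa> * dist y x0 \<le> infdist y W1"
      using False by (subst infdist_notempty) (auto intro!: cINF_greatest)
    moreover have "\<kappa> * (dist y x0 + 1) \<le> \<kappa> * (2 * dist y x0)" using d \<kappa> by (intro mult_left_mono) auto
    ultimately have "\<kappa> * (dist y x0 + 1) \<le> infdist y W1" by simp
    then have "infdist y W1 / (\<kappa> * (dist y x0 + 1)) \<ge> 1"
      using \<kappa> d by (subst le_divide_eq_1_pos) auto
    then show ?thesis by (simp add: f_def)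
  qed
  have "e ` W2 = e ` (W2 \<inter> ball x0 1) \<union> e ` (W2 - ball x0 1)" by auto
  then have "hX closure_of (e ` W2) = hX closure_of (e ` (W2 \<inter> ball x0 1)) \<union> hX closure_of (e ` (W2 - ball x0 1))"
    by (metis closure_of_Un)
  moreover have "hX closure_of (e ` (W2 \<inter> ball x0 1)) \<inter> bdry = {}"
    by (rule closure_image_ball_off_bdry[of _ 1]) (use W in auto)
  moreover have "hX closure_of (e ` (W2 - ball x0 1)) \<subseteq> {p \<in> topspace hX. F p = 1}"
    by (rule cl) (use W f1 in auto)
  moreover have "hX closure_of (e ` W1) \<subseteq> {p \<in> topspace hX. F p = 0}"
    by (rule cl) (use W f0 in auto)
  moreover have "{p \<in> topspace hX. F p = 0} \<inter> {p \<in> topspace hX. F p = 1} = {}" by auto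
  ultimately show ?thesis by blast
qed simp

section \<open>Covers of the corona and colourings near infinity\<close>

lemma closedin_bdry_Diff:
  assumes "openin (corona X hX e) U"
  shows "closedin hX (bdry - U)"
proof -
  have "closedin (subtopology hX bdry) (bdry - U)"
    using assms closedin_def unfolding corona_def
    by (metis closedin_topspace openin_closedin_eq topspace_corona corona_def closedin_diff)
  then show ?thesis using closedin_bdry closedin_trans_full by blast
qed

text \<open>A substitute for a partition of unity that lives on all of \<open>hX\<close>. Urysohn
  functions at finitely many points of the corona exceed 1/2 somewhere near every point of it, and
  those belonging to the same \<open>U\<close> are added. Where none exceeds 1/2 is closed and
  misses the corona, hence is bounded.\<close>

lemma cover_functions:
  assumes fin: "finite \<U>" and op: "\<forall>U\<in>\<U>. openin (corona X hX e) U" and cov: "\<Union>\<U> = bdry"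
  shows "\<exists>F R. (\<forall>U\<in>\<U>. continuous_map hX euclideanreal (F U) \<and> (\<forall>p\<in>bdry - U. F U p = 0)) \<and>
           (\<forall>x\<in>X. dist x x0 \<ge> R \<longrightarrow> (\<exists>U\<in>\<U>. F U (e x) \<ge> 1 / 2))"
proof -
  have "\<forall>p\<in>bdry. \<exists>q. fst q \<in> \<U> \<and> continuous_map hX (top_of_set {0..1}) (snd q) \<and>
     (\<forall>r\<in>bdry - fst q. snd q r = (0::real)) \<and> snd q p = 1"
  proof
    fix p assume p: "p \<in> bdry"
    then obtain U where U: "U \<in> \<U>" "p \<in> U" using cov by blast
    have "closedin hX {p}" using Hausdorff_hX p by (simp add: closedin_Hausdorff_singleton)
    moreover have "disjnt (bdry - U) {p}" using U(2) by (simp add: disjnt_def)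
    ultimately obtain f where "continuous_map hX (top_of_set {0..1::real}) f"
      "f ` (bdry - U) \<subseteq> {0}" "f ` {p} \<subseteq> {1}"
      by (rule Urysohn_lemma[OF normal_hX closedin_bdry_Diff[OF bspec[OF op U(1)]], of "{p}" 0 1]) simp
    then show "\<exists>q. fst q \<in> \<U> \<and> continuous_map hX (top_of_set {0..1}) (snd q) \<and>
       (\<forall>r\<in>bdry - fst q. snd q r = (0::real)) \<and> snd q p = 1"
      using U by (intro exI[of _ "(U, f)"]) auto
  qed
  from bchoice[OF this] obtain q where q: "\<forall>p\<in>bdry. fst (q p) \<in> \<U> \<and>
     continuous_map hX (top_of_set {0..1}) (snd (q p)) \<and>
     (\<forall>r\<in>bdry - fst (q p). snd (q p) r = (0::real)) \<and> snd (q p) p = 1" ..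
  define u where "u = (\<lambda>p. fst (q p))"
  define g where "g = (\<lambda>p. snd (q p))"
  have u: "u p \<in> \<U>" and gc: "continuous_map hX (top_of_set {0..1}) (g p)"
    and g0: "\<And>r. r \<in> bdry - u p \<Longrightarrow> g p r = 0" and g1: "g p p = 1" if "p \<in> bdry" for p
    using q that by (auto simp: u_def g_def)
  have gcr: "continuous_map hX euclideanreal (g p)" and gpos: "\<And>r. r \<in> topspace hX \<Longrightarrow> g p r \<ge> 0"
    if "p \<in> bdry" for p
    using gc[OF that] by (auto simp: continuous_map_in_subtopology)
  define N where "N = (\<lambda>p. {r \<in> topspace hX. g p r \<in> {1/2<..}})"
  have Nop: "openin hX (N p)" if "p \<in> bdry" for p
    unfolding N_def by (rule openin_continuous_map_preimage[OF gcr[OF that]]) auto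
  have "compactin hX bdry" using compact_hX closedin_bdry closedin_compact_space by blast
  moreover have "bdry \<subseteq> \<Union>(N ` bdry)"
  proof
    fix p assume p: "p \<in> bdry"
    then have "p \<in> N p" using g1[OF p] by (auto simp: N_def)
    then show "p \<in> \<Union>(N ` bdry)" using p by blast
  qed
  ultimately obtain \<F> where \<F>: "finite \<F>" "\<F> \<subseteq> N ` bdry" "bdry \<subseteq> \<Union>\<F>"
    using compactinD[of hX bdry "N ` bdry"] Nop by blast
  obtain D where D: "finite D" "D \<subseteq> bdry" "\<F> = N ` D"
    using finite_subset_image[OF \<F>(1,2)] by blast
  define F where "F = (\<lambda>U r. \<Sum>p\<in>{p\<in>D. u p = U}. g p r)"
  define S where "S = topspace hX - \<Union>(N ` D)"
  have "closedin hX S" unfolding S_def using Nop D by (intro closedin_diff) auto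
  moreover have "S \<inter> bdry = {}" using \<F> D by (auto simp: S_def)
  ultimately have "\<exists>R. \<forall>x\<in>X. e x \<in> S \<longrightarrow> dist x x0 < R" by (rule bounded_off_bdry)
  then obtain R where R: "\<And>x. x \<in> X \<Longrightarrow> e x \<in> S \<Longrightarrow> dist x x0 < R" by blast
  show ?thesis
  proof (intro exI[of _ F] exI[of _ R] conjI ballI impI)
    fix U assume "U \<in> \<U>"
    show "continuous_map hX euclideanreal (F U)"
      unfolding F_def by (intro continuous_map_sum) (use D gcr in auto)
    show "F U p = 0" if "p \<in> bdry - U" for p
      unfolding F_def by (intro sum.neutral ballI) (use that g0 D in auto)
  next
    fix x assume x: "x \<in> X" "dist x x0 \<ge> R"
    then have "e x \<notin> S" using R by force
    then obtain p where p: "p \<in> D" "e x \<in> N p" using e_in[OF x(1)] by (auto simp: S_def)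
    have "g p (e x) \<le> F (u p) (e x)"
      unfolding F_def
      by (rule member_le_sum) (use p D gpos e_in[OF x(1)] in auto)
    moreover have "g p (e x) > 1/2" using p by (simp add: N_def)
    ultimately show "\<exists>U\<in>\<U>. F U (e x) \<ge> 1 / 2" using u[of p] p D by (intro bexI[of _ "u p"]) auto
  qed
qed

text \<open>Chain classes are so small that each fits one member \<open>U\<close> of the cover. For
  a fixed colour, the unions of the classes assigned to different \<open>U\<close> diverge linearly,
  so their closures are disjoint on the corona; normality thickens them to disjoint open sets, one
  disjoint family per colour.\<close>

lemma small_colourable_imp_covering_dim_le:
  assumes W: "small_colourable n at_top (\<lambda>R. X - ball x0 R) (\<lambda>R x. dist x x0)"
  shows "covering_dim_le (corona X hX e) n"
  unfolding covering_dim_le_def topspace_corona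
proof (intro allI impI)
  fix \<U> assume "finite \<U> \<and> (\<forall>U\<in>\<U>. openin (corona X hX e) U) \<and> \<Union>\<U> = bdry"
  then have fin: "finite \<U>" and op: "\<forall>U\<in>\<U>. openin (corona X hX e) U" and cov: "\<Union>\<U> = bdry"
    by auto
  obtain F R1 where F: "\<forall>U\<in>\<U>. continuous_map hX euclideanreal (F U) \<and> (\<forall>p\<in>bdry - U. F U p = 0)"
    "\<forall>x\<in>X. dist x x0 \<ge> R1 \<longrightarrow> (\<exists>U\<in>\<U>. F U (e x) \<ge> 1 / 2)"
    using cover_functions[OF fin op cov] by (elim exE conjE)
  have Fc: "\<forall>U\<in>\<U>. continuous_map hX euclideanreal (F U)" using F(1) by simp
  have F0: "F U p = 0" if "U \<in> \<U>" "p \<in> bdry - U" for U p using F(1) that by simp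
  have F1: "\<exists>U\<in>\<U>. F U (e x) \<ge> 1 / 2" if "x \<in> X" "dist x x0 \<ge> R1" for x using F(2) that by simp
  have "(1/4::real) > 0" by simp
  from finite_continuous_map_slow[OF fin Fc this]
  obtain \<delta> R2 where \<delta>: "\<delta> > 0" and slow: "\<And>U x y. U \<in> \<U> \<Longrightarrow> x \<in> X \<Longrightarrow> y \<in> X \<Longrightarrow> dist x x0 \<ge> R2 \<Longrightarrow>
     dist x y \<le> \<delta> * dist x x0 \<Longrightarrow> \<bar>F U (e x) - F U (e y)\<bar> < 1/4"
    by blast
  obtain \<delta>' where \<delta>': "\<delta>' > 0" and ev: "\<forall>\<^sub>F R in at_top. \<exists>c::'a \<Rightarrow> nat. (\<forall>x\<in>X - ball x0 R. c x \<le> n) \<and>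
     controlled (X - ball x0 R) c (\<lambda>x. \<delta>' * dist x x0) (\<lambda>x. \<delta> * dist x x0)"
    by (rule small_colourableE[OF W \<delta>])
  obtain R where R: "R \<ge> R1" "R \<ge> R2" and "\<exists>c::'a \<Rightarrow> nat. (\<forall>x\<in>X - ball x0 R. c x \<le> n) \<and>
     controlled (X - ball x0 R) c (\<lambda>x. \<delta>' * dist x x0) (\<lambda>x. \<delta> * dist x x0)"
    using eventually_happens'[OF trivial_limit_at_top_linorder
        eventually_conj[OF ev eventually_ge_at_top[of "max R1 R2"]]] by auto
  then obtain c :: "'a \<Rightarrow> nat" where c: "\<And>x. x \<in> X - ball x0 R \<Longrightarrow> c x \<le> n"
     "controlled (X - ball x0 R) c (\<lambda>x. \<delta>' * dist x x0) (\<lambda>x. \<delta> * dist x x0)" by blast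
  define A where "A = X - ball x0 R"
  define rl where "rl = chain_rel A c (\<lambda>x. \<delta>' * dist x x0)"
  have AX: "x \<in> X" "dist x x0 \<ge> R1" "dist x x0 \<ge> R2" if "x \<in> A" for x
    using that R by (auto simp: A_def dist_commute)
  have rep: "chain_rep rl x \<in> A" "dist (chain_rep rl x) x \<le> \<delta> * dist (chain_rep rl x) x0" if "x \<in> A" for x
  proof -
    have r: "(x, chain_rep rl x) \<in> rl\<^sup>*" by (rule chain_rep_related)
    show A: "chain_rep rl x \<in> A" using chain_rel_rtrancl_in(1) r that unfolding rl_def by blast
    have "(chain_rep rl x, x) \<in> rl\<^sup>*" using r chain_rel_rtrancl_sym unfolding rl_def by blast
    then show "dist (chain_rep rl x) x \<le> \<delta> * dist (chain_rep rl x) x0"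
      using controlledD[OF c(2)[folded A_def] A] unfolding rl_def by blast
  qed
  \<comment> \<open>Chosen at the representative, where \<open>F U\<close> is at least 1/2;
    oscillation below 1/4 leaves at least 1/4 on the whole class.\<close>
  define u where "u = (\<lambda>x. SOME U. U \<in> \<U> \<and> F U (e (chain_rep rl x)) \<ge> 1 / 2)"
  have u: "u x \<in> \<U>" "F (u x) (e x) \<ge> 1 / 4" if x: "x \<in> A" for x
  proof -
    note r = rep[OF x]
    have "\<exists>U. U \<in> \<U> \<and> F U (e (chain_rep rl x)) \<ge> 1 / 2" using F1 AX[OF r(1)] by blast
    then have ux: "u x \<in> \<U> \<and> F (u x) (e (chain_rep rl x)) \<ge> 1 / 2" unfolding u_def by (rule someI_ex)
    then show "u x \<in> \<U>" by blast
    have "\<bar>F (u x) (e (chain_rep rl x)) - F (u x) (e x)\<bar> < 1 / 4"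
      using slow ux AX[OF r(1)] AX[OF x] r(2) by blast
    then show "F (u x) (e x) \<ge> 1 / 4" using ux by linarith
  qed
  define B where "B = (\<lambda>(i, U). {x\<in>A. c x = i \<and> u x = U})"
  define K where "K = (\<lambda>q. hX closure_of (e ` B q) \<inter> bdry)"
  define J where "J = {..n} \<times> \<U>"
  have BA: "B q \<subseteq> A" for q by (auto simp: B_def split: prod.splits)
  have BX: "B q \<subseteq> X" for q using BA AX by blast
  have Kc: "closedin hX (K q)" for q
    unfolding K_def by (intro closedin_Int closedin_closure_of closedin_bdry)
  have Kdisj: "K (i, U) \<inter> K (i, V) = {}" if "U \<noteq> V" for i U V
  proof -
    \<comment> \<open>Points of one colour in different classes are more than \<delta>' times one of
      the two norms apart. Expressing this by the norm of \<open>x\<close> alone costs the factor 1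
      + \<delta>'.\<close>
    have pos: "\<delta>' / (1 + \<delta>') > 0" using \<delta>' by simp
    have "hX closure_of (e ` B (i, U)) \<inter> hX closure_of (e ` B (i, V)) \<inter> bdry = {}"
    proof (rule closures_disjoint[OF BX BX pos])
      fix x y assume xy: "x \<in> B (i, U)" "y \<in> B (i, V)"
      have A: "x \<in> A" "y \<in> A" "c x = c y" "u x \<noteq> u y" using xy that by (auto simp: B_def)
      have "(x, y) \<notin> rl"
      proof
        assume "(x, y) \<in> rl"
        then have "chain_rep rl x = chain_rep rl y"
          by (intro chain_rep_eq) (auto simp: rl_def sym_chain_rel)
        then show False using A(4) by (simp add: u_def)
      qed
      then consider "dist x y > \<delta>' * dist x x0" | "dist x y > \<delta>' * dist y x0"
        using A unfolding rl_def chain_rel_def by force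
      then have "\<delta>' * dist x x0 \<le> (1 + \<delta>') * dist x y"
      proof cases
        case 1
        moreover have "0 \<le> \<delta>' * dist x y" using \<delta>' by simp
        ultimately show ?thesis by (simp add: distrib_right)
      next
        case 2
        have "\<delta>' * dist x x0 \<le> \<delta>' * (dist x y + dist y x0)"
          using \<delta>' dist_triangle[of x x0 y] by (intro mult_left_mono) auto
        then show ?thesis using 2 by (simp add: algebra_simps)
      qed
      then show "\<delta>' / (1 + \<delta>') * dist x x0 \<le> dist x y" using \<delta>' by (simp add: field_simps)
    qed
    then show ?thesis unfolding K_def by blast
  qed
  have KU: "K (i, U) \<subseteq> U" if "U \<in> \<U>" for i U
  proof
    fix p assume p: "p \<in> K (i, U)"
    have "hX closure_of (e ` B (i, U)) \<subseteq> {p \<in> topspace hX. F U p \<in> {1/4..}}"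
    proof (rule closure_of_minimal)
      show "closedin hX {p \<in> topspace hX. F U p \<in> {1/4..}}"
        by (rule closedin_continuous_map_preimage[OF bspec[OF Fc that]]) simp
      show "e ` B (i, U) \<subseteq> {p \<in> topspace hX. F U p \<in> {1/4..}}"
        using u AX e_in by (auto simp: B_def)
    qed
    then have "F U p \<ge> 1/4" using p by (auto simp: K_def)
    then show "p \<in> U" using F0[OF that, of p] p by (force simp: K_def)
  qed
  have Kcov: "bdry \<subseteq> (\<Union>q\<in>J. K q)"
  proof
    fix p assume p: "p \<in> bdry"
    have "X \<subseteq> (X \<inter> cball x0 R) \<union> A" by (auto simp: A_def)
    also have "A \<subseteq> (\<Union>q\<in>J. B q)"
      using c(1)[folded A_def] u(1) by (auto simp: J_def B_def)
    finally have "e ` X \<subseteq> e ` (X \<inter> cball x0 R) \<union> \<Union>((\<lambda>q. e ` B q) ` J)" by blast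
    then have "hX closure_of (e ` X) \<subseteq> hX closure_of (e ` (X \<inter> cball x0 R) \<union> \<Union>((\<lambda>q. e ` B q) ` J))"
      by (rule closure_of_mono)
    moreover have "finite ((\<lambda>q. e ` B q) ` J)" using fin by (simp add: J_def)
    ultimately have "p \<in> hX closure_of (e ` (X \<inter> cball x0 R)) \<or> (\<exists>q\<in>J. p \<in> hX closure_of (e ` B q))"
      using dense p by (auto simp: closure_of_Union)
    moreover have "p \<notin> hX closure_of (e ` (X \<inter> cball x0 R))"
      using closure_image_ball_off_bdry[OF order_refl, of R] p by blast
    ultimately show "p \<in> (\<Union>q\<in>J. K q)" using p by (auto simp: K_def)
  qed
  have "\<forall>i. \<exists>G. (\<forall>U\<in>\<U>. openin hX (G U) \<and> K (i, U) \<subseteq> G U) \<and>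
      (\<forall>U\<in>\<U>. \<forall>V\<in>\<U>. U \<noteq> V \<longrightarrow> G U \<inter> G V = {})"
  proof
    fix i
    show "\<exists>G. (\<forall>U\<in>\<U>. openin hX (G U) \<and> K (i, U) \<subseteq> G U) \<and>
      (\<forall>U\<in>\<U>. \<forall>V\<in>\<U>. U \<noteq> V \<longrightarrow> G U \<inter> G V = {})"
      by (rule normal_space_disjoint_expansion[OF normal_hX fin Kc, of "\<lambda>U. (i, U)"])
         (use Kdisj in blast)+
  qed
  from choice[OF this] obtain G where G: "\<forall>i. (\<forall>U\<in>\<U>. openin hX (G i U) \<and> K (i, U) \<subseteq> G i U) \<and>
      (\<forall>U\<in>\<U>. \<forall>V\<in>\<U>. U \<noteq> V \<longrightarrow> G i U \<inter> G i V = {})" ..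
  define V where "V = (\<lambda>(i, U). G i U \<inter> U)"
  have UB: "U \<subseteq> bdry" if "U \<in> \<U>" for U using cov that by blast
  show "\<exists>\<V>. finite \<V> \<and> (\<forall>V\<in>\<V>. openin (corona X hX e) V) \<and> \<Union>\<V> = bdry \<and>
     (\<forall>V\<in>\<V>. \<exists>U\<in>\<U>. V \<subseteq> U) \<and> multiplicity_le \<V> (n + 1)"
  proof (intro exI[of _ "V ` J"] conjI ballI)
    show "finite (V ` J)" using fin by (simp add: J_def)
    show "openin (corona X hX e) W" if W: "W \<in> V ` J" for W
    proof -
      obtain i U where iU: "U \<in> \<U>" "W = G i U \<inter> U" using W by (auto simp: V_def J_def)
      have "openin (corona X hX e) (bdry \<inter> G i U)"
        unfolding corona_def using G iU by (intro openin_subtopology_Int2) auto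
      then have "openin (corona X hX e) ((bdry \<inter> G i U) \<inter> U)" using bspec[OF op iU(1)] by (rule openin_Int)
      moreover have "(bdry \<inter> G i U) \<inter> U = W" using iU UB by blast
      ultimately show ?thesis by simp
    qed
    show "\<Union>(V ` J) = bdry"
    proof
      show "\<Union>(V ` J) \<subseteq> bdry" using UB by (auto simp: V_def J_def)
      have "K q \<subseteq> V q" if "q \<in> J" for q
      proof -
        obtain i U where q: "q = (i, U)" "U \<in> \<U>" using \<open>q \<in> J\<close> by (auto simp: J_def)
        have "K (i, U) \<subseteq> G i U" using G q(2) by simp
        then show ?thesis using KU[OF q(2), of i] by (simp add: V_def q(1))
      qed
      then show "bdry \<subseteq> \<Union>(V ` J)" using Kcov by blast
    qed
    show "\<exists>U\<in>\<U>. W \<subseteq> U" if "W \<in> V ` J" for W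
      using that by (auto simp: V_def J_def)
    show "multiplicity_le (V ` J) (n + 1)"
    proof (rule multiplicity_le_colour[of J fst])
      show "fst q \<le> n" if "q \<in> J" for q using that by (auto simp: J_def)
      fix q q' assume q: "q \<in> J" "q' \<in> J" "fst q = fst q'" "V q \<noteq> V q'"
      obtain i U U' where iU: "q = (i, U)" "q' = (i, U')" "U \<in> \<U>" "U' \<in> \<U>" "U \<noteq> U'"
        using q by (cases q, cases q') (auto simp: J_def)
      then have "G i U \<inter> G i U' = {}" using G by simp
      then show "V q \<inter> V q' = {}" unfolding V_def iU(1,2) by auto
    qed
  qed
qed

text \<open>The colour classes of an \<open>m\<close>-colouring at linearly growing scale induce an open cover of the
  corona. A refinement of multiplicity \<open>n + 1\<close>, pulled back to \<open>X\<close>, yields a colouring with \<open>n + 1\<close>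
  colours each chain of which stays close to a single class of the \<open>m\<close>-colouring.\<close>

lemma covering_dim_le_imp_small_colourable:
  assumes dim: "covering_dim_le (corona X hX e) n"
    and W: "small_colourable m at_top (\<lambda>R. X - ball x0 R) (\<lambda>R x. dist x x0)"
  shows "small_colourable n at_top (\<lambda>R. X - ball x0 R) (\<lambda>R x. dist x x0)"
  unfolding small_colourable_def
proof (intro allI impI)
  fix \<epsilon> :: real assume \<epsilon>: "\<epsilon> > 0"
  have "\<epsilon> / 8 > 0" using \<epsilon> by simp
  then obtain \<delta> where \<delta>: "\<delta> > 0" and ev: "\<forall>\<^sub>F R in at_top. \<exists>c::'a \<Rightarrow> nat. (\<forall>x\<in>X - ball x0 R. c x \<le> m) \<and>
     controlled (X - ball x0 R) c (\<lambda>x. \<delta> * dist x x0) (\<lambda>x. \<epsilon> / 8 * dist x x0)"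
    by (rule small_colourableE[OF W])
  then obtain R0 where "\<exists>c::'a \<Rightarrow> nat. (\<forall>x\<in>X - ball x0 R0. c x \<le> m) \<and>
     controlled (X - ball x0 R0) c (\<lambda>x. \<delta> * dist x x0) (\<lambda>x. \<epsilon> / 8 * dist x x0)"
    unfolding eventually_at_top_linorder by blast
  then obtain a :: "'a \<Rightarrow> nat" where a: "\<forall>x\<in>X - ball x0 R0. a x \<le> m"
     "controlled (X - ball x0 R0) a (\<lambda>x. \<delta> * dist x x0) (\<lambda>x. \<epsilon> / 8 * dist x x0)" by blast
  define A where "A = X - ball x0 R0"
  \<comment> \<open>\<beta> \<le> 1/2 keeps the norms of a point and of a nearby point of
    \<open>Q i\<close> within a factor 2. \<beta> \<le> \<delta>/16, with \<gamma> \<le> \<delta>/8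
    later, gives 3 \<beta> + \<gamma> \<le> \<delta>/2, so nearby points of a \<gamma>-chain form a
    \<delta>-chain; \<beta> \<le> \<epsilon>/8 pays for the end points.\<close>
  define \<beta> where "\<beta> = min (1 / 2) (min (\<delta> / 16) (\<epsilon> / 8))"
  have \<beta>: "\<beta> > 0" "\<beta> \<le> 1 / 2" "\<beta> \<le> \<delta> / 16" "\<beta> \<le> \<epsilon> / 8" using \<delta> \<epsilon> by (auto simp: \<beta>_def)
  define Q where "Q = (\<lambda>i. {x\<in>A. a x = i})"
  define N where "N = (\<lambda>i. {x\<in>X. \<exists>y\<in>Q i. dist x y \<le> \<beta> * dist x x0})"
  \<comment> \<open>The points of the corona that cannot be approached from outside
    \<open>N i\<close>. It contains the limit points of \<open>Q i\<close>, from which the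
    complement of \<open>N i\<close> diverges linearly.\<close>
  define O' where "O' = (\<lambda>i. bdry - hX closure_of (e ` (X - N i)))"
  have QX: "Q i \<subseteq> X" for i by (auto simp: Q_def A_def)
  have cov: "bdry \<subseteq> \<Union>(O' ` {..m})"
  proof
    fix p assume p: "p \<in> bdry"
    have "X \<subseteq> (X \<inter> cball x0 R0) \<union> A" by (auto simp: A_def)
    also have "A \<subseteq> (\<Union>i\<in>{..m}. Q i)" using a(1) by (auto simp: Q_def A_def)
    finally have "X \<subseteq> (X \<inter> cball x0 R0) \<union> (\<Union>i\<in>{..m}. Q i)" by blast
    then have "e ` X \<subseteq> e ` (X \<inter> cball x0 R0) \<union> \<Union>((\<lambda>i. e ` Q i) ` {..m})"
      by blast
    then have "hX closure_of (e ` X) \<subseteq> hX closure_of (e ` (X \<inter> cball x0 R0) \<union> \<Union>((\<lambda>i. e ` Q i) ` {..m}))"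
      by (rule closure_of_mono)
    then have "p \<in> hX closure_of (e ` (X \<inter> cball x0 R0)) \<or> (\<exists>i\<in>{..m}. p \<in> hX closure_of (e ` Q i))"
      using dense p by (auto simp: closure_of_Union)
    moreover have "p \<notin> hX closure_of (e ` (X \<inter> cball x0 R0))"
      using closure_image_ball_off_bdry[OF order_refl, of R0] p by blast
    ultimately obtain i where i: "i \<le> m" "p \<in> hX closure_of (e ` Q i)" by auto
    have "hX closure_of (e ` (X - N i)) \<inter> hX closure_of (e ` Q i) \<inter> bdry = {}"
      by (rule closures_disjoint[OF _ QX \<beta>(1)]) (auto simp: N_def)
    then have "p \<in> O' i" using i p by (auto simp: O'_def)
    then show "p \<in> \<Union>(O' ` {..m})" using i by auto
  qed
  have opO: "openin (corona X hX e) (O' i)" for i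
  proof -
    have "openin (subtopology hX bdry) (bdry \<inter> (topspace hX - hX closure_of (e ` (X - N i))))"
      by (intro openin_subtopology_Int2 openin_diff) auto
    moreover have "bdry \<inter> (topspace hX - hX closure_of (e ` (X - N i))) = O' i"
      by (auto simp: O'_def)
    ultimately show ?thesis by (simp add: corona_def)
  qed
  have "finite (O' ` {..m}) \<and> (\<forall>U\<in>O' ` {..m}. openin (corona X hX e) U) \<and>
     \<Union>(O' ` {..m}) = topspace (corona X hX e)"
    using opO cov unfolding topspace_corona by (auto simp: O'_def)
  then obtain \<V> where fin: "finite \<V>" and op: "\<forall>V\<in>\<V>. openin (corona X hX e) V" and covV: "\<Union>\<V> = bdry"
    and refine: "\<forall>V\<in>\<V>. \<exists>U\<in>O' ` {..m}. V \<subseteq> U" and mult: "multiplicity_le \<V> (n + 1)"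
    using dim[unfolded covering_dim_le_def, rule_format, of "O' ` {..m}"]
    unfolding topspace_corona by auto
  have "\<forall>V\<in>\<V>. \<exists>i. V \<subseteq> O' i" using refine by auto
  from bchoice[OF this] obtain I where I: "\<forall>V\<in>\<V>. V \<subseteq> O' (I V)" ..
  obtain F R1 where F: "\<forall>U\<in>\<V>. continuous_map hX euclideanreal (F U) \<and> (\<forall>p\<in>bdry - U. F U p = 0)"
    "\<forall>x\<in>X. dist x x0 \<ge> R1 \<longrightarrow> (\<exists>U\<in>\<V>. F U (e x) \<ge> 1 / 2)"
    using cover_functions[OF fin op covV] by (elim exE conjE)
  have Fc: "\<forall>U\<in>\<V>. continuous_map hX euclideanreal (F U)" using F(1) by simp
  define H where "H = (\<lambda>V. {p \<in> topspace hX. F V p \<in> {1/4..}})"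
  have Hc: "closedin hX (H V)" if "V \<in> \<V>" for V
    unfolding H_def by (rule closedin_continuous_map_preimage[OF bspec[OF Fc that]]) simp
  have HV: "p \<in> V" if "V \<in> \<V>" "p \<in> H V" "p \<in> bdry" for V p
  proof (rule ccontr)
    assume "p \<notin> V"
    then have "F V p = 0" using F(1) that by simp
    then show False using that(2) by (simp add: H_def)
  qed
  \<comment> \<open>On the corona \<open>H V\<close> lies in \<open>V\<close>, so n + 2 of these
    closed sets have no common point there; far out in \<open>X\<close> at most n + 1 of them meet
    at a point.\<close>
  have "\<exists>R. \<forall>x\<in>X. e x \<in> (\<Union>\<W>\<in>{\<W>. \<W> \<subseteq> \<V> \<and> card \<W> = n + 2}. topspace hX \<inter> \<Inter>(H ` \<W>)) \<longrightarrow> dist x x0 < R"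
  proof (rule bounded_off_bdry)
    show "closedin hX (\<Union>\<W>\<in>{\<W>. \<W> \<subseteq> \<V> \<and> card \<W> = n + 2}. topspace hX \<inter> \<Inter>(H ` \<W>))"
    proof (intro closedin_Union)
      show "finite ((\<lambda>\<W>. topspace hX \<inter> \<Inter>(H ` \<W>)) ` {\<W>. \<W> \<subseteq> \<V> \<and> card \<W> = n + 2})"
        using fin by (intro finite_imageI finite_subset[OF _ finite_Pow_iff[THEN iffD2, OF fin]]) auto
      fix S assume "S \<in> (\<lambda>\<W>. topspace hX \<inter> \<Inter>(H ` \<W>)) ` {\<W>. \<W> \<subseteq> \<V> \<and> card \<W> = n + 2}"
      then obtain \<W> where W: "\<W> \<subseteq> \<V>" "card \<W> = n + 2" "S = topspace hX \<inter> \<Inter>(H ` \<W>)" by auto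
      have "\<W> \<noteq> {}" using W(2) by auto
      then have "closedin hX (\<Inter>(H ` \<W>))" using W(1) Hc by (intro closedin_Inter) auto
      then show "closedin hX S" unfolding W(3) by (intro closedin_Int closedin_topspace)
    qed
    show "(\<Union>\<W>\<in>{\<W>. \<W> \<subseteq> \<V> \<and> card \<W> = n + 2}. topspace hX \<inter> \<Inter>(H ` \<W>)) \<inter> bdry = {}"
    proof (rule ccontr)
      assume "\<not> ?thesis"
      then obtain \<W> p where W: "\<W> \<subseteq> \<V>" "card \<W> = n + 2" "p \<in> \<Inter>(H ` \<W>)" "p \<in> bdry" by auto
      have "p \<in> \<Inter>\<W>" using W HV by blast
      moreover have "finite \<W>" using W(2) by (simp add: card_ge_0_finite)
      then have "\<Inter>\<W> = {}" using mult W(1,2) unfolding multiplicity_le_def by simp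
      ultimately show False by simp
    qed
  qed
  then obtain R2 where R2: "\<forall>x\<in>X. e x \<in> (\<Union>\<W>\<in>{\<W>. \<W> \<subseteq> \<V> \<and> card \<W> = n + 2}. topspace hX \<inter> \<Inter>(H ` \<W>)) \<longrightarrow>
     dist x x0 < R2" ..
  \<comment> \<open>In the same way \<open>V\<close> inside \<open>O' (I V)\<close> becomes: far
    out, \<open>H V\<close> lies over \<open>N (I V)\<close>.\<close>
  have "\<exists>R. \<forall>x\<in>X. e x \<in> (\<Union>V\<in>\<V>. H V \<inter> hX closure_of (e ` (X - N (I V)))) \<longrightarrow> dist x x0 < R"
  proof (rule bounded_off_bdry)
    show "closedin hX (\<Union>V\<in>\<V>. H V \<inter> hX closure_of (e ` (X - N (I V))))"
      using fin Hc by (intro closedin_Union) auto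
    show "(\<Union>V\<in>\<V>. H V \<inter> hX closure_of (e ` (X - N (I V)))) \<inter> bdry = {}"
    proof (rule ccontr)
      assume "\<not> ?thesis"
      then obtain V p where V: "V \<in> \<V>" "p \<in> H V" "p \<in> hX closure_of (e ` (X - N (I V)))" "p \<in> bdry" by auto
      then have "p \<in> O' (I V)" using HV I by blast
      then show False using V(3) by (simp add: O'_def)
    qed
  qed
  then obtain R3 where R3: "\<forall>x\<in>X. e x \<in> (\<Union>V\<in>\<V>. H V \<inter> hX closure_of (e ` (X - N (I V)))) \<longrightarrow>
     dist x x0 < R3" ..
  have "(1/4::real) / real (n + 1) > 0" by simp
  from finite_continuous_map_slow[OF fin Fc this]
  obtain \<delta>1 R4 where \<delta>1: "\<delta>1 > 0" and slow: "\<And>U x y. U \<in> \<V> \<Longrightarrow> x \<in> X \<Longrightarrow> y \<in> X \<Longrightarrow> dist x x0 \<ge> R4 \<Longrightarrow>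
     dist x y \<le> \<delta>1 * dist x x0 \<Longrightarrow> \<bar>F U (e x) - F U (e y)\<bar> < (1/4) / real (n + 1)"
    by blast
  define R where "R = max 1 (max (max R1 R2) (max R3 R4))"
  define B where "B = X - ball x0 R"
  have BX: "x \<in> X" "dist x x0 \<ge> 1" "dist x x0 \<ge> R1" "dist x x0 \<ge> R2" "dist x x0 \<ge> R3" "dist x x0 \<ge> R4"
    if "x \<in> B" for x
    using that by (auto simp: B_def R_def dist_commute)
  \<comment> \<open>The shift by 1/4 makes positivity imply membership in \<open>H V\<close>, and
    still leaves a value of at least 1/4 at every far point.\<close>
  define f where "f = (\<lambda>V x. F V (e x) - 1/4)"
  have fH: "e x \<in> H V" if "x \<in> X" "f V x > 0" for V x
    using that e_in by (simp add: H_def f_def)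
  have fcard: "finite {V\<in>\<V>. f V x > 0} \<and> card {V\<in>\<V>. f V x > 0} \<le> n + 1" if x: "x \<in> B" for x
  proof (intro conjI)
    show "finite {V\<in>\<V>. f V x > 0}" using fin by simp
    show "card {V\<in>\<V>. f V x > 0} \<le> n + 1"
    proof (rule ccontr)
      assume "\<not> ?thesis"
      then have "n + 2 \<le> card {V\<in>\<V>. f V x > 0}" by simp
      then obtain \<W> where W: "\<W> \<subseteq> {V\<in>\<V>. f V x > 0}" "card \<W> = n + 2"
        by (rule obtain_subset_with_card_n)
      have "e x \<in> topspace hX \<inter> \<Inter>(H ` \<W>)"
        using W(1) fH BX(1)[OF x] e_in by auto
      then have "dist x x0 < R2" using R2 W BX(1)[OF x] by blast
      then show False using BX(4)[OF x] by simp
    qed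
  qed
  have fbig: "\<exists>V\<in>\<V>. f V x \<ge> 1/4" if x: "x \<in> B" for x
  proof -
    obtain V where "V \<in> \<V>" "F V (e x) \<ge> 1 / 2" using F(2) BX(1,3)[OF x] by auto
    then show ?thesis by (intro bexI[of _ V]) (auto simp: f_def)
  qed
  have fN: "x \<in> N (I V)" if x: "x \<in> B" and V: "V \<in> \<V>" "f V x > 0" for x V
  proof (rule ccontr)
    assume "x \<notin> N (I V)"
    then have "e x \<in> e ` (X - N (I V))" using BX(1)[OF x] by auto
    moreover have "e ` (X - N (I V)) \<subseteq> hX closure_of (e ` (X - N (I V)))"
      using e_in by (intro closure_of_subset) auto
    ultimately have "e x \<in> (\<Union>V\<in>\<V>. H V \<inter> hX closure_of (e ` (X - N (I V))))"
      using fH[OF BX(1)[OF x] V(2)] V(1) by blast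
    then have "dist x x0 < R3" using R3 BX(1)[OF x] by blast
    then show False using BX(5)[OF x] by simp
  qed
  have quarter: "(1/4::real) > 0" by simp
  have "\<exists>(c::'a \<Rightarrow> nat) T. (\<forall>x\<in>B. c x \<le> n) \<and> (\<forall>x\<in>B. T x \<noteq> {} \<and> T x \<subseteq> {V\<in>\<V>. f V x > 0}) \<and>
    (\<forall>x\<in>B. \<forall>y\<in>B. c x = c y \<and> (\<forall>V\<in>\<V>. \<bar>f V x - f V y\<bar> < (1/4) / real (n + 1)) \<longrightarrow> T x = T y)"
    by (rule gap_colouring[OF _ _ quarter]) (use fcard fbig in auto)
  then obtain c :: "'a \<Rightarrow> nat" and T where cT': "\<forall>x\<in>B. c x \<le> n"
    "\<forall>x\<in>B. T x \<noteq> {} \<and> T x \<subseteq> {V\<in>\<V>. f V x > 0}"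
    "\<forall>x\<in>B. \<forall>y\<in>B. c x = c y \<and> (\<forall>V\<in>\<V>. \<bar>f V x - f V y\<bar> < (1/4) / real (n + 1)) \<longrightarrow> T x = T y"
    by (elim exE conjE)
  note cT = bspec[OF cT'(1)] bspec[OF cT'(2)] cT'(3)[rule_format, OF _ _ conjI]
  define \<gamma> where "\<gamma> = min \<delta>1 (min (1 / 2) (\<delta> / 8))"
  have \<gamma>: "\<gamma> > 0" "\<gamma> \<le> \<delta>1" "\<gamma> \<le> 1 / 2" "\<gamma> \<le> \<delta> / 8" using \<delta> \<delta>1 by (auto simp: \<gamma>_def)
  define rl where "rl = chain_rel B c (\<lambda>x. \<gamma> * dist x x0)"
  have stepT: "T x = T y" if xy: "(x, y) \<in> rl" for x y
  proof (rule cT(3))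
    note d = chain_relD[OF xy[unfolded rl_def]]
    show "x \<in> B" "y \<in> B" "c x = c y" using d by auto
    show "\<forall>V\<in>\<V>. \<bar>f V x - f V y\<bar> < (1/4) / real (n + 1)"
    proof
      fix V assume V: "V \<in> \<V>"
      have "\<gamma> * dist x x0 \<le> \<delta>1 * dist x x0" using \<gamma> by (intro mult_right_mono) auto
      then have "dist x y \<le> \<delta>1 * dist x x0" using d by simp
      then show "\<bar>f V x - f V y\<bar> < (1/4) / real (n + 1)"
        using slow[OF V] BX[OF d(1)] BX[OF d(2)] by (simp add: f_def)
    qed
  qed
  have ctl: "controlled B c (\<lambda>x. \<gamma> * dist x x0) (\<lambda>x. \<epsilon> * dist x x0)"
    unfolding controlled_def rl_def[symmetric]
  proof (intro allI impI)
    fix x y assume x: "x \<in> B" and xy: "(x, y) \<in> rl\<^sup>*"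
    \<comment> \<open>\<open>T\<close> is constant along the chain, so one \<open>V\<close>, and
      with it one class \<open>Q i\<close>, accompanies all of its points.\<close>
    obtain V where V: "V \<in> T x" using cT(2)[OF x] by auto
    define i where "i = I V"
    have inN: "z \<in> N i" if "z \<in> B" "T z = T x" for z
      using cT(2)[OF that(1)] that V fN[OF that(1)] by (auto simp: i_def)
    have "\<forall>z\<in>N i. \<exists>w. w \<in> Q i \<and> dist z w \<le> \<beta> * dist z x0" by (auto simp: N_def)
    from bchoice[OF this] obtain w where w: "\<forall>z\<in>N i. w z \<in> Q i \<and> dist z (w z) \<le> \<beta> * dist z x0" ..
    have wN: "w z \<in> A" "a (w z) = i" "dist z (w z) \<le> \<beta> * dist z x0"
      "dist z x0 \<le> 2 * dist (w z) x0" "dist (w z) x0 \<le> 2 * dist z x0" if "z \<in> N i" for z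
    proof -
      have wz: "w z \<in> Q i" "dist z (w z) \<le> \<beta> * dist z x0" using w that by auto
      show "w z \<in> A" "a (w z) = i" using wz by (auto simp: Q_def)
      show "dist z (w z) \<le> \<beta> * dist z x0" by (rule wz(2))
      have "\<beta> * dist z x0 \<le> 1 / 2 * dist z x0" using \<beta> by (intro mult_right_mono) auto
      then show "dist z x0 \<le> 2 * dist (w z) x0" "dist (w z) x0 \<le> 2 * dist z x0"
        using wz(2) dist_triangle[of z x0 "w z"] dist_triangle[of "w z" x0 z]
        by (auto simp: dist_commute)
    qed
    have half: "dist (w z) (w z') \<le> \<delta> * dist (w z) x0"
      if z: "z \<in> N i" "z' \<in> N i" and d: "dist z z' \<le> \<gamma> * dist z x0" for z z'
    proof -
      have "\<gamma> * dist z x0 \<le> 1 / 2 * dist z x0" using \<gamma> by (intro mult_right_mono) auto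
      then have z'2: "dist z' x0 \<le> 2 * dist z x0"
        using d dist_triangle[of z' x0 z] zero_le_dist[of z x0] dist_commute[of z z'] by linarith
      have "dist (w z) (w z') \<le> dist (w z) z + dist z z' + dist z' (w z')"
        using dist_triangle[of "w z" "w z'" z] dist_triangle[of z "w z'" z'] by simp
      also have "\<dots> \<le> \<beta> * dist z x0 + \<gamma> * dist z x0 + \<beta> * dist z' x0"
        using wN(3)[OF z(1)] wN(3)[OF z(2)] d by (simp add: dist_commute)
      also have "\<dots> \<le> \<beta> * dist z x0 + \<gamma> * dist z x0 + \<beta> * (2 * dist z x0)"
        using z'2 \<beta> by (intro add_left_mono mult_left_mono) auto
      also have "\<dots> = (3 * \<beta> + \<gamma>) * dist z x0" by (simp add: algebra_simps)
      also have "\<dots> \<le> (\<delta> / 2) * (2 * dist (w z) x0)"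
        using \<beta> \<gamma> \<delta> wN(4)[OF z(1)] by (intro mult_mono) auto
      finally show ?thesis by simp
    qed
    define ra where "ra = chain_rel A a (\<lambda>x. \<delta> * dist x x0)"
    have main: "y \<in> B \<and> T y = T x \<and> (w x, w y) \<in> ra\<^sup>*"
      using xy
    proof (induction rule: rtrancl_induct)
      case base
      show ?case using x by simp
    next
      case (step y z)
      note d = chain_relD[OF step(2)[unfolded rl_def]]
      have Tz: "T z = T x" using stepT[OF step(2)] step(3) by simp
      have N: "y \<in> N i" "z \<in> N i" using inN d Tz step(3) by auto
      have "dist (w y) (w z) \<le> \<delta> * dist (w y) x0" by (rule half[OF N d(4)])
      moreover have "dist (w z) (w y) \<le> \<delta> * dist (w z) x0"
        by (rule half[OF N(2,1)]) (use d(5) in \<open>simp add: dist_commute\<close>)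
      ultimately have "(w y, w z) \<in> ra"
        using wN[OF N(1)] wN[OF N(2)] by (simp add: ra_def chain_rel_def dist_commute)
      then show ?case using step(3) Tz d(2) by (auto intro: rtrancl_into_rtrancl)
    qed
    have N: "x \<in> N i" "y \<in> N i" using inN x main by auto
    have "dist (w x) (w y) \<le> \<epsilon> / 8 * dist (w x) x0"
      using controlledD[OF a(2)[folded A_def] wN(1)[OF N(1)]] main by (simp add: ra_def)
    also have "\<dots> \<le> \<epsilon> / 8 * (2 * dist x x0)" using wN(5)[OF N(1)] \<epsilon> by (intro mult_left_mono) auto
    finally have wxy: "dist (w x) (w y) \<le> \<epsilon> / 4 * dist x x0" by simp
    have "dist x y \<le> dist x (w x) + dist (w x) (w y) + dist (w y) y"
      using dist_triangle[of x y "w x"] dist_triangle[of "w x" y "w y"] by simp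
    also have "\<dots> \<le> \<beta> * dist x x0 + \<epsilon> / 4 * dist x x0 + \<beta> * dist y x0"
      using wN(3)[OF N(1)] wN(3)[OF N(2)] wxy by (simp add: dist_commute)
    \<comment> \<open>The norm of \<open>y\<close> is bounded through \<open>dist x y\<close>
      itself, which is absorbed into the left-hand side because \<beta> \<le> 1/2.\<close>
    also have "\<dots> \<le> \<beta> * dist x x0 + \<epsilon> / 4 * dist x x0 + \<beta> * (dist x y + dist x x0)"
      using \<beta> dist_triangle[of y x0 x] by (intro add_left_mono mult_left_mono) (auto simp: dist_commute)
    also have "\<dots> = (2 * \<beta> + \<epsilon> / 4) * dist x x0 + \<beta> * dist x y" by (simp add: algebra_simps)
    also have "\<dots> \<le> (\<epsilon> / 2) * dist x x0 + 1 / 2 * dist x y"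
      using \<beta> by (intro add_mono mult_right_mono) auto
    finally show "dist x y \<le> \<epsilon> * dist x x0" by simp
  qed
  have "\<forall>\<^sub>F R' in at_top. \<exists>c::'a \<Rightarrow> nat. (\<forall>x\<in>X - ball x0 R'. c x \<le> n) \<and>
     controlled (X - ball x0 R') c (\<lambda>x. \<gamma> * dist x x0) (\<lambda>x. \<epsilon> * dist x x0)"
    using eventually_ge_at_top[of R]
  proof eventually_elim
    case (elim R')
    have sub: "X - ball x0 R' \<subseteq> B" using elim by (auto simp: B_def)
    have "controlled (X - ball x0 R') c (\<lambda>x. \<gamma> * dist x x0) (\<lambda>x. \<epsilon> * dist x x0)"
      by (rule controlled_mono[OF ctl sub]) auto
    then show ?case using cT(1) sub by (intro exI[of _ c]) auto
  qed
  then show "\<exists>\<delta>>0. \<forall>\<^sub>F R in at_top. \<exists>c::'a \<Rightarrow> nat. (\<forall>x\<in>X - ball x0 R. c x \<le> n) \<and>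
     controlled (X - ball x0 R) c (\<lambda>x. \<delta> * dist x x0) (\<lambda>x. \<epsilon> * dist x x0)"
    using \<gamma>(1) by blast
qed

lemma bounded_imp_covering_dim_le:
  assumes "bounded X"
  shows "covering_dim_le (corona X hX e) n"
proof -
  obtain R where "\<forall>x\<in>X. dist x0 x \<le> R" using assms unfolding bounded_any_center[of X x0] ..
  then have "hX closure_of (e ` X) \<inter> bdry = {}"
    by (intro closure_image_ball_off_bdry[of X R]) auto
  then have "bdry = {}" unfolding dense by auto
  then show ?thesis
    unfolding covering_dim_le_def topspace_corona
    by (intro allI impI exI[of _ "{}"]) (auto simp: multiplicity_le_def)
qed

end

section \<open>Bounded spaces and the comparison of dimensions\<close>

lemma bounded_imp_AN_asdim_le:
  fixes X :: "'a::metric_space set"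
  assumes "bounded X" "X \<noteq> {}"
  shows "AN_asdim_le X n"
proof -
  obtain D where D: "\<And>x y. x \<in> X \<Longrightarrow> y \<in> X \<Longrightarrow> dist x y \<le> D"
    using assms(1) unfolding bounded_two_points by blast
  have "\<Union>{X} = X \<and> mesh {X} \<le> ennreal (1 * r) \<and> Lebesgue_number X {X} > ennreal r \<and>
     multiplicity_le {X} (n + 1)" if r: "r \<ge> max 1 D" for r
  proof (intro conjI)
    have "ediam X \<le> ennreal (1 * r)"
      unfolding ediam_def
    proof (intro SUP_least ennreal_leI)
      fix x y assume "x \<in> X" "y \<in> X"
      then show "dist x y \<le> 1 * r" using D[of x y] r by simp
    qed
    then show "mesh {X} \<le> ennreal (1 * r)" by (simp add: mesh_def)
    \<comment> \<open>The complement of \<open>X\<close> in \<open>X\<close> is empty, so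
      \<open>esetdist\<close> is an infimum over the empty set, that is, infinite.\<close>
    show "Lebesgue_number X {X} > ennreal r" by (simp add: Lebesgue_number_def esetdist_def assms(2))
    show "multiplicity_le {X} (n + 1)"
      unfolding multiplicity_le_def
    proof (intro allI impI)
      fix \<V> assume "\<V> \<subseteq> {X}" "finite \<V> \<and> card \<V> = n + 1 + 1"
      then show "\<Inter>\<V> = {}" using card_mono[of "{X}" \<V>] by simp
    qed
  qed simp
  moreover have "(1::real) > 0" "max 1 D > 0" by auto
  ultimately show ?thesis unfolding AN_asdim_le_def by blast
qed

theorem corollary3p11:
  fixes X :: "'a::metric_space set" and x0 :: 'a
    and hX :: "'b topology" and e :: "'a \<Rightarrow> 'b"
  assumes "x0 \<in> X"
    and "proper_metric X" and "connected X" and "cocompact X"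
    and "AN_asdim X < \<infinity>"
    and "sublinear_Higson_compactification X x0 hX e"
  shows "AN_asdim X = covering_dim (corona X hX e)"
proof -
  interpret sublinear_Higson X x0 hX e
    using assms(2,6) by unfold_locales
  obtain m where m: "AN_asdim_le X m"
  proof (rule ccontr)
    assume "\<not> thesis"
    then have "{n. AN_asdim_le X n} = {}" using that by blast
    then show False using assms(5) by (simp add: AN_asdim_def top_enat_def)
  qed
  \<comment> \<open>Both dimensions are least elements of sets of admissible numbers, and these sets
    agree. In the unbounded case the finite bound \<open>m\<close> enters the converse twice: it
    gives the sizes near infinity and the pieces to be moved.\<close>
  have "AN_asdim_le X n \<longleftrightarrow> covering_dim_le (corona X hX e) n" for n
  proof (cases "bounded X")
    case True
    then show ?thesis
      using bounded_imp_AN_asdim_le[OF True] bounded_imp_covering_dim_le[OF True] assms(1) by blast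
  next
    case False
    show ?thesis
    proof
      assume "AN_asdim_le X n"
      then show "covering_dim_le (corona X hX e) n"
        by (intro small_colourable_imp_covering_dim_le small_colourable_linear
            AN_asdim_le_imp_small_colourable False)
    next
      assume dim: "covering_dim_le (corona X hX e) n"
      have sm: "small_colourable m at_top (\<lambda>R. X) (\<lambda>R _. R)"
        by (rule AN_asdim_le_imp_small_colourable[OF False m])
      have "small_colourable n at_top (\<lambda>R. X - ball x0 R) (\<lambda>R x. dist x x0)"
        by (rule covering_dim_le_imp_small_colourable[OF dim small_colourable_linear[OF sm]])
      then show "AN_asdim_le X n"
        by (intro small_colourable_imp_AN_asdim_le
            small_colourable_linear_imp_global[OF assms(3) False assms(4,1) _ sm])
    qed
  qed
  then show ?thesis by (simp add: AN_asdim_def covering_dim_def)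
qed

end
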